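(* Let $\lambda=\Delta(q^2)/\Delta(q)$. Every element of $\mathbb{Q}_2[\lambda]$ (polynomials in $\lambda$ with coefficients in $\mathbb{Q}_2$, viewed as $q$-series) lies in the image of the $2$-adic character map $\widehat F_S:S_1\to\mathcal M_2$.
   Context: Let $E_k(q)=1-\frac{2k}{B_k}\sum_{n\ge1}\sigma_{k-1}(n)q^n$ ($B_k$ the Bernoulli numbers), $\Delta=(E_4^3-E_6^2)/1728$. The ring $\mathcal{M}_2$ of $2$-adic modular forms is the completion of $\mathbb{Q}_2[E_4,E_6]$ inside $\mathbb{Q}_2[[q]]$ for the sup-norm of coefficients. Let $S$ be the Heisenberg vertex operator algebra of central charge $1$ over $\mathbb{Q}_2$: as a vector space $S=\mathbb{Q}_2[h(-1),h(-2),\dots]\mathbf 1$, where for $n\ge1$ the mode $h(-n)$ acts by multiplication, $h(n)$ acts as $n\,\partial/\partial h(-n)$, and $h(0)=0$; the weight of $h(-n_1)\cdots h(-n_r)\mathbf 1$ is $\sum n_i$, giving $S=\bigoplus_{n\ge0}S_{(n)}$. The normalized character of $v\in S$ is $F_S(v,q)=q^{-1/24}\eta(q)\sum_{n\ge0}\mathrm{Tr}_{S_{(n)}}o(v)\,q^n$, with $\eta(q)=q^{1/24}\prod_{n\ge1}(1-q^n)$ and $o(v)$ the grading-preserving zero mode of $v$. For a monomial $h^I=\prod_{i\in I}h(i)\mathbf 1$ put $|\sum_I a_Ih^I|=\sup_I|a_I|_2$; $S_1$ is the completion of $S$ for this norm. The $2$-adic character map $\widehat F_S:S_1\to\mathcal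 M_2$ is the continuous linear extension of $F_S$. *)

theory Defs
  imports
    "HOL-Analysis.Analysis"
    "HOL-Computational_Algebra.Formal_Power_Series"
    "HOL-Computational_Algebra.Polynomial"
    "HOL-Library.Poly_Mapping"
begin

section \<open>The field of 2-adic numbers\<close>

subsection \<open>The 2-adic absolute value on the rationals\<close>

definition abs2 :: "rat \<Rightarrow> real" where
  "abs2 x = (if x = 0 then 0 else
     2 powi (int (multiplicity 2 (snd (quotient_of x))) - int (multiplicity 2 (fst (quotient_of x)))))"

lemma abs2_0 [simp]: "abs2 0 = 0"
  by (simp add: abs2_def)

lemma abs2_of_int_div:
  assumes "a \<noteq> 0" "b \<noteq> 0"
  shows "abs2 (of_int a / of_int b) = 2 powi (int (multiplicity 2 b) - int (multiplicity 2 a))"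
proof -
  define c d where "c = fst (quotient_of (of_int a / of_int b))"
    and "d = snd (quotient_of (of_int a / of_int b))"
  have q: "quotient_of (of_int a / of_int b) = (c, d)"
    by (simp add: c_def d_def)
  have d: "d > 0" using q by (rule quotient_of_denom_pos)
  have eq: "(of_int a / of_int b :: rat) = of_int c / of_int d"
    using q by (rule quotient_of_div)
  have c: "c \<noteq> 0" using eq assms d by auto
  have "(of_int (a * d) :: rat) = of_int (c * b)"
    using eq assms d by (simp add: field_simps)
  hence "a * d = c * b" by (simp only: of_int_eq_iff)
  hence "multiplicity 2 (a * d) = multiplicity 2 (c * b)" by simp
  hence "multiplicity 2 a + multiplicity 2 d = multiplicity 2 c + multiplicity 2 b"
    using assms c d by (simp add: prime_elem_multiplicity_mult_distrib)
  hence "int (multiplicity 2 b) - int (multiplicity 2 a) = int (multiplicity 2 d) - int (multiplicity 2 c)"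
    by linarith
  thus ?thesis using assms q by (simp add: abs2_def)
qed

lemma rat_int_div_cases:
  fixes x :: rat
  assumes "x \<noteq> 0"
  obtains a b :: int where "a \<noteq> 0" "b \<noteq> 0" "x = of_int a / of_int b"
proof (cases x rule: Rat_cases)
  case (Fract a b)
  thus ?thesis using assms by (intro that[of a b]) (auto simp: Fract_of_int_quotient)
qed

lemma abs2_nonneg [simp]: "abs2 x \<ge> 0"
  by (simp add: abs2_def)

lemma abs2_eq_0_iff [simp]: "abs2 x = 0 \<longleftrightarrow> x = 0"
  by (simp add: abs2_def)

lemma abs2_1 [simp]: "abs2 1 = 1"
  using abs2_of_int_div[of 1 1] by simp

lemma abs2_mult: "abs2 (x * y) = abs2 x * abs2 y"
proof (cases "x = 0 \<or> y = 0")
  case False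
  then obtain a b c d :: int where *: "a \<noteq> 0" "b \<noteq> 0" "x = of_int a / of_int b"
     "c \<noteq> 0" "d \<noteq> 0" "y = of_int c / of_int d"
    by (metis rat_int_div_cases)
  have "x * y = of_int (a * c) / of_int (b * d)" using * by simp
  hence "abs2 (x * y) = 2 powi (int (multiplicity 2 (b * d)) - int (multiplicity 2 (a * c)))"
    using * by (simp only: abs2_of_int_div mult_eq_0_iff simp_thms)
  also have "int (multiplicity 2 (b * d)) - int (multiplicity 2 (a * c)) =
      (int (multiplicity 2 b) - int (multiplicity 2 a)) + (int (multiplicity 2 d) - int (multiplicity 2 c))"
    using * by (simp add: prime_elem_multiplicity_mult_distrib)
  also have "2 powi \<dots> = abs2 x * abs2 y"
    using * by (subst power_int_add) (simp_all add: abs2_of_int_div)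
  finally show ?thesis .
qed auto

lemma abs2_minus [simp]: "abs2 (- x) = abs2 x"
proof -
  have "multiplicity 2 (-1 :: int) = 0" by (intro not_dvd_imp_multiplicity_0) auto
  hence "abs2 (-1) = 1" using abs2_of_int_div[of "-1" 1] by simp
  thus ?thesis using abs2_mult[of "-1" x] by simp
qed

lemma abs2_minus_commute: "abs2 (x - y) = abs2 (y - x)"
  using abs2_minus[of "x - y"] by simp

lemma abs2_inverse: "abs2 (inverse x) = inverse (abs2 x)"
  by (cases "x = 0") (metis abs2_0 inverse_zero, metis abs2_1 abs2_mult inverse_unique right_inverse)

lemma abs2_ultra: "abs2 (x + y) \<le> max (abs2 x) (abs2 y)"
proof (cases "x = 0 \<or> y = 0 \<or> x + y = 0")
  case False
  then obtain a b c d :: int where *: "a \<noteq> 0" "b \<noteq> 0" "x = of_int a / of_int b"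
     "c \<noteq> 0" "d \<noteq> 0" "y = of_int c / of_int d"
    by (metis rat_int_div_cases)
  define m where "m = min (multiplicity 2 (a * d)) (multiplicity 2 (c * b))"
  have x: "x = of_int (a * d) / of_int (b * d)" and y: "y = of_int (c * b) / of_int (b * d)"
    and xy: "x + y = of_int (a * d + c * b) / of_int (b * d)"
    using * by (simp_all add: field_simps)
  have nz: "a * d + c * b \<noteq> 0"
  proof
    assume "a * d + c * b = 0"
    hence "x + y = 0" unfolding xy by (simp only: of_int_0 div_0)
    thus False using False by simp
  qed
  have "2 ^ m dvd a * d" "2 ^ m dvd c * b"
    by (simp_all add: m_def multiplicity_dvd')
  hence "2 ^ m dvd a * d + c * b" by simp
  hence m: "m \<le> multiplicity 2 (a * d + c * b)"
    using nz by (intro multiplicity_geI) auto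
  have "abs2 (x + y) = 2 powi (int (multiplicity 2 (b * d)) - int (multiplicity 2 (a * d + c * b)))"
    unfolding xy using nz * by (intro abs2_of_int_div) auto
  also have "\<dots> \<le> 2 powi (int (multiplicity 2 (b * d)) - int m)"
    using m by (intro power_int_increasing) auto
  also have "\<dots> \<le> max (abs2 x) (abs2 y)"
  proof (cases "m = multiplicity 2 (a * d)")
    case True
    have "abs2 x = 2 powi (int (multiplicity 2 (b * d)) - int m)"
      unfolding x True using * by (intro abs2_of_int_div) auto
    thus ?thesis by simp
  next
    case False
    hence m': "m = multiplicity 2 (c * b)" by (auto simp: m_def min_def split: if_splits)
    have "abs2 y = 2 powi (int (multiplicity 2 (b * d)) - int m)"
      unfolding y m' using * by (intro abs2_of_int_div) auto
    thus ?thesis by simp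
  qed
  finally show ?thesis .
qed (auto simp: le_max_iff_disj)

lemma abs2_triangle: "abs2 (x + y) \<le> abs2 x + abs2 y"
  using abs2_ultra[of x y] abs2_nonneg[of x] abs2_nonneg[of y] by linarith

lemma abs2_triangle_diff: "abs2 (x - y) \<le> abs2 x + abs2 y"
  using abs2_triangle[of x "- y"] by simp

lemma abs2_diff_abs: "\<bar>abs2 x - abs2 y\<bar> \<le> abs2 (x - y)"
  using abs2_triangle[of "x - y" y] abs2_triangle[of "y - x" x] abs2_minus_commute[of x y] by simp


subsection \<open>Cauchy sequences and null sequences\<close>

definition cauchy2 :: "(nat \<Rightarrow> rat) \<Rightarrow> bool" where
  "cauchy2 X \<longleftrightarrow> (\<forall>e>0. \<exists>N. \<forall>m\<ge>N. \<forall>n\<ge>N. abs2 (X m - X n) < e)"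

definition null2 :: "(nat \<Rightarrow> rat) \<Rightarrow> bool" where
  "null2 X \<longleftrightarrow> (\<lambda>n. abs2 (X n)) \<longlonglongrightarrow> 0"

lemma null2_const [simp]: "null2 (\<lambda>n. c) \<longleftrightarrow> c = 0"
  by (simp add: null2_def tendsto_const_iff)

lemma null2_minus: "null2 X \<Longrightarrow> null2 (\<lambda>n. - X n)"
  by (simp add: null2_def)

lemma null2_le:
  assumes "g \<longlonglongrightarrow> 0" "\<And>n. abs2 (X n) \<le> g n"
  shows "null2 X"
  unfolding null2_def
  by (rule tendsto_sandwich[OF _ _ tendsto_const assms(1)]) (auto simp: assms)

lemma null2_add: "null2 X \<Longrightarrow> null2 Y \<Longrightarrow> null2 (\<lambda>n. X n + Y n)"
  unfolding null2_def[of X] null2_def[of Y]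
  by (rule null2_le[where g = "\<lambda>n. abs2 (X n) + abs2 (Y n)"])
     (auto intro: abs2_triangle tendsto_add_zero)

lemma null2_diff: "null2 X \<Longrightarrow> null2 Y \<Longrightarrow> null2 (\<lambda>n. X n - Y n)"
  using null2_add[OF _ null2_minus] by fastforce

lemma cauchy2_const [simp]: "cauchy2 (\<lambda>n. c)"
  by (simp add: cauchy2_def)

lemma cauchy2_le:
  assumes "cauchy2 X" "cauchy2 Y" "C > 0"
    and le: "\<And>m n. abs2 (Z m - Z n) \<le> C * (abs2 (X m - X n) + abs2 (Y m - Y n))"
  shows "cauchy2 Z"
  unfolding cauchy2_def
proof safe
  fix e :: real assume "e > 0"
  hence e: "e / (2 * C) > 0" using assms(3) by simp
  obtain M where M: "\<forall>m\<ge>M. \<forall>n\<ge>M. abs2 (X m - X n) < e / (2 * C)"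
    using assms(1) e unfolding cauchy2_def by blast
  obtain N where N: "\<forall>m\<ge>N. \<forall>n\<ge>N. abs2 (Y m - Y n) < e / (2 * C)"
    using assms(2) e unfolding cauchy2_def by blast
  show "\<exists>N. \<forall>m\<ge>N. \<forall>n\<ge>N. abs2 (Z m - Z n) < e"
  proof (intro exI[of _ "max M N"] allI impI)
    fix m n assume mn: "m \<ge> max M N" "n \<ge> max M N"
    have "abs2 (Z m - Z n) \<le> C * (abs2 (X m - X n) + abs2 (Y m - Y n))" by (rule le)
    also have "\<dots> < C * (e / (2 * C) + e / (2 * C))"
      using mn M N assms(3) by (intro mult_strict_left_mono add_strict_mono) auto
    also have "\<dots> = e" using assms(3) by (simp add: field_simps)
    finally show "abs2 (Z m - Z n) < e" .
  qed
qed

lemma cauchy2_minus: "cauchy2 X \<Longrightarrow> cauchy2 (\<lambda>n. - X n)"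
proof -
  have "abs2 (- X m - - X n) \<le> 1 * (abs2 (X m - X n) + abs2 (X m - X n))" for m n
    using abs2_minus_commute[of "X m" "X n"] by simp
  thus "cauchy2 X \<Longrightarrow> cauchy2 (\<lambda>n. - X n)" by (rule cauchy2_le[rotated 3]) auto
qed

lemma cauchy2_add: "cauchy2 X \<Longrightarrow> cauchy2 Y \<Longrightarrow> cauchy2 (\<lambda>n. X n + Y n)"
  by (rule cauchy2_le[where C = 1 and X = X and Y = Y])
     (simp_all add: add_diff_add abs2_triangle)

lemma cauchy2_convergent:
  assumes "cauchy2 X"
  shows "convergent (\<lambda>n. abs2 (X n))"
proof (rule Cauchy_convergent, rule metric_CauchyI)
  fix e :: real assume "e > 0"
  then obtain N where N: "\<forall>m\<ge>N. \<forall>n\<ge>N. abs2 (X m - X n) < e"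
    using assms unfolding cauchy2_def by blast
  show "\<exists>N. \<forall>m\<ge>N. \<forall>n\<ge>N. dist (abs2 (X m)) (abs2 (X n)) < e"
  proof (intro exI[of _ N] allI impI)
    fix m n assume "m \<ge> N" "n \<ge> N"
    hence "abs2 (X m - X n) < e" using N by blast
    thus "dist (abs2 (X m)) (abs2 (X n)) < e"
      unfolding dist_real_def by (rule order_le_less_trans[OF abs2_diff_abs])
  qed
qed

lemma cauchy2_bounded:
  assumes "cauchy2 X"
  obtains B where "B > 0" "\<And>n. abs2 (X n) \<le> B"
proof -
  have "Bseq (\<lambda>n. abs2 (X n))"
    using cauchy2_convergent[OF assms] by (rule convergent_imp_Bseq)
  thus ?thesis using that by (auto elim!: BseqE)
qed

lemma cauchy2_mult:
  assumes "cauchy2 X" "cauchy2 Y"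
  shows "cauchy2 (\<lambda>n. X n * Y n)"
proof -
  obtain A where A: "A > 0" "\<And>n. abs2 (X n) \<le> A" using cauchy2_bounded[OF assms(1)] by blast
  obtain B where B: "B > 0" "\<And>n. abs2 (Y n) \<le> B" using cauchy2_bounded[OF assms(2)] by blast
  show ?thesis
  proof (rule cauchy2_le[OF assms, of "A + B"])
    fix m n
    have "abs2 (X m * Y m - X n * Y n) = abs2 (X m * (Y m - Y n) + (X m - X n) * Y n)"
      by (simp add: algebra_simps)
    also have "\<dots> \<le> abs2 (X m) * abs2 (Y m - Y n) + abs2 (X m - X n) * abs2 (Y n)"
      by (metis abs2_mult abs2_triangle)
    also have "\<dots> \<le> (A + B) * abs2 (Y m - Y n) + abs2 (X m - X n) * (A + B)"
      by (intro add_mono mult_mono)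
         (use A B in \<open>auto intro: order_trans[OF A(2)] order_trans[OF B(2)]\<close>)
    finally show "abs2 (X m * Y m - X n * Y n) \<le> (A + B) * (abs2 (X m - X n) + abs2 (Y m - Y n))"
      by (simp add: algebra_simps)
  qed (use A B in auto)
qed

lemma null2_mult:
  assumes "cauchy2 X" "null2 Y"
  shows "null2 (\<lambda>n. X n * Y n)"
proof -
  obtain A where A: "A > 0" "\<And>n. abs2 (X n) \<le> A" using cauchy2_bounded[OF assms(1)] by blast
  show ?thesis
  proof (rule null2_le)
    show "(\<lambda>n. A * abs2 (Y n)) \<longlonglongrightarrow> 0"
      using assms(2) unfolding null2_def by (rule tendsto_mult_right_zero)
    show "abs2 (X n * Y n) \<le> A * abs2 (Y n)" for n
      using A by (simp add: abs2_mult mult_right_mono)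
  qed
qed

lemma cauchy2_not_null2:
  assumes "cauchy2 X" "\<not> null2 X"
  obtains c N where "c > 0" "\<And>n. n \<ge> N \<Longrightarrow> abs2 (X n) \<ge> c"
proof -
  obtain L where L: "(\<lambda>n. abs2 (X n)) \<longlonglongrightarrow> L"
    using cauchy2_convergent[OF assms(1)] by (auto simp: convergent_def)
  have "L \<ge> 0" by (rule LIMSEQ_le_const[OF L]) auto
  moreover have "L \<noteq> 0" using L assms(2) by (auto simp: null2_def)
  ultimately have "L / 2 < L" "L > 0" by auto
  from order_tendstoD(1)[OF L this(1)] obtain N where "\<forall>n\<ge>N. L / 2 < abs2 (X n)"
    by (auto simp: eventually_sequentially)
  with \<open>L > 0\<close> show ?thesis by (intro that[of "L / 2" N]) auto
qed

lemma abs2_inverse_diff: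
  assumes "abs2 x \<ge> c" "abs2 y \<ge> c" "c > 0"
  shows "abs2 (inverse x - inverse y) \<le> inverse c * inverse c * abs2 (x - y)"
proof -
  have nz: "x \<noteq> 0" "y \<noteq> 0" using assms by auto
  have "inverse x - inverse y = inverse x * inverse y * (y - x)"
    using nz by (simp add: field_simps)
  hence "abs2 (inverse x - inverse y) = inverse (abs2 x) * inverse (abs2 y) * abs2 (x - y)"
    by (simp add: abs2_mult abs2_inverse abs2_minus_commute)
  also have "\<dots> \<le> inverse c * inverse c * abs2 (x - y)"
    using assms by (intro mult_right_mono mult_mono) (auto intro: le_imp_inverse_le)
  finally show ?thesis .
qed

lemma cauchy2_inverse:
  assumes "cauchy2 X" "\<not> null2 X"
  shows "cauchy2 (\<lambda>n. inverse (X n))"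
  unfolding cauchy2_def
proof safe
  fix e :: real assume e: "e > 0"
  obtain c N where c: "c > 0" "\<And>n. n \<ge> N \<Longrightarrow> abs2 (X n) \<ge> c"
    using cauchy2_not_null2[OF assms] by blast
  have "e * c * c > 0" using e c by simp
  then obtain M where M: "\<forall>m\<ge>M. \<forall>n\<ge>M. abs2 (X m - X n) < e * c * c"
    using assms(1) unfolding cauchy2_def by blast
  show "\<exists>N. \<forall>m\<ge>N. \<forall>n\<ge>N. abs2 (inverse (X m) - inverse (X n)) < e"
  proof (intro exI[of _ "max M N"] allI impI)
    fix m n assume mn: "m \<ge> max M N" "n \<ge> max M N"
    have "abs2 (inverse (X m) - inverse (X n)) \<le> inverse c * inverse c * abs2 (X m - X n)"
      using c mn by (intro abs2_inverse_diff) auto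
    also have "\<dots> < inverse c * inverse c * (e * c * c)"
      using mn M c by (intro mult_strict_left_mono) auto
    also have "\<dots> = e" using c by (simp add: field_simps)
    finally show "abs2 (inverse (X m) - inverse (X n)) < e" .
  qed
qed

lemma null2_inverse_diff:
  assumes "cauchy2 X" "\<not> null2 X" "cauchy2 Y" "\<not> null2 Y" "null2 (\<lambda>n. X n - Y n)"
  shows "null2 (\<lambda>n. inverse (X n) - inverse (Y n))"
proof -
  obtain c N where c: "c > 0" "\<And>n. n \<ge> N \<Longrightarrow> abs2 (X n) \<ge> c"
    using cauchy2_not_null2[OF assms(1,2)] by blast
  obtain d M where d: "d > 0" "\<And>n. n \<ge> M \<Longrightarrow> abs2 (Y n) \<ge> d"
    using cauchy2_not_null2[OF assms(3,4)] by blast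
  define b where "b = min c d"
  have b: "b > 0" "\<And>n. n \<ge> max N M \<Longrightarrow> abs2 (X n) \<ge> b \<and> abs2 (Y n) \<ge> b"
    using c d unfolding b_def by (force simp: min_le_iff_disj)+
  have ev: "\<forall>\<^sub>F n in sequentially.
      abs2 (inverse (X n) - inverse (Y n)) \<le> inverse b * inverse b * abs2 (X n - Y n)"
    using eventually_ge_at_top[of "max N M"]
    by eventually_elim (use b abs2_inverse_diff in blast)
  have "(\<lambda>n. inverse b * inverse b * abs2 (X n - Y n)) \<longlonglongrightarrow> 0"
    using assms(5) unfolding null2_def by (rule tendsto_mult_right_zero)
  thus ?thesis unfolding null2_def
    by (intro tendsto_sandwich[OF _ ev tendsto_const]) auto
qed


subsection \<open>The completion\<close>

definition q2rel :: "(nat \<Rightarrow> rat) \<Rightarrow> (nat \<Rightarrow> rat) \<Rightarrow> bool" where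
  "q2rel X Y \<longleftrightarrow> cauchy2 X \<and> cauchy2 Y \<and> null2 (\<lambda>n. X n - Y n)"

lemma part_equivp_q2rel: "part_equivp q2rel"
proof (rule part_equivpI)
  show "\<exists>X. q2rel X X" by (rule exI[of _ "\<lambda>_. 0"]) (simp add: q2rel_def)
  show "symp q2rel"
    by (rule sympI) (simp add: q2rel_def null2_def abs2_minus_commute)
  show "transp q2rel"
  proof (rule transpI)
    fix X Y Z assume *: "q2rel X Y" "q2rel Y Z"
    have "null2 (\<lambda>n. (X n - Y n) + (Y n - Z n))"
      using * unfolding q2rel_def by (intro null2_add) auto
    thus "q2rel X Z" using * by (simp add: q2rel_def)
  qed
qed

text \<open>\<open>q2\<close> is the field of 2-adic numbers.\<close>

quotient_type q2 = "nat \<Rightarrow> rat" / partial: q2rel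
  by (rule part_equivp_q2rel)

lemma Domainp_pcr_q2 [transfer_domain_rule]: "Domainp pcr_q2 = cauchy2"
  by (simp add: q2.domain_eq q2rel_def)

instantiation q2 :: field
begin

lift_definition zero_q2 :: q2 is "\<lambda>_. 0" by (simp add: q2rel_def)

lift_definition one_q2 :: q2 is "\<lambda>_. 1" by (simp add: q2rel_def)

lift_definition plus_q2 :: "q2 \<Rightarrow> q2 \<Rightarrow> q2" is "\<lambda>X Y n. X n + Y n"
  unfolding q2rel_def add_diff_add by (auto intro: cauchy2_add null2_add)

lift_definition uminus_q2 :: "q2 \<Rightarrow> q2" is "\<lambda>X n. - X n"
  unfolding q2rel_def minus_diff_minus by (intro conjI cauchy2_minus null2_minus) auto

lift_definition times_q2 :: "q2 \<Rightarrow> q2 \<Rightarrow> q2" is "\<lambda>X Y n. X n * Y n"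
proof -
  fix X X' Y Y' assume *: "q2rel X X'" "q2rel Y Y'"
  have "null2 (\<lambda>n. X n * (Y n - Y' n) + Y' n * (X n - X' n))"
    using * by (intro null2_add null2_mult) (auto simp: q2rel_def)
  thus "q2rel (\<lambda>n. X n * Y n) (\<lambda>n. X' n * Y' n)"
    using * by (simp add: q2rel_def cauchy2_mult algebra_simps)
qed

lift_definition inverse_q2 :: "q2 \<Rightarrow> q2" is
  "\<lambda>X. if null2 X then (\<lambda>_. 0) else (\<lambda>n. inverse (X n))"
proof -
  fix X Y assume *: "q2rel X Y"
  have "null2 X \<longleftrightarrow> null2 Y"
    using * null2_diff[of X "\<lambda>n. X n - Y n"] null2_add[of "\<lambda>n. X n - Y n" Y]
    by (auto simp: q2rel_def)
  thus "?thesis X Y"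
    using * by (auto simp: q2rel_def intro: cauchy2_inverse null2_inverse_diff)
qed

definition "x - y = x + - y" for x y :: q2

definition "x div y = x * inverse y" for x y :: q2

instance
proof
  fix a b c :: q2
  show "a + b = b + a"
    by transfer (simp add: ac_simps q2rel_def cauchy2_add)
  show "(a + b) + c = a + (b + c)"
    by transfer (simp add: ac_simps q2rel_def cauchy2_add)
  show "0 + a = a"
    by transfer (simp add: q2rel_def)
  show "- a + a = 0"
    by transfer (simp add: q2rel_def)
  show "a - b = a + - b"
    by (rule minus_q2_def)
  show "(a * b) * c = a * (b * c)"
    by transfer (simp add: ac_simps q2rel_def cauchy2_mult)
  show "a * b = b * a"
    by transfer (simp add: ac_simps q2rel_def cauchy2_mult)
  show "1 * a = a"
    by transfer (simp add: ac_simps q2rel_def)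
  show "(a + b) * c = a * c + b * c"
    by transfer (simp add: distrib_right q2rel_def cauchy2_mult cauchy2_add)
  show "(0::q2) \<noteq> 1"
    by transfer (simp add: q2rel_def)
  have "null2 (\<lambda>n. inverse (X n) * X n - 1)" if X: "cauchy2 X" "\<not> null2 X" for X
  proof -
    obtain d N where d: "d > 0" "\<And>n. n \<ge> N \<Longrightarrow> abs2 (X n) \<ge> d"
      using cauchy2_not_null2[OF X] by blast
    have "\<forall>\<^sub>F n in sequentially. abs2 (inverse (X n) * X n - 1) = 0"
      using eventually_ge_at_top[of N]
    proof eventually_elim
      case (elim n)
      hence "X n \<noteq> 0" using d(1) d(2)[of n] by auto
      thus ?case by simp
    qed
    thus ?thesis unfolding null2_def by (rule tendsto_eventually)
  qed
  thus "a \<noteq> 0 \<Longrightarrow> inverse a * a = 1"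
    by transfer (simp add: q2rel_def cauchy2_mult cauchy2_inverse)
  show "a div b = a * inverse b"
    by (rule divide_q2_def)
  show "inverse (0::q2) = 0"
    by transfer (simp add: q2rel_def)
qed

end

text \<open>
  The absolute value, extended from the rationals by continuity.  The overloaded \<open>norm\<close> is not
  available here, since it is reserved for real normed spaces.
\<close>

lift_definition norm2 :: "q2 \<Rightarrow> real" is "\<lambda>X. lim (\<lambda>n. abs2 (X n))"
proof -
  fix X Y assume *: "q2rel X Y"
  obtain L where L: "(\<lambda>n. abs2 (X n)) \<longlonglongrightarrow> L"
    using * cauchy2_convergent[of X] by (auto simp: q2rel_def convergent_def)
  have "(\<lambda>n. abs2 (X n - Y n)) \<longlonglongrightarrow> 0" using * by (simp add: q2rel_def null2_def)
  hence "(\<lambda>n. abs2 (Y n) - abs2 (X n)) \<longlonglongrightarrow> 0"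
    by (rule Lim_null_comparison[rotated])
       (metis (no_types, lifting) abs2_diff_abs abs2_minus_commute always_eventually real_norm_def)
  from tendsto_add[OF this L] have "(\<lambda>n. abs2 (Y n)) \<longlonglongrightarrow> L" by simp
  with L show "lim (\<lambda>n. abs2 (X n)) = lim (\<lambda>n. abs2 (Y n))"
    by (metis limI)
qed

lemma norm2_0 [simp]: "norm2 (0::q2) = 0"
  by transfer simp

lemma norm2_1 [simp]: "norm2 (1::q2) = 1"
  by transfer simp

lemma norm2_eq_0_iff [simp]: "norm2 (x::q2) = 0 \<longleftrightarrow> x = 0"
proof (transfer)
  fix X assume X: "cauchy2 X"
  hence "(\<lambda>n. abs2 (X n)) \<longlonglongrightarrow> lim (\<lambda>n. abs2 (X n))"
    using cauchy2_convergent convergent_LIMSEQ_iff by blast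
  thus "(lim (\<lambda>n. abs2 (X n)) = 0) = q2rel X (\<lambda>_. 0)"
    using X by (auto simp: q2rel_def null2_def dest: limI)
qed

lemma norm2_nonneg [simp]: "norm2 (x::q2) \<ge> 0"
proof (transfer)
  fix X assume "cauchy2 X"
  hence "(\<lambda>n. abs2 (X n)) \<longlonglongrightarrow> lim (\<lambda>n. abs2 (X n))"
    using cauchy2_convergent convergent_LIMSEQ_iff by blast
  thus "0 \<le> lim (\<lambda>n. abs2 (X n))" by (rule LIMSEQ_le_const) auto
qed

lemma norm2_mult: "norm2 (x * y :: q2) = norm2 x * norm2 y"
proof (transfer)
  fix X Y assume "cauchy2 X" "cauchy2 Y"
  hence "(\<lambda>n. abs2 (X n)) \<longlonglongrightarrow> lim (\<lambda>n. abs2 (X n))" "(\<lambda>n. abs2 (Y n)) \<longlonglongrightarrow> lim (\<lambda>n. abs2 (Y n))"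
    using cauchy2_convergent convergent_LIMSEQ_iff by blast+
  from tendsto_mult[OF this] show "lim (\<lambda>n. abs2 (X n * Y n)) = lim (\<lambda>n. abs2 (X n)) * lim (\<lambda>n. abs2 (Y n))"
    by (simp add: abs2_mult limI)
qed

lemma norm2_minus [simp]: "norm2 (- x :: q2) = norm2 x"
  by transfer simp

lemma norm2_ultra: "norm2 (x + y :: q2) \<le> max (norm2 x) (norm2 y)"
proof (transfer)
  fix X Y assume "cauchy2 X" "cauchy2 Y"
  hence "(\<lambda>n. abs2 (X n)) \<longlonglongrightarrow> lim (\<lambda>n. abs2 (X n))" "(\<lambda>n. abs2 (Y n)) \<longlonglongrightarrow> lim (\<lambda>n. abs2 (Y n))"
    "(\<lambda>n. abs2 (X n + Y n)) \<longlonglongrightarrow> lim (\<lambda>n. abs2 (X n + Y n))"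
    using cauchy2_convergent convergent_LIMSEQ_iff cauchy2_add by blast+
  thus "lim (\<lambda>n. abs2 (X n + Y n)) \<le> max (lim (\<lambda>n. abs2 (X n))) (lim (\<lambda>n. abs2 (Y n)))"
    using abs2_ultra by (intro LIMSEQ_le[OF _ tendsto_max]) auto
qed

lemma norm2_triangle: "norm2 (x + y :: q2) \<le> norm2 x + norm2 y"
  using norm2_ultra[of x y] norm2_nonneg[of x] norm2_nonneg[of y] by linarith

instantiation q2 :: "metric_space"
begin

definition dist_q2 :: "q2 \<Rightarrow> q2 \<Rightarrow> real" where
  "dist_q2 x y = norm2 (x - y)"

definition uniformity_q2 :: "(q2 \<times> q2) filter" where
  "uniformity_q2 = (INF e\<in>{0 <..}. principal {(x, y). dist x y < e})"

definition open_q2 :: "q2 set \<Rightarrow> bool" where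
  "open_q2 U \<longleftrightarrow> (\<forall>x\<in>U. eventually (\<lambda>(x', y). x' = x \<longrightarrow> y \<in> U) uniformity)"

instance
proof
  fix x y z :: q2
  show "dist x y \<le> dist x z + dist y z"
    using norm2_triangle[of "x - z" "z - y"] norm2_minus[of "y - z"]
    by (simp add: dist_q2_def)
qed (simp_all add: dist_q2_def uniformity_q2_def open_q2_def)

end


lift_definition q2_of_rat :: "rat \<Rightarrow> q2" is "\<lambda>x _. x" by (simp add: q2rel_def)

lemma q2_of_rat_add: "q2_of_rat (x + y) = q2_of_rat x + q2_of_rat y"
  by transfer (simp add: q2rel_def)

lemma q2_of_rat_mult: "q2_of_rat (x * y) = q2_of_rat x * q2_of_rat y"
  by transfer (simp add: q2rel_def)

lemma q2_of_rat_minus: "q2_of_rat (- x) = - q2_of_rat x"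
  by transfer (simp add: q2rel_def)

lemma q2_of_rat_eq_iff: "q2_of_rat x = q2_of_rat y \<longleftrightarrow> x = y"
  by transfer (simp add: q2rel_def)

lemma q2_of_rat_of_nat: "q2_of_rat (of_nat n) = of_nat n"
proof (induction n)
  case 0
  show ?case by (simp, transfer) (simp add: q2rel_def)
next
  case (Suc n)
  have "q2_of_rat 1 = 1" by transfer (simp add: q2rel_def)
  with Suc show ?case by (simp add: q2_of_rat_add)
qed

instance q2 :: field_char_0
  by standard (metis injI of_nat_eq_iff q2_of_rat_eq_iff q2_of_rat_of_nat)

lemma q2_of_rat_eq_of_rat: "q2_of_rat x = of_rat x"
proof (cases x rule: Rat_cases)
  case (Fract a b)
  have int: "q2_of_rat (of_int k) = of_int k" for k
    by (cases k rule: int_cases2) (simp_all add: q2_of_rat_of_nat q2_of_rat_minus)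
  have x: "x = of_int a / of_int b" using Fract by (simp add: Fract_of_int_quotient)
  hence "x * of_int b = of_int a" using Fract by simp
  hence "q2_of_rat x * of_int b = of_int a" by (metis int q2_of_rat_mult)
  moreover have "(of_rat x :: q2) = of_int a / of_int b"
    by (simp add: x of_rat_divide)
  ultimately show ?thesis using \<open>b > 0\<close>
    by (metis eq_divide_eq less_irrefl of_int_eq_0_iff)
qed

lemma norm2_of_rat: "norm2 (of_rat x) = abs2 x"
  unfolding q2_of_rat_eq_of_rat[symmetric] by transfer simp

lemma of_rat_dense_q2:
  assumes "e > 0"
  obtains r where "dist x (of_rat r :: q2) < e"
proof -
  have "\<exists>r. norm2 (x - q2_of_rat r) < e"
    unfolding minus_q2_def
  proof (transfer fixing: e)
    fix X assume X: "cauchy2 X"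
    obtain N where N: "\<forall>m\<ge>N. \<forall>n\<ge>N. abs2 (X m - X n) < e / 2"
      using X assms unfolding cauchy2_def by (meson half_gt_zero)
    have "cauchy2 (\<lambda>n. X n + - X N)" using X by (intro cauchy2_add) auto
    hence "(\<lambda>n. abs2 (X n + - X N)) \<longlonglongrightarrow> lim (\<lambda>n. abs2 (X n + - X N))"
      using cauchy2_convergent convergent_LIMSEQ_iff by blast
    hence "lim (\<lambda>n. abs2 (X n + - X N)) \<le> e / 2"
      by (rule LIMSEQ_le_const2) (use N in \<open>auto intro!: exI[of _ N] less_imp_le\<close>)
    thus "\<exists>r. lim (\<lambda>n. abs2 (X n + - r)) < e" using assms by (intro exI[of _ "X N"]) auto
  qed
  thus ?thesis using that by (auto simp: dist_q2_def q2_of_rat_eq_of_rat)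
qed

instance q2 :: complete_space
proof
  fix x :: "nat \<Rightarrow> q2" assume C: "Cauchy x"
  have "\<exists>r. dist (x n) (of_rat r) < 1 / real (Suc n)" for n
    using of_rat_dense_q2[of "1 / real (Suc n)" "x n"] by auto
  then obtain r where r: "\<And>n. dist (x n) (of_rat (r n)) < 1 / real (Suc n)" by metis
  have *: "norm2 (x n - of_rat (r n)) < 1 / real (Suc n)" for n
    using r[of n] by (simp add: dist_q2_def)
  have lim: "(\<lambda>n. dist (x n) (of_rat (r n))) \<longlonglongrightarrow> 0"
    by (rule tendsto_sandwich[OF _ _ tendsto_const LIMSEQ_inverse_real_of_nat])
       (use r in \<open>auto intro!: always_eventually less_imp_le simp: field_simps\<close>)
  have "cauchy2 r"
    unfolding cauchy2_def
  proof safe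
    fix e :: real assume e: "e > 0"
    hence e3: "e / 3 > 0" by simp
    obtain M where M: "\<forall>m\<ge>M. \<forall>n\<ge>M. dist (x m) (x n) < e / 3"
      using metric_CauchyD[OF C e3] by blast
    obtain N where N: "\<forall>n\<ge>N. dist (x n) (of_rat (r n)) < e / 3"
      using order_tendstoD(2)[OF lim e3] by (auto simp: eventually_sequentially)
    show "\<exists>N. \<forall>m\<ge>N. \<forall>n\<ge>N. abs2 (r m - r n) < e"
    proof (intro exI[of _ "max M N"] allI impI)
      fix m n assume mn: "m \<ge> max M N" "n \<ge> max M N"
      have "abs2 (r m - r n) = dist (of_rat (r m)) (of_rat (r n) :: q2)"
        by (simp add: dist_q2_def norm2_of_rat flip: of_rat_diff)
      also have "\<dots> \<le> dist (x m) (of_rat (r m)) + dist (x m) (x n) + dist (x n) (of_rat (r n))"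
        by metric
      also have "\<dots> < e / 3 + e / 3 + e / 3"
        using M N mn by (intro add_strict_mono) auto
      finally show "abs2 (r m - r n) < e" by simp
    qed
  qed
  define l where "l = abs_q2 r"
  have "(\<lambda>n. dist (of_rat (r n)) l) \<longlonglongrightarrow> 0"
  proof (rule LIMSEQ_I)
    fix e :: real assume e: "e > 0"
    then obtain N where N: "\<forall>m\<ge>N. \<forall>n\<ge>N. abs2 (r m - r n) < e / 2"
      using \<open>cauchy2 r\<close> unfolding cauchy2_def by (meson half_gt_zero)
    have "dist (of_rat (r n)) l < e" if n: "n \<ge> N" for n
    proof -
      have c: "cauchy2 (\<lambda>k. r n + - r k)"
        by (intro cauchy2_add cauchy2_minus \<open>cauchy2 r\<close>) auto
      have "of_rat (r n) - l = abs_q2 (\<lambda>k. r n + - r k)"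
        using \<open>cauchy2 r\<close> unfolding minus_q2_def l_def q2_of_rat_eq_of_rat[symmetric] q2_of_rat_def
        by (simp add: uminus_q2.abs_eq plus_q2.abs_eq q2rel_def cauchy2_minus eq_onp_def)
      hence "dist (of_rat (r n)) l = lim (\<lambda>k. abs2 (r n + - r k))"
        using c by (simp add: dist_q2_def norm2.abs_eq q2rel_def)
      also have "\<dots> \<le> e / 2"
        by (rule LIMSEQ_le_const2[OF cauchy2_convergent[OF c, unfolded convergent_LIMSEQ_iff]])
           (use N n in \<open>auto intro!: exI[of _ N] less_imp_le\<close>)
      finally show ?thesis using e by simp
    qed
    thus "\<exists>no. \<forall>n\<ge>no. norm (dist (of_rat (r n)) l - 0) < e" by auto
  qed
  hence sum: "(\<lambda>n. dist (x n) (of_rat (r n)) + dist (of_rat (r n)) l) \<longlonglongrightarrow> 0"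
    by (rule tendsto_add_zero[OF lim])
  have "\<forall>\<^sub>F n in sequentially.
      norm (dist (x n) l) \<le> dist (x n) (of_rat (r n)) + dist (of_rat (r n)) l"
    by (intro always_eventually allI) (simp only: real_norm_def abs_of_nonneg zero_le_dist dist_triangle)
  hence "(\<lambda>n. dist (x n) l) \<longlonglongrightarrow> 0"
    using sum by (rule Lim_null_comparison)
  hence "x \<longlonglongrightarrow> l" by (subst tendsto_dist_iff)
  thus "convergent x" by (rule convergentI)
qed

section \<open>2-adic modular forms\<close>

definition bernoulli :: "nat \<Rightarrow> rat" where
  "bernoulli k = fact k * fps_nth (fps_X / (fps_exp 1 - 1)) k"

definition divisor_sigma :: "nat \<Rightarrow> nat \<Rightarrow> nat" where
  "divisor_sigma k n = (\<Sum>d | d dvd n. d ^ k)"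

definition Eis :: "nat \<Rightarrow> q2 fps" where
  "Eis k = Abs_fps (\<lambda>n. if n = 0 then 1
     else - of_rat (of_nat (2 * k) / bernoulli k) * of_nat (divisor_sigma (k - 1) n))"

definition Delta :: "q2 fps" where
  "Delta = (Eis 4 ^ 3 - Eis 6 ^ 2) / 1728"

definition modular_forms :: "q2 fps set" where
  "modular_forms = {\<Sum>i\<le>N. \<Sum>j\<le>N. fps_const (c i j) * Eis 4 ^ i * Eis 6 ^ j | N c. True}"

text \<open>
  Convergence in the sup-norm of coefficients is uniform convergence of the coefficient functions
  with respect to the metric of \<open>q2\<close>.  (The metric that the library puts on \<open>q2 fps\<close> is
  the X-adic one, which ignores the topology of the coefficients.)
\<close>

definition fps_sup_tendsto :: "(nat \<Rightarrow> q2 fps) \<Rightarrow> q2 fps \<Rightarrow> bool" where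
  "fps_sup_tendsto g f \<longleftrightarrow> uniform_limit UNIV (\<lambda>n. fps_nth (g n)) (fps_nth f) sequentially"

definition M2 :: "q2 fps set" where
  "M2 = {f. \<exists>g. (\<forall>n. g n \<in> modular_forms) \<and> fps_sup_tendsto g f}"


section \<open>The Heisenberg vertex operator algebra\<close>

text \<open>
  \<open>S\<close> is the polynomial ring in \<open>h(-1), h(-2), \<dots>\<close>.  The index \<open>k :: nat\<close> stands for the
  generator \<open>h(-(k + 1))\<close>, a multiset of indices for the corresponding monomial \<open>h\<^sup>I\<close>, and
  the empty multiset for the vacuum.
\<close>

type_synonym heis = "nat multiset \<Rightarrow>\<^sub>0 q2"

definition monom_heis :: "nat multiset \<Rightarrow> heis" where
  "monom_heis I = Poly_Mapping.single I 1"

definition scale_heis :: "q2 \<Rightarrow> heis \<Rightarrow> heis" where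
  "scale_heis c v = Poly_Mapping.map (\<lambda>x. c * x) v"

definition wt :: "nat multiset \<Rightarrow> nat" where
  "wt I = (\<Sum>k\<in>#I. Suc k)"

definition deriv_heis :: "nat \<Rightarrow> heis \<Rightarrow> heis" where
  "deriv_heis k v =
     (\<Sum>I\<in>Poly_Mapping.keys v.
        Poly_Mapping.single (I - {#k#}) (of_nat (count I k) * Poly_Mapping.lookup v I))"

definition h_mode :: "int \<Rightarrow> heis \<Rightarrow> heis" where
  "h_mode n v =
     (if n < 0 then monom_heis {#nat (- n - 1)#} * v
      else if n > 0 then scale_heis (of_int n) (deriv_heis (nat (n - 1)) v)
      else 0)"


subsection \<open>Vertex operators\<close>

text \<open>
  A field \<open>A(z) = \<Sum>\<^sub>n A(n) z\<^sup>-\<^sup>n\<^sup>-\<^sup>1\<close> is represented by its modes \<open>A(n)\<close>.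
  For every state \<open>v\<close> one has \<open>A(n) v = 0\<close> for all large \<open>n\<close>.
\<close>

type_synonym heis_field = "int \<Rightarrow> heis \<Rightarrow> heis"

text \<open>The modes of the divided derivative \<open>(1/k!) (d/dz)\<^sup>k A(z)\<close>.\<close>

definition div_deriv :: "nat \<Rightarrow> heis_field \<Rightarrow> heis_field" where
  "div_deriv k A n v = scale_heis ((of_int (int k - n - 1) :: q2) gchoose k) (A (n - int k) v)"

text \<open>
  The modes of the normally ordered product \<open>A\<^sub>+(z) B(z) + B(z) A\<^sub>-(z)\<close>, where
  \<open>A\<^sub>+(z)\<close> collects the \<open>A(j)\<close> with \<open>j < 0\<close> and \<open>A\<^sub>-(z)\<close> those with
  \<open>j \<ge> 0\<close>.  On a given state only finitely many summands are nonzero.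
\<close>

definition normal_ordered :: "heis_field \<Rightarrow> heis_field \<Rightarrow> heis_field" where
  "normal_ordered A B n v =
     Sum_any (\<lambda>j. if j < 0 then A j (B (n - j - 1) v) else B (n - j - 1) (A j v))"

text \<open>
  \<open>Y(h(-k\<^sub>1-1) \<cdots> h(-k\<^sub>r-1) 1, z)\<close> is the iterated normally ordered product of the divided
  derivatives of order \<open>k\<^sub>1, \<dots>, k\<^sub>r\<close> of \<open>h(z) = \<Sum>\<^sub>n h(n) z\<^sup>-\<^sup>n\<^sup>-\<^sup>1\<close>.
  It does not depend on the order of the factors.
\<close>

fun vertex_op_list :: "nat list \<Rightarrow> heis_field" where
  "vertex_op_list [] = (\<lambda>n v. if n = -1 then v else 0)"
| "vertex_op_list (k # ks) = normal_ordered (div_deriv k h_mode) (vertex_op_list ks)"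

definition vertex_op :: "heis \<Rightarrow> heis_field" where
  "vertex_op v n u =
     (\<Sum>I\<in>Poly_Mapping.keys v.
        scale_heis (Poly_Mapping.lookup v I) (vertex_op_list (sorted_list_of_multiset I) n u))"

text \<open>
  The zero mode is \<open>v (wt v - 1)\<close> for homogeneous \<open>v\<close>, extended linearly.
\<close>

definition zero_mode :: "heis \<Rightarrow> heis \<Rightarrow> heis" where
  "zero_mode v u =
     (\<Sum>I\<in>Poly_Mapping.keys v.
        scale_heis (Poly_Mapping.lookup v I) (vertex_op (monom_heis I) (int (wt I) - 1) u))"


subsection \<open>Characters\<close>

text \<open>The trace on \<open>S\<^sub>(\<^sub>n\<^sub>)\<close> is taken with respect to the basis of monomials of weight \<open>n\<close>.\<close>

definition graded_trace :: "nat \<Rightarrow> (heis \<Rightarrow> heis) \<Rightarrow> q2" where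
  "graded_trace n f = (\<Sum>I | wt I = n. Poly_Mapping.lookup (f (monom_heis I)) I)"

text \<open>
  \<open>q\<^sup>-\<^sup>1\<^sup>/\<^sup>2\<^sup>4 \<eta>(q) = \<Prod>\<^sub>m\<^sub>\<ge>\<^sub>1 (1 - q\<^sup>m)\<close>: factors with \<open>m > n\<close> do not affect
  the coefficient of \<open>q\<^sup>n\<close>.
\<close>

definition euler_prod :: "q2 fps" where
  "euler_prod = Abs_fps (\<lambda>n. fps_nth (\<Prod>m=1..n. 1 - fps_X ^ m) n)"

definition F_S :: "heis \<Rightarrow> q2 fps" where
  "F_S v = euler_prod * Abs_fps (\<lambda>n. graded_trace n (zero_mode v))"


section \<open>The 2-adic character map\<close>

text \<open>
  The completion \<open>S\<^sub>1\<close> of \<open>S\<close> for the sup-norm of coefficients is realised as the closure of \<open>S\<close>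
  in the complete space of bounded coefficient families with the sup-norm.
\<close>

definition heis_sup_tendsto :: "(nat \<Rightarrow> heis) \<Rightarrow> (nat multiset \<Rightarrow> q2) \<Rightarrow> bool" where
  "heis_sup_tendsto v a \<longleftrightarrow>
     uniform_limit UNIV (\<lambda>n. Poly_Mapping.lookup (v n)) a sequentially"

definition S1 :: "(nat multiset \<Rightarrow> q2) set" where
  "S1 = {a. \<exists>v. heis_sup_tendsto v a}"

text \<open>
  The continuous extension of \<open>F_S\<close> to a map from \<open>S\<^sub>1\<close> to \<open>M2\<close>: its value at \<open>a\<close> is the
  common limit of \<open>F_S (v n)\<close> over all sequences \<open>v\<close> in \<open>S\<close> that converge to \<open>a\<close>.
\<close>

definition F_S_hat :: "(nat multiset \<Rightarrow> q2) \<Rightarrow> q2 fps" where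
  "F_S_hat a = (THE f. f \<in> M2 \<and>
     (\<forall>v. heis_sup_tendsto v a \<longrightarrow> fps_sup_tendsto (\<lambda>n. F_S (v n)) f))"

definition lambda :: "q2 fps" where
  "lambda = (Delta oo fps_X ^ 2) / Delta"

end

theory Submission
  imports Defs
begin

text \<open>
  Put \<open>X = 2 \<Sum> \<sigma>\<^sub>3(n) q\<^sup>n\<close> and \<open>Y = 2 \<Sum> \<sigma>\<^sub>5(n) q\<^sup>n\<close>.  The trace recursion obtained from the commutation
  relations expresses \<open>F_S\<close> of a product of linear forms by pairings.  The forms
  \<open>a = h(-1) + h(-2)\<close> and \<open>b = h(-1) + 3 h(-2) + 2 h(-3)\<close> are orthogonal with self-pairings \<open>-X\<close> and
  \<open>Y\<close>, so \<open>F_S (a\<^sup>2\<^sup>i b\<^sup>2\<^sup>j)\<close> is \<open>X\<^sup>i Y\<^sup>j\<close> up to sign and the odd factor \<open>(2i-1)!! (2j-1)!!\<close>, a 2-adic unit.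
  As \<open>F_S\<close> does not increase norms, every series in \<open>X\<close> and \<open>Y\<close> with coefficients tending to 0 lies
  in the image.

  On the other side \<open>E\<^sub>4\<^sup>3 \<lambda> = \<Delta> (1 + 256 \<lambda>)\<^sup>3\<close>.  Since \<open>E\<^sub>4 = 1 + 120 X\<close> and \<open>E\<^sub>6 = 1 - 252 Y\<close>, this equation
  presents \<open>8 \<lambda>\<close> as the fixed point of a map which contracts \<open>\<int>\<^sub>2[X, Y]\<close> by the factor 8, and polynomials
  in the iterates converge to polynomials in \<open>\<lambda>\<close>.  The level 2 identities behind the equation follow from
  Liouville's identity for \<open>x\<^sup>2\<close> and \<open>x\<^sup>4\<close>, both on all integers and on the even ones.
\<close>

section \<open>Lambert series and Liouville's identity\<close>

definition geo :: "nat \<Rightarrow> 'a::field_char_0 fps" where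
  "geo d = Abs_fps (\<lambda>n. if n > 0 \<and> d dvd n then 1 else 0)"

definition lambert :: "(nat \<Rightarrow> 'a::field_char_0) \<Rightarrow> 'a fps" where
  "lambert g = Abs_fps (\<lambda>n. if n = 0 then 0 else \<Sum>d | d dvd n. g d)"

definition fps_theta :: "'a::field_char_0 fps \<Rightarrow> 'a fps" where
  "fps_theta f = fps_X * fps_deriv f"

definition fps_eq_upto :: "nat \<Rightarrow> 'a::zero fps \<Rightarrow> 'a fps \<Rightarrow> bool" where
  "fps_eq_upto N f g \<longleftrightarrow> (\<forall>n\<le>N. fps_nth f n = fps_nth g n)"

lemma fps_eq_upto_refl [simp]: "fps_eq_upto N f f"
  by (simp add: fps_eq_upto_def)

lemma fps_eq_upto_sym: "fps_eq_upto N f g \<Longrightarrow> fps_eq_upto N g f"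
  by (simp add: fps_eq_upto_def)

lemma fps_eq_upto_trans [trans]: "fps_eq_upto N f g \<Longrightarrow> fps_eq_upto N g h \<Longrightarrow> fps_eq_upto N f h"
  by (simp add: fps_eq_upto_def)

lemma fps_eq_upto_add:
  fixes f :: "'a::comm_ring_1 fps"
  shows "fps_eq_upto N f g \<Longrightarrow> fps_eq_upto N f' g' \<Longrightarrow> fps_eq_upto N (f + f') (g + g')"
  by (simp add: fps_eq_upto_def)

lemma fps_eq_upto_diff:
  fixes f :: "'a::comm_ring_1 fps"
  shows "fps_eq_upto N f g \<Longrightarrow> fps_eq_upto N f' g' \<Longrightarrow> fps_eq_upto N (f - f') (g - g')"
  by (simp add: fps_eq_upto_def)

lemma fps_eq_upto_mult:
  fixes f :: "'a::comm_ring_1 fps"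
  shows "fps_eq_upto N f g \<Longrightarrow> fps_eq_upto N f' g' \<Longrightarrow> fps_eq_upto N (f * f') (g * g')"
  by (auto simp: fps_eq_upto_def fps_mult_nth intro!: sum.cong)

lemma fps_eq_upto_sum:
  fixes f :: "'b \<Rightarrow> 'a::comm_ring_1 fps"
  shows "(\<And>i. i \<in> I \<Longrightarrow> fps_eq_upto N (f i) (g i)) \<Longrightarrow> fps_eq_upto N (sum f I) (sum g I)"
  by (auto simp: fps_eq_upto_def fps_sum_nth intro!: sum.cong)

lemma fps_eqI_upto: "(\<And>N. fps_eq_upto N f g) \<Longrightarrow> f = g"
  by (auto simp: fps_eq_upto_def fps_eq_iff)

lemma geo_eq: "d > 0 \<Longrightarrow> geo d = fps_X ^ d * (1 + geo d)"
  by (rule fps_ext) (auto simp: geo_def fps_X_power_mult_nth dest: dvd_imp_le dvd_diffD)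

lemma one_minus_X_power_nz: "d > 0 \<Longrightarrow> 1 - fps_X ^ d \<noteq> (0 :: 'a::field_char_0 fps)"
proof
  assume "d > 0" and eq: "1 - fps_X ^ d = (0 :: 'a fps)"
  have "fps_nth (1 - fps_X ^ d :: 'a fps) 0 = fps_nth 0 0" unfolding eq ..
  thus False using \<open>d > 0\<close> by (simp add: fps_X_power_nth)
qed

lemma geo_unique:
  assumes "d > 0" "f = fps_X ^ d * (f + g)"
  shows "f = geo d * g"
proof -
  have "(1 - fps_X ^ d) * f = fps_X ^ d * g" using assms(2) by (simp add: algebra_simps)
  moreover have "(1 - fps_X ^ d) * geo d = (fps_X ^ d :: 'a fps)"
    using geo_eq[OF assms(1), where ?'a='a] by (simp add: algebra_simps)
  ultimately have "(1 - fps_X ^ d) * f = (1 - fps_X ^ d) * (geo d * g)"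
    by (simp flip: mult.assoc)
  thus ?thesis using one_minus_X_power_nz[OF assms(1), where ?'a='a] by simp
qed

lemma geo_mult:
  assumes "a > 0" "b > 0"
  shows "geo a * geo b = (geo (a + b) * (1 + geo a + geo b) :: 'a::field_char_0 fps)"
proof (rule geo_unique)
  have "geo a = fps_X ^ a * (1 + geo a :: 'a fps)" "geo b = fps_X ^ b * (1 + geo b :: 'a fps)"
    using geo_eq assms by blast+
  hence "geo a * geo b = (fps_X ^ a * (1 + geo a)) * (fps_X ^ b * (1 + geo b) :: 'a fps)"
    by simp
  also have "\<dots> = fps_X ^ (a + b) * (geo a * geo b + (1 + geo a + geo b))"
    by (simp add: power_add algebra_simps)
  finally show "geo a * geo b = fps_X ^ (a + b) * (geo a * geo b + (1 + geo a + geo b) :: 'a fps)" .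
qed (use assms in auto)

lemma geo_nth: "fps_nth (geo d) n = (if n > 0 \<and> d dvd n then 1 else 0)"
  by (simp add: geo_def)

lemma X_power_mult_eq_upto_0: "N < d \<Longrightarrow> fps_eq_upto N (fps_X ^ d * f :: 'a::field_char_0 fps) 0"
  by (auto simp: fps_eq_upto_def fps_X_power_mult_nth)

lemma geo_mult_eq_upto_0:
  assumes "a > 0" "b > 0" "N < a + b"
  shows "fps_eq_upto N (geo a * geo b :: 'a::field_char_0 fps) 0"
proof -
  have "geo a * geo b = (fps_X ^ a * (1 + geo a)) * (fps_X ^ b * (1 + geo b) :: 'a fps)"
    using geo_eq[OF assms(1), where ?'a='a] geo_eq[OF assms(2), where ?'a='a] by simp
  also have "\<dots> = fps_X ^ (a + b) * ((1 + geo a) * (1 + geo b))"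
    by (simp add: power_add algebra_simps)
  finally show ?thesis using X_power_mult_eq_upto_0[OF assms(3)] by simp
qed

lemma lambert_upto:
  fixes g :: "nat \<Rightarrow> 'a::field_char_0"
  assumes "N \<le> M"
  shows "fps_eq_upto N (lambert g) (\<Sum>d=1..M. fps_const (g d) * geo d)"
  unfolding fps_eq_upto_def
proof safe
  fix n assume n: "n \<le> N"
  have "(\<Sum>d | d dvd n. g d) = (\<Sum>d=1..M. if n > 0 \<and> d dvd n then g d else 0)" if "n > 0"
  proof -
    have "d \<le> n \<and> d \<noteq> 0" if "d dvd n" for d
      using that \<open>n > 0\<close> by (auto dest: dvd_imp_le)
    hence "{d. d dvd n} \<subseteq> {1..M}" using n assms by force
    hence "(\<Sum>d | d dvd n. g d) = (\<Sum>d\<in>{1..M}. if d \<in> {d. d dvd n} then g d else 0)"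
      by (subst sum.inter_restrict[symmetric]) (auto intro!: sum.cong)
    thus ?thesis using that by (auto intro!: sum.cong)
  qed
  thus "fps_nth (lambert g) n = fps_nth (\<Sum>d=1..M. fps_const (g d) * geo d) n"
    by (auto simp: lambert_def fps_sum_nth geo_nth if_distrib cong: if_cong)
qed

lemma sum_square_split:
  fixes G :: "nat \<Rightarrow> nat \<Rightarrow> 'a::comm_ring_1"
  assumes "\<And>a b. G a b = G b a"
  shows "(\<Sum>a=1..N. \<Sum>b=1..N. G a b) = (\<Sum>a=1..N. G a a) + 2 * (\<Sum>k=1..N. \<Sum>b=1..N-k. G (b + k) b)"
proof -
  have 1: "(\<Sum>(a,b) | a \<in> {1..N} \<and> b \<in> {1..N} \<and> b < a. G a b) = (\<Sum>k=1..N. \<Sum>b=1..N-k. G (b + k) b)"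
    unfolding sum.Sigma[OF finite_atLeastAtMost ballI[OF finite_atLeastAtMost]]
    by (rule sum.reindex_bij_witness[of _ "\<lambda>(k,b). (b + k, b)" "\<lambda>(a,b). (a - b, b)"]) auto
  have 2: "(\<Sum>(a,b) | a \<in> {1..N} \<and> b \<in> {1..N} \<and> a < b. G a b) = (\<Sum>k=1..N. \<Sum>b=1..N-k. G (b + k) b)"
    unfolding sum.Sigma[OF finite_atLeastAtMost ballI[OF finite_atLeastAtMost]]
    by (rule sum.reindex_bij_witness[of _ "\<lambda>(k,b). (b, b + k)" "\<lambda>(a,b). (b - a, a)"]) (auto simp: assms)
  have 3: "(\<Sum>(a,b) | a \<in> {1..N} \<and> b = a. G a b) = (\<Sum>a=1..N. G a a)"
    by (rule sum.reindex_bij_witness[of _ "\<lambda>a. (a, a)" fst]) auto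
  have fin: "finite {(a,b). a \<in> {1..N} \<and> b = a}" "finite {(a,b). a \<in> {1..N} \<and> b \<in> {1..N} \<and> b < a}"
       "finite {(a,b). a \<in> {1..N} \<and> b \<in> {1..N} \<and> a < b}"
    by (rule finite_subset[of _ "{1..N} \<times> {1..N}"]; auto)+
  have "(\<Sum>a=1..N. \<Sum>b=1..N. G a b) = (\<Sum>(a,b)\<in>{1..N}\<times>{1..N}. G a b)"
    by (simp add: sum.cartesian_product)
  also have "{1..N}\<times>{1..N} = {(a,b). a \<in> {1..N} \<and> b = a} \<union> ({(a,b). a \<in> {1..N} \<and> b \<in> {1..N} \<and> b < a}
       \<union> {(a,b). a \<in> {1..N} \<and> b \<in> {1..N} \<and> a < b})" by auto
  also have "(\<Sum>(a,b)\<in>\<dots>. G a b) = (\<Sum>(a,b) | a \<in> {1..N} \<and> b = a. G a b) +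
      ((\<Sum>(a,b) | a \<in> {1..N} \<and> b \<in> {1..N} \<and> b < a. G a b) + (\<Sum>(a,b) | a \<in> {1..N} \<and> b \<in> {1..N} \<and> a < b. G a b))"
    by (subst sum.union_disjoint, use fin in \<open>auto\<close>)
       (subst sum.union_disjoint, use fin in \<open>auto\<close>)
  finally show ?thesis unfolding 1 2 3 by simp
qed

text \<open>Solved for \<open>u\<^sub>b u\<^sub>b\<^sub>+\<^sub>k\<close>, the relation \<open>geo_mult\<close> makes the sum over \<open>b\<close> telescope.\<close>

lemma geo_shift_sum:
  assumes "k > 0" "k \<le> N"
  shows "fps_eq_upto N (\<Sum>b=1..N-k. geo (b + k) * geo b :: 'a::field_char_0 fps)
           (geo k * (\<Sum>b=1..k. geo b) - (\<Sum>b=Suc k..N. geo b))"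
proof -
  have *: "geo (b + k) * geo b = geo k * geo b - geo k * geo (b + k) - (geo (b + k) :: 'a fps)" if "b > 0" for b
    using geo_mult[OF that assms(1), where ?'a='a] by (simp add: algebra_simps)
  have sh: "(\<Sum>b=1..N-k. geo (b + k)) = (\<Sum>b=Suc k..N. geo b :: 'a fps)"
    by (rule sum.reindex_bij_witness[of _ "\<lambda>b. b - k" "\<lambda>b. b + k"]) (use assms in auto)
  have tel: "(\<Sum>b=1..N-k. geo b) + (\<Sum>b=Suc (N-k)..N. geo b) = (\<Sum>b=1..N. geo b :: 'a fps)"
    "(\<Sum>b=1..k. geo b) + (\<Sum>b=Suc k..N. geo b) = (\<Sum>b=1..N. geo b :: 'a fps)"
    by (subst sum.union_disjoint[symmetric]; use assms in \<open>auto intro!: sum.cong\<close>)+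
  have "(\<Sum>b=1..N-k. geo (b + k) * geo b) =
      geo k * (\<Sum>b=1..N-k. geo b) - geo k * (\<Sum>b=1..N-k. geo (b + k)) - (\<Sum>b=1..N-k. geo (b + k) :: 'a fps)"
    by (simp add: * sum_subtractf sum_distrib_left)
  also have "\<dots> = geo k * ((\<Sum>b=1..N-k. geo b) - (\<Sum>b=Suc k..N. geo b)) - (\<Sum>b=Suc k..N. geo b)"
    unfolding sh by (simp add: algebra_simps)
  also have "(\<Sum>b=1..N-k. geo b) - (\<Sum>b=Suc k..N. geo b) = (\<Sum>b=1..k. geo b) - (\<Sum>b=Suc (N-k)..N. geo b :: 'a fps)"
    using tel by (simp add: algebra_simps)
  also have "geo k * \<dots> - (\<Sum>b=Suc k..N. geo b) =
      (geo k * (\<Sum>b=1..k. geo b) - (\<Sum>b=Suc k..N. geo b)) - (\<Sum>b=Suc (N-k)..N. geo k * geo b)"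
    by (simp add: algebra_simps sum_distrib_left)
  finally have eq: "(\<Sum>b=1..N-k. geo (b + k) * geo b) = \<dots>" .
  have "fps_eq_upto N (\<Sum>b=Suc (N-k)..N. geo k * geo b :: 'a fps) (\<Sum>b=Suc (N-k)..N. 0)"
    by (intro fps_eq_upto_sum geo_mult_eq_upto_0) (use assms in auto)
  from fps_eq_upto_diff[OF fps_eq_upto_refl this] show ?thesis unfolding eq by simp
qed

lemma geo_conv_sum:
  assumes "k > 0"
  shows "(\<Sum>a=1..k-1. geo a * geo (k - a) :: 'a::field_char_0 fps) =
           geo k * (of_nat (k - 1) + 2 * (\<Sum>a=1..k-1. geo a))"
proof -
  have "(\<Sum>a=1..k-1. geo a * geo (k - a) :: 'a fps) = (\<Sum>a=1..k-1. geo k * (1 + geo a + geo (k - a)))"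
    by (intro sum.cong refl, subst geo_mult) auto
  also have "\<dots> = geo k * (of_nat (k - 1) + (\<Sum>a=1..k-1. geo a) + (\<Sum>a=1..k-1. geo (k - a)))"
    by (simp add: sum_distrib_left[symmetric] sum.distrib)
  also have "(\<Sum>a=1..k-1. geo (k - a)) = (\<Sum>a=1..k-1. geo a :: 'a fps)"
    by (rule sum.reindex_bij_witness[of _ "\<lambda>a. k - a" "\<lambda>a. k - a"]) auto
  finally show ?thesis by simp
qed

lemma theta_geo:
  assumes "d > 0"
  shows "fps_theta (geo d) = of_nat d * (geo d + geo d ^ 2 :: 'a::field_char_0 fps)"
proof -
  define g where "g = (geo d :: 'a fps)"
  have X: "fps_theta (fps_X ^ d) = (of_nat d * fps_X ^ d :: 'a fps)"
    by (induction d) (auto simp: fps_theta_def algebra_simps)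
  have add: "fps_theta (f + h) = fps_theta f + fps_theta h" for f h :: "'a fps"
    by (simp add: fps_theta_def algebra_simps)
  have mult: "fps_theta (f * h) = fps_theta f * h + f * fps_theta h" for f h :: "'a fps"
    by (simp add: fps_theta_def algebra_simps)
  have 1: "fps_theta (1 :: 'a fps) = 0" by (simp add: fps_theta_def)
  have g: "g = fps_X ^ d * (1 + g)" unfolding g_def by (rule geo_eq[OF assms])
  have "fps_theta g = fps_theta (fps_X ^ d * (1 + g))" using g by simp
  also have "\<dots> = fps_X ^ d * (fps_theta g + of_nat d * (1 + g))"
    by (simp add: add mult X 1 algebra_simps)
  finally have "fps_theta g = geo d * (of_nat d * (1 + g))" by (rule geo_unique[OF assms])
  thus ?thesis by (simp add: g_def algebra_simps power2_eq_square)
qed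

lemma fps_eq_upto_theta: "fps_eq_upto N f g \<Longrightarrow> fps_eq_upto N (fps_theta f) (fps_theta g)"
  by (auto simp: fps_eq_upto_def fps_theta_def)

lemma theta_sum: "fps_theta (\<Sum>i\<in>I. fps_const (c i) * f i) = (\<Sum>i\<in>I. fps_const (c i) * fps_theta (f i))"
  by (simp add: fps_theta_def fps_deriv_sum sum_distrib_left algebra_simps)

lemma fps_const_sum: "fps_const (sum f A) = (\<Sum>i\<in>A. fps_const (f i :: 'a::comm_ring_1))"
  by (rule fps_ext) (simp add: fps_sum_nth)

theorem liouville:
  fixes F :: "int \<Rightarrow> 'a::field_char_0" and g h :: "nat \<Rightarrow> nat \<Rightarrow> 'a"
  assumes even: "\<And>x. F (- x) = F x" and F0: "F 0 = 0"
  and split: "\<And>a b. a > 0 \<Longrightarrow> b > 0 \<Longrightarrow> F (int a - int b) - F (int a + int b) = (\<Sum>i<m. g i a * h i b)"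
  and G: "\<And>k. k > 0 \<Longrightarrow> F (int k) = of_nat k * G k"
  shows "(\<Sum>i<m. lambert (g i) * lambert (h i)) =
    2 * fps_theta (lambert G) +
      lambert (\<lambda>k. (1 - of_nat k) * F (int k) - 2 * (\<Sum>l=1..k. F (int l)))"
proof (rule fps_eqI_upto)
  fix N
  let ?u = "geo :: nat \<Rightarrow> 'a fps" and ?c = "fps_const :: 'a \<Rightarrow> 'a fps"
  let ?F = "\<lambda>k::nat. ?c (F (int k))"
  define S1 where "S1 = (\<Sum>a=1..N. \<Sum>b=1..N. ?c (F (int a - int b)) * (?u a * ?u b))"
  define S2 where "S2 = (\<Sum>a=1..N. \<Sum>b=1..N. ?c (F (int a + int b)) * (?u a * ?u b))"
  have "fps_eq_upto N (\<Sum>i<m. lambert (g i) * lambert (h i))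
     (\<Sum>i<m. (\<Sum>a=1..N. ?c (g i a) * ?u a) * (\<Sum>b=1..N. ?c (h i b) * ?u b))"
    by (intro fps_eq_upto_sum fps_eq_upto_mult lambert_upto order_refl)
  also have "(\<Sum>i<m. (\<Sum>a=1..N. ?c (g i a) * ?u a) * (\<Sum>b=1..N. ?c (h i b) * ?u b)) =
      (\<Sum>i<m. \<Sum>a=1..N. \<Sum>b=1..N. ?c (g i a * h i b) * (?u a * ?u b))"
    by (simp add: sum_product mult_ac flip: fps_const_mult)
  also have "\<dots> = (\<Sum>a=1..N. \<Sum>i<m. \<Sum>b=1..N. ?c (g i a * h i b) * (?u a * ?u b))"
    by (rule sum.swap)
  also have "\<dots> = (\<Sum>a=1..N. \<Sum>b=1..N. \<Sum>i<m. ?c (g i a * h i b) * (?u a * ?u b))"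
    by (intro sum.cong refl sum.swap)
  also have "\<dots> = (\<Sum>a=1..N. \<Sum>b=1..N. ?c (\<Sum>i<m. g i a * h i b) * (?u a * ?u b))"
    by (simp add: fps_const_sum sum_distrib_right)
  also have "\<dots> = (\<Sum>a=1..N. \<Sum>b=1..N. (?c (F (int a - int b)) - ?c (F (int a + int b))) * (?u a * ?u b))"
    by (intro sum.cong refl) (simp flip: split)
  also have "\<dots> = S1 - S2"
    unfolding S1_def S2_def by (simp only: left_diff_distrib sum_subtractf)
  finally have L: "fps_eq_upto N (\<Sum>i<m. lambert (g i) * lambert (h i)) (S1 - S2)" .
  have "S1 = 2 * (\<Sum>k=1..N. \<Sum>b=1..N-k. ?c (F (int (b + k) - int b)) * (?u (b + k) * ?u b))"
    unfolding S1_def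
  proof (subst sum_square_split)
    show "?c (F (int a - int b)) * (?u a * ?u b) = ?c (F (int b - int a)) * (?u b * ?u a)" for a b
      using even[of "int a - int b"] by (simp add: mult_ac)
  qed (simp add: F0)
  also have "\<dots> = 2 * (\<Sum>k=1..N. ?F k * (\<Sum>b=1..N-k. ?u (b + k) * ?u b))"
    by (simp add: sum_distrib_left)
  finally have S1: "S1 = \<dots>" .
  have "fps_eq_upto N (\<Sum>k=1..N. ?F k * (\<Sum>b=1..N-k. ?u (b + k) * ?u b))
          (\<Sum>k=1..N. ?F k * (?u k * (\<Sum>b=1..k. ?u b) - (\<Sum>b=Suc k..N. ?u b)))"
    by (intro fps_eq_upto_sum fps_eq_upto_mult geo_shift_sum) auto
  from fps_eq_upto_mult[OF fps_eq_upto_refl this]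
  have S1': "fps_eq_upto N S1 (2 * (\<Sum>k=1..N. ?F k * (?u k * (\<Sum>b=1..k. ?u b) - (\<Sum>b=Suc k..N. ?u b))))"
    unfolding S1 .
  have "fps_eq_upto N S2 (\<Sum>a=1..N. \<Sum>b=1..N. ?c (F (int a + int b)) * (if a + b \<le> N then ?u a * ?u b else 0))"
    unfolding S2_def
  proof (intro fps_eq_upto_sum fps_eq_upto_mult[OF fps_eq_upto_refl])
    fix a b assume "a \<in> {1..N}" "b \<in> {1..N}"
    thus "fps_eq_upto N (?u a * ?u b) (if a + b \<le> N then ?u a * ?u b else 0)"
      using geo_mult_eq_upto_0[of a b N, where ?'a='a] by auto
  qed
  also have "\<dots> = (\<Sum>(a,b) \<in> {1..N}\<times>{1..N}. if a + b \<le> N then ?c (F (int a + int b)) * (?u a * ?u b) else 0)"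
    by (auto simp: sum.cartesian_product intro!: sum.cong)
  also have "\<dots> = (\<Sum>(a,b) | a \<in> {1..N} \<and> b \<in> {1..N} \<and> a + b \<le> N. ?c (F (int a + int b)) * (?u a * ?u b))"
    by (rule sum.mono_neutral_cong_right) (auto split: if_splits)
  also have "\<dots> = (\<Sum>k=1..N. \<Sum>a=1..k-1. ?F k * (?u a * ?u (k - a)))"
    unfolding sum.Sigma[OF finite_atLeastAtMost ballI[OF finite_atLeastAtMost]]
    by (rule sum.reindex_bij_witness[of _ "\<lambda>(k,a). (a, k - a)" "\<lambda>(a,b). (a + b, a)"]) auto
  also have "\<dots> = (\<Sum>k=1..N. ?F k * (?u k * (of_nat (k - 1) + 2 * (\<Sum>a=1..k-1. ?u a))))"
    by (intro sum.cong refl, subst geo_conv_sum[symmetric]) (auto simp: sum_distrib_left)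
  finally have S2': "fps_eq_upto N S2 \<dots>" .
  have "fps_eq_upto N (2 * fps_theta (lambert G) + lambert (\<lambda>k. (1 - of_nat k) * F (int k) - 2 * (\<Sum>l=1..k. F (int l))))
     (2 * fps_theta (\<Sum>k=1..N. ?c (G k) * ?u k) +
       (\<Sum>k=1..N. ?c ((1 - of_nat k) * F (int k) - 2 * (\<Sum>l=1..k. F (int l))) * ?u k))"
    by (intro fps_eq_upto_add fps_eq_upto_mult fps_eq_upto_refl fps_eq_upto_theta lambert_upto order_refl)
  also have "fps_theta (\<Sum>k=1..N. ?c (G k) * ?u k) = (\<Sum>k=1..N. ?F k * (?u k + ?u k ^ 2))"
    unfolding theta_sum by (intro sum.cong refl)
      (simp add: theta_geo G fps_of_nat mult_ac flip: fps_const_mult)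
  also have "(\<Sum>k=1..N. ?c ((1 - of_nat k) * F (int k) - 2 * (\<Sum>l=1..k. F (int l))) * ?u k) =
      (\<Sum>k=1..N. ?F k * ((1 - of_nat k) * ?u k)) - 2 * (\<Sum>k=1..N. \<Sum>l=1..k. ?F l * ?u k)"
  proof -
    have c: "?c ((1 - of_nat k) * F (int k) - 2 * (\<Sum>l=1..k. F (int l))) =
        (1 - of_nat k) * ?F k - 2 * (\<Sum>l=1..k. ?F l)" for k
      unfolding fps_const_sub[symmetric] fps_const_mult[symmetric] fps_const_sum
      by (simp add: fps_numeral_fps_const fps_of_nat)
    have eq: "?c ((1 - of_nat k) * F (int k) - 2 * (\<Sum>l=1..k. F (int l))) * ?u k =
        ?F k * ((1 - of_nat k) * ?u k) - 2 * (\<Sum>l=1..k. ?F l * ?u k)" for k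
      unfolding c by (simp add: algebra_simps sum_distrib_left)
    show ?thesis unfolding eq sum_subtractf by (simp only: sum_distrib_left)
  qed
  also have "(\<Sum>k=1..N. \<Sum>l=1..k. ?F l * ?u k) = (\<Sum>l=1..N. \<Sum>k=l..N. ?F l * ?u k)"
    unfolding sum.Sigma[OF finite_atLeastAtMost ballI[OF finite_atLeastAtMost]]
    by (rule sum.reindex_bij_witness[of _ "\<lambda>(k,a). (a, k)" "\<lambda>(a,b). (b, a)"]) auto
  also have "\<dots> = (\<Sum>l=1..N. ?F l * (\<Sum>k=l..N. ?u k))"
    by (simp add: sum_distrib_left)
  also have "2 * (\<Sum>k=1..N. ?F k * (?u k + ?u k ^ 2)) +
      ((\<Sum>k=1..N. ?F k * ((1 - of_nat k) * ?u k)) - 2 * (\<Sum>l=1..N. ?F l * (\<Sum>k=l..N. ?u k))) =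
     (\<Sum>k=1..N. ?F k * (2 * (?u k + ?u k ^ 2) + (1 - of_nat k) * ?u k - 2 * (\<Sum>b=k..N. ?u b)))"
  proof -
    have lin: "2 * sum A {1..N} + (sum B {1..N} - 2 * sum C {1..N}) = (\<Sum>k=1..N. 2 * A k + B k - 2 * C k)"
      for A B C :: "nat \<Rightarrow> 'a fps"
      by (simp add: sum_distrib_left sum.distrib sum_subtractf)
    show ?thesis unfolding lin
    proof (intro sum.cong refl)
      fix k
      show "2 * (?F k * (?u k + ?u k ^ 2)) + ?F k * ((1 - of_nat k) * ?u k) - 2 * (?F k * (\<Sum>b=k..N. ?u b)) =
        ?F k * (2 * (?u k + ?u k ^ 2) + (1 - of_nat k) * ?u k - 2 * (\<Sum>b=k..N. ?u b))"
        by (simp only: ring_distribs mult.left_commute[of 2])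
    qed
  qed
  also have "\<dots> = 2 * (\<Sum>k=1..N. ?F k * (?u k * (\<Sum>b=1..k. ?u b) - (\<Sum>b=Suc k..N. ?u b))) -
       (\<Sum>k=1..N. ?F k * (?u k * (of_nat (k - 1) + 2 * (\<Sum>a=1..k-1. ?u a))))"
  proof -
    have "?F k * (2 * (?u k + ?u k ^ 2) + (1 - of_nat k) * ?u k - 2 * (\<Sum>b=k..N. ?u b)) =
       2 * (?F k * (?u k * (\<Sum>b=1..k. ?u b) - (\<Sum>b=Suc k..N. ?u b))) -
       ?F k * (?u k * (of_nat (k - 1) + 2 * (\<Sum>a=1..k-1. ?u a)))" if "k \<in> {1..N}" for k
    proof -
      have 1: "(\<Sum>b=1..k. ?u b) = (\<Sum>b=1..k-1. ?u b) + ?u k"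
        using that by (cases k) auto
      have 2: "(\<Sum>b=k..N. ?u b) = ?u k + (\<Sum>b=Suc k..N. ?u b)"
        using that by (subst sum.atLeast_Suc_atMost) auto
      have 3: "of_nat (k - 1) = (of_nat k - 1 :: 'a fps)" using that by (simp add: of_nat_diff)
      show ?thesis unfolding 1 2 3 by (simp add: algebra_simps power2_eq_square)
    qed
    thus ?thesis by (simp add: sum_distrib_left sum_subtractf)
  qed
  finally have R: "fps_eq_upto N (2 * fps_theta (lambert G) + lambert (\<lambda>k. (1 - of_nat k) * F (int k) - 2 * (\<Sum>l=1..k. F (int l)))) \<dots>" .
  show "fps_eq_upto N (\<Sum>i<m. lambert (g i) * lambert (h i))
     (2 * fps_theta (lambert G) + lambert (\<lambda>k. (1 - of_nat k) * F (int k) - 2 * (\<Sum>l=1..k. F (int l))))"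
    by (rule fps_eq_upto_trans[OF L fps_eq_upto_trans[OF fps_eq_upto_diff[OF S1' S2'] fps_eq_upto_sym[OF R]]])
qed

lemma lambert_nth: "fps_nth (lambert g) n = (if n = 0 then 0 else \<Sum>d | d dvd n. g d)"
  by (simp add: lambert_def)

lemma lambert_add: "lambert (\<lambda>d. g d + h d) = lambert g + lambert h"
  by (rule fps_ext) (simp add: lambert_nth sum.distrib)

lemma lambert_diff: "lambert (\<lambda>d. g d - h d) = lambert g - lambert h"
  by (rule fps_ext) (simp add: lambert_nth sum_subtractf)

lemma lambert_cmult: "lambert (\<lambda>d. c * g d) = fps_const c * lambert g"
  by (rule fps_ext) (simp add: lambert_nth sum_distrib_left)

lemma lambert_numeral: "lambert (\<lambda>d. numeral w * g d) = numeral w * lambert g"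
  by (simp add: lambert_cmult fps_numeral_fps_const)

lemma lambert_neg_numeral: "lambert (\<lambda>d. - numeral w * g d) = - numeral w * lambert g"
proof -
  have "(- numeral w :: 'a fps) = fps_const (- numeral w)" by (simp add: fps_numeral_fps_const)
  thus ?thesis using lambert_cmult[of "- numeral w" g] by metis
qed

lemma lambert_uminus: "lambert (\<lambda>d. - g d) = - lambert g"
  by (rule fps_ext) (simp add: lambert_nth sum_negf)

lemma lambert_cong: "(\<And>d. d > 0 \<Longrightarrow> g d = h d) \<Longrightarrow> lambert g = lambert h"
  by (rule fps_ext) (auto simp: lambert_nth intro!: sum.cong dest: dvd_pos_nat)

lemmas lambert_linear = lambert_add lambert_diff lambert_neg_numeral lambert_numeral lambert_uminus

definition Sig :: "nat \<Rightarrow> 'a::field_char_0 fps" where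
  "Sig k = lambert (\<lambda>d. of_nat d ^ k)"

definition Sig_even :: "nat \<Rightarrow> 'a::field_char_0 fps" where
  "Sig_even k = lambert (\<lambda>d. if even d then of_nat d ^ k else 0)"

definition Sig_odd :: "nat \<Rightarrow> 'a::field_char_0 fps" where
  "Sig_odd k = lambert (\<lambda>d. if odd d then of_nat d ^ k else 0)"

lemma Sig_split: "Sig k = Sig_even k + Sig_odd k"
  unfolding Sig_def Sig_even_def Sig_odd_def lambert_add[symmetric] by (rule lambert_cong) auto

lemma Sig_1_sq:
  "-12 * (Sig 1 * Sig 1) = 6 * fps_theta (Sig 1) - 5 * Sig 3 - (Sig 1 :: 'a::field_char_0 fps)"
proof -
  have P: "2 * (\<Sum>l=1..k. 3 * of_nat l ^ 2) = (of_nat k * (of_nat k + 1) * (2 * of_nat k + 1) :: 'a)" for k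
    by (induction k) (simp_all add: field_simps power2_eq_square)
  have "(\<Sum>i<1::nat. lambert (\<lambda>a. -12 * of_nat a) * lambert of_nat) =
    2 * fps_theta (lambert (\<lambda>k. 3 * of_nat k)) + lambert (\<lambda>k. (1 - of_nat k) * (3 * of_int (int k) ^ 2)
       - 2 * (\<Sum>l=1..k. 3 * of_int (int l) ^ 2) :: 'a)"
    by (rule liouville[where F = "\<lambda>x. 3 * of_int x ^ 2" and g = "\<lambda>_ a. -12 * of_nat a" and h = "\<lambda>_. of_nat"
         and m = 1 and G = "\<lambda>k. 3 * of_nat k"]) (simp_all add: algebra_simps power2_eq_square)
  also have "lambert (\<lambda>k. (1 - of_nat k) * (3 * of_int (int k) ^ 2) - 2 * (\<Sum>l=1..k. 3 * of_int (int l) ^ 2) :: 'a) =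
     lambert (\<lambda>k. - (5 * of_nat k ^ 3) - of_nat k ^ 1)"
    by (rule arg_cong[where f = lambert], rule ext, simp only: of_int_of_nat_eq P)
       (simp add: algebra_simps power2_eq_square power3_eq_cube)
  finally show ?thesis unfolding lambert_linear by (simp add: Sig_def fps_theta_def algebra_simps)
qed

lemma Sig_1_Sig_3:
  "-240 * (Sig 1 * Sig 3) = 30 * fps_theta (Sig 3) - 21 * Sig 5 - 10 * Sig 3 + (Sig 1 :: 'a::field_char_0 fps)"
proof -
  have P: "2 * (\<Sum>l=1..k. 15 * of_nat l ^ 4) =
     (6 * of_nat k ^ 5 + 15 * of_nat k ^ 4 + 10 * of_nat k ^ 3 - of_nat k :: 'a)" for k
    by (induction k) (simp_all add: algebra_simps power_numeral_reduce)
  have "(\<Sum>i<2::nat. lambert (\<lambda>a. -120 * of_nat a ^ (if i = 0 then 3 else 1)) *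
         lambert (\<lambda>b. of_nat b ^ (if i = 0 then 1 else 3))) =
    2 * fps_theta (lambert (\<lambda>k. 15 * of_nat k ^ 3)) + lambert (\<lambda>k. (1 - of_nat k) * (15 * of_int (int k) ^ 4)
       - 2 * (\<Sum>l=1..k. 15 * of_int (int l) ^ 4) :: 'a)"
    by (rule liouville[where F = "\<lambda>x. 15 * of_int x ^ 4" and m = 2 and G = "\<lambda>k. 15 * of_nat k ^ 3"
       and g = "\<lambda>i a. -120 * of_nat a ^ (if i = 0 then 3 else 1)" and h = "\<lambda>i b. of_nat b ^ (if i = 0 then 1 else 3)"])
       (simp_all add: algebra_simps power_numeral_reduce numeral_2_eq_2)
  also have "lambert (\<lambda>k. (1 - of_nat k) * (15 * of_int (int k) ^ 4) - 2 * (\<Sum>l=1..k. 15 * of_int (int l) ^ 4) :: 'a) =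
     lambert (\<lambda>k. - (21 * of_nat k ^ 5) - 10 * of_nat k ^ 3 + of_nat k ^ 1)"
    by (rule arg_cong[where f = lambert], rule ext, simp only: of_int_of_nat_eq P)
       (simp add: algebra_simps power_numeral_reduce)
  finally show ?thesis unfolding lambert_linear
    by (simp add: lessThan_nat_numeral Sig_def fps_theta_def algebra_simps)
qed

lemma Sig_odd_1_sq:
  "-12 * (Sig_odd 1 * Sig_odd 1 + Sig_even 1 * Sig_even 1) =
     6 * fps_theta (Sig_even 1) - 4 * Sig_even 3 - 2 * Sig_even 1 - Sig_odd 3 + (Sig_odd 1 :: 'a::field_char_0 fps)"
proof -
  define F where "F x = (if even x then 3 * of_int x ^ 2 else 0 :: 'a)" for x :: int
  define ev where "ev k a = (if even a then of_nat a ^ k else 0 :: 'a)" for k a :: nat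
  define od where "od k a = (if odd a then of_nat a ^ k else 0 :: 'a)" for k a :: nat
  have Sig: "lambert (ev k) = Sig_even k" "lambert (od k) = Sig_odd k" for k
    by (simp_all add: Sig_even_def Sig_odd_def ev_def[abs_def] od_def[abs_def])
  have P: "2 * (\<Sum>l=1..k. F (int l)) = (if even k then of_nat k ^ 3 + 3 * of_nat k ^ 2 + 2 * of_nat k
      else of_nat k ^ 3 - of_nat k :: 'a)" for k
    by (induction k) (simp_all add: F_def algebra_simps power2_eq_square power3_eq_cube)
  have "(\<Sum>i<2::nat. lambert (\<lambda>a. -12 * (if i = 0 then ev 1 a else od 1 a)) *
         lambert (\<lambda>b. if i = 0 then ev 1 b else od 1 b)) =
    2 * fps_theta (lambert (\<lambda>k. 3 * ev 1 k)) + lambert (\<lambda>k. (1 - of_nat k) * F (int k)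
       - 2 * (\<Sum>l=1..k. F (int l)) :: 'a)"
    by (rule liouville[where F = F and m = 2 and G = "\<lambda>k. 3 * ev 1 k" and
         g = "\<lambda>i a. -12 * (if i = 0 then ev 1 a else od 1 a)" and h = "\<lambda>i b. if i = 0 then ev 1 b else od 1 b"])
       (auto simp: F_def ev_def od_def algebra_simps power2_eq_square numeral_2_eq_2)
  also have "lambert (\<lambda>k. (1 - of_nat k) * F (int k) - 2 * (\<Sum>l=1..k. F (int l)) :: 'a) =
     lambert (\<lambda>k. - (4 * ev 3 k) - 2 * ev 1 k - od 3 k + od 1 k)"
    by (rule arg_cong[where f = lambert], rule ext, simp only: P)
       (simp add: F_def ev_def od_def algebra_simps power2_eq_square power3_eq_cube)
  finally show ?thesis unfolding lambert_linear
    by (simp add: lessThan_nat_numeral Sig fps_theta_def algebra_simps)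
qed

lemma Sig_odd_1_Sig_odd_3:
  "-240 * (Sig_odd 1 * Sig_odd 3 + Sig_even 1 * Sig_even 3) =
     30 * fps_theta (Sig_even 3) - 18 * Sig_even 5 - 20 * Sig_even 3 + 8 * Sig_even 1
       - 3 * Sig_odd 5 + 10 * Sig_odd 3 - 7 * (Sig_odd 1 :: 'a::field_char_0 fps)"
proof -
  define F where "F x = (if even x then 15 * of_int x ^ 4 else 0 :: 'a)" for x :: int
  define ev where "ev k a = (if even a then of_nat a ^ k else 0 :: 'a)" for k a :: nat
  define od where "od k a = (if odd a then of_nat a ^ k else 0 :: 'a)" for k a :: nat
  have Sig: "lambert (ev k) = Sig_even k" "lambert (od k) = Sig_odd k" for k
    by (simp_all add: Sig_even_def Sig_odd_def ev_def[abs_def] od_def[abs_def])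
  have P: "2 * (\<Sum>l=1..k. F (int l)) = (if even k then 3 * of_nat k ^ 5 + 15 * of_nat k ^ 4 + 20 * of_nat k ^ 3 - 8 * of_nat k
      else 3 * of_nat k ^ 5 - 10 * of_nat k ^ 3 + 7 * of_nat k :: 'a)" for k
    by (induction k) (simp_all add: F_def algebra_simps power_numeral_reduce)
  have "(\<Sum>i<4::nat. lambert (\<lambda>a. -120 * (if i = 0 then ev 1 a else if i = 1 then ev 3 a else if i = 2 then od 1 a else od 3 a)) *
         lambert (\<lambda>b. if i = 0 then ev 3 b else if i = 1 then ev 1 b else if i = 2 then od 3 b else od 1 b)) =
    2 * fps_theta (lambert (\<lambda>k. 15 * ev 3 k)) + lambert (\<lambda>k. (1 - of_nat k) * F (int k)
       - 2 * (\<Sum>l=1..k. F (int l)) :: 'a)"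
    by (rule liouville[where F = F and m = 4 and G = "\<lambda>k. 15 * ev 3 k" and
         g = "\<lambda>i a. -120 * (if i = 0 then ev 1 a else if i = 1 then ev 3 a else if i = 2 then od 1 a else od 3 a)" and
         h = "\<lambda>i b. if i = 0 then ev 3 b else if i = 1 then ev 1 b else if i = 2 then od 3 b else od 1 b"])
       (auto simp: F_def ev_def od_def algebra_simps power_numeral_reduce eval_nat_numeral)
  also have "lambert (\<lambda>k. (1 - of_nat k) * F (int k) - 2 * (\<Sum>l=1..k. F (int l)) :: 'a) =
     lambert (\<lambda>k. - (18 * ev 5 k) - 20 * ev 3 k + 8 * ev 1 k - 3 * od 5 k + 10 * od 3 k - 7 * od 1 k)"
    by (rule arg_cong[where f = lambert], rule ext, simp only: P)
       (simp add: F_def ev_def od_def algebra_simps power_numeral_reduce)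
  finally show ?thesis unfolding lambert_linear
    by (simp add: lessThan_nat_numeral Sig fps_theta_def algebra_simps)
qed

section \<open>The equation satisfied by \<open>\<lambda>\<close>\<close>

definition fps_V :: "'a::field_char_0 fps \<Rightarrow> 'a fps" where
  "fps_V f = f oo fps_X ^ 2"

lemma fps_V_nth: "fps_nth (fps_V f) n = (if even n then fps_nth f (n div 2) else 0)"
proof -
  have "fps_nth (fps_V f) n = (\<Sum>i=0..n. if n = 2 * i then fps_nth f i else 0)"
    by (auto simp: fps_V_def fps_compose_nth fps_X_power_nth simp flip: power_mult intro!: sum.cong)
  also have "\<dots> = (\<Sum>i=0..n. if i = n div 2 then if even n then fps_nth f (n div 2) else 0 else 0)"
    by (rule sum.cong) auto
  finally show ?thesis by simp
qed

lemma fps_V_ring_hom: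
  "fps_V (f + g) = fps_V f + fps_V g" "fps_V (f - g) = fps_V f - fps_V g"
  "fps_V (f * g) = fps_V f * fps_V g" "fps_V (- f) = - fps_V f"
  "fps_V 1 = 1" "fps_V (numeral w) = numeral w"
proof -
  show "fps_V (f * g) = fps_V f * fps_V g" unfolding fps_V_def
    by (rule fps_compose_mult_distrib) simp
  show "fps_V 1 = 1" "fps_V (numeral w) = numeral w"
    by (simp_all add: fps_V_def fps_numeral_fps_const)
qed (rule fps_ext; simp add: fps_V_nth)+

lemma theta_V: "fps_theta (fps_V f) = 2 * fps_V (fps_theta f)"
proof (rule fps_ext)
  fix n
  have "fps_nth (fps_theta f) n = of_nat n * fps_nth f n" for f :: "'a fps" and n
    by (cases n) (simp_all add: fps_theta_def)
  thus "fps_nth (fps_theta (fps_V f)) n = fps_nth (2 * fps_V (fps_theta f)) n"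
    by (auto simp: fps_V_nth fps_numeral_fps_const elim!: evenE)
qed

lemma Sig_even_eq: "Sig_even k = 2 ^ k * fps_V (Sig k)"
proof (rule fps_ext)
  fix n
  have c: "(2 ^ k :: 'a fps) = fps_const (2 ^ k)"
    by (simp add: fps_numeral_fps_const fps_const_power)
  consider "n = 0" | m :: nat where "n = 2 * m" "m > 0" | "odd n"
    by (metis evenE mult_0_right neq0_conv)
  thus "fps_nth (Sig_even k) n = fps_nth (2 ^ k * fps_V (Sig k) :: 'a fps) n"
  proof cases
    case (2 m)
    have "(\<Sum>d | d dvd n. if even d then of_nat d ^ k else 0) = (\<Sum>d | d dvd n \<and> even d. of_nat d ^ k :: 'a)"
      using 2 by (intro sum.mono_neutral_cong_right) auto
    also have "\<dots> = (\<Sum>d | d dvd m. of_nat (2 * d) ^ k)"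
      by (rule sum.reindex_bij_witness[of _ "\<lambda>d. 2 * d" "\<lambda>d. d div 2"]) (use 2 in auto)
    finally show ?thesis using 2
      by (simp add: Sig_even_def Sig_def lambert_nth fps_V_nth c power_mult_distrib sum_distrib_left)
  next
    case 3
    hence "odd d" if "d dvd n" for d using that by (meson dvd_trans)
    hence "(\<Sum>d | d dvd n. if even d then of_nat d ^ k else 0 :: 'a) = 0" by (intro sum.neutral) auto
    thus ?thesis using 3 by (simp add: Sig_even_def lambert_nth fps_V_nth c)
  qed (simp add: Sig_even_def Sig_def lambert_nth fps_V_nth c)
qed

lemma theta_ring:
  "fps_theta (f + g) = fps_theta f + fps_theta g" "fps_theta (f - g) = fps_theta f - fps_theta g"
  "fps_theta (f * g) = fps_theta f * g + f * fps_theta g" "fps_theta (- f) = - fps_theta f"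
  "fps_theta 1 = 0" "fps_theta (numeral w) = 0" "fps_theta (f ^ 2) = 2 * f * fps_theta f"
  by (simp_all add: fps_theta_def algebra_simps fps_numeral_fps_const power2_eq_square)

lemma Ramanujan_P:
  fixes P Q :: "'a::field_char_0 fps"
  assumes "P = 1 - 24 * Sig 1" "Q = 1 + 240 * Sig 3"
  shows "12 * fps_theta P = P ^ 2 - Q"
  using Sig_1_sq[where ?'a='a] unfolding assms theta_ring by algebra

lemma Ramanujan_Q:
  fixes P Q R :: "'a::field_char_0 fps"
  assumes "P = 1 - 24 * Sig 1" "Q = 1 + 240 * Sig 3" "R = 1 - 504 * Sig 5"
  shows "3 * fps_theta Q = P * Q - R"
  using Sig_1_Sig_3[where ?'a='a] unfolding assms theta_ring by algebra

text \<open>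
  Applying \<open>fps_theta\<close> to the first relation gives \<open>8 R2 + R = 3 e (4 Q2 - Q)\<close>, and Liouville's identity in
  weight 6 gives \<open>7 e (8 Q2 - Q) = R + 48 R2\<close>.  Together they determine \<open>R\<close> and \<open>R2\<close>.
\<close>

lemma level_two_relations:
  fixes P Q R e P2 Q2 R2 :: "'a::field_char_0 fps"
  assumes P: "P = 1 - 24 * Sig 1" and Q: "Q = 1 + 240 * Sig 3" and R: "R = 1 - 504 * Sig 5"
    and e: "e = 1 + 24 * Sig_odd 1" and V: "P2 = fps_V P" "Q2 = fps_V Q" "R2 = fps_V R"
  shows "5 * e ^ 2 = 4 * Q2 + Q" "10 * R2 = e * (11 * Q2 - Q)" "5 * R = e * (16 * Q2 - 11 * Q)"
proof -
  note RP = Ramanujan_P[OF P Q] and RQ = Ramanujan_Q[OF P Q R]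
  have RP2: "6 * fps_theta P2 = P2 ^ 2 - Q2"
    using arg_cong[OF RP, of fps_V] unfolding V theta_V by (simp add: fps_V_ring_hom power2_eq_square)
  have RQ2: "3 * fps_theta Q2 = 2 * (P2 * Q2 - R2)"
    using arg_cong[OF RQ, of fps_V] unfolding V theta_V fps_V_ring_hom by algebra
  have ev: "P2 = 1 - 12 * Sig_even 1" "Q2 = 1 + 30 * Sig_even 3" "4 * R2 = 4 - 63 * Sig_even 5"
    unfolding V P Q R Sig_even_eq fps_V_ring_hom by simp_all
  have Od: "Sig_odd k = (Sig k - Sig_even k :: 'a fps)" for k
    using Sig_split[of k, where ?'a='a] by simp
  have e2: "e = 2 * P2 - P" unfolding e Od ev P by simp
  have "24 * (5 * e ^ 2) = 24 * (4 * Q2 + Q)"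
    using Sig_odd_1_sq[where ?'a='a] RP2 unfolding e2 Od[of 3] Od[of 1] ev P Q theta_ring by algebra
  thus 1: "5 * e ^ 2 = 4 * Q2 + Q" unfolding mult_cancel_left by simp
  have "fps_theta (5 * e ^ 2) = fps_theta (4 * Q2 + Q)" using 1 by simp
  hence "10 * e * (2 * fps_theta P2 - fps_theta P) = 4 * fps_theta Q2 + fps_theta Q"
    unfolding theta_ring by (simp add: e2 theta_ring algebra_simps)
  hence 2: "8 * R2 + R = 3 * e * (4 * Q2 - Q)" using RP RQ RP2 RQ2 1 e2 by algebra
  have 3: "7 * e * (8 * Q2 - Q) = R + 48 * R2"
    using Sig_odd_1_Sig_odd_3[where ?'a='a] RQ2 ev(3) unfolding e2 Od ev(1,2) P Q R theta_ring by algebra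
  have "40 * R2 = 4 * (e * (11 * Q2 - Q))" using 2 3 by algebra
  hence "4 * (10 * R2) = 4 * (e * (11 * Q2 - Q))" by simp
  thus 4: "10 * R2 = e * (11 * Q2 - Q)" unfolding mult_cancel_left by simp
  show "5 * R = e * (16 * Q2 - 11 * Q)" using 2 4 by algebra
qed

lemma bernoulli_4_6: "bernoulli 4 = - 1 / 30" "bernoulli 6 = 1 / 42"
proof -
  define E where "E = (fps_exp 1 - 1 :: rat fps)"
  define B where "B = fps_X / E"
  have E: "fps_nth E n = (if n = 0 then 0 else 1 / fact n)" for n
    by (simp add: E_def)
  have "E \<noteq> 0" using E[of 1] by (metis fps_zero_nth divide_eq_0_iff fact_nonzero one_neq_zero)
  moreover have "subdegree E = 1" by (rule subdegreeI) (simp_all add: E)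
  ultimately have "E dvd fps_X" by (simp add: fps_dvd_iff)
  hence BE: "B * E = fps_X" by (simp add: B_def)
  have *: "(\<Sum>i=0..n. fps_nth B i * fps_nth E (n - i)) = fps_nth fps_X n" for n
    unfolding BE[symmetric] by (rule fps_mult_nth[symmetric])
  have b0: "fps_nth B 0 = 1" using *[of 1] by (simp add: E)
  have b1: "fps_nth B 1 = - 1 / 2" using *[of 2] b0 by (simp add: E numeral_eq_Suc field_simps)
  have b2: "fps_nth B 2 = 1 / 12" using *[of 3] b0 b1 by (simp add: E numeral_eq_Suc field_simps)
  have b3: "fps_nth B 3 = 0" using *[of 4] b0 b1 b2 by (simp add: E numeral_eq_Suc field_simps)
  have b4: "fps_nth B 4 = - 1 / 720" using *[of 5] b0 b1 b2 b3 by (simp add: E numeral_eq_Suc field_simps)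
  have b5: "fps_nth B 5 = 0" using *[of 6] b0 b1 b2 b3 b4 by (simp add: E numeral_eq_Suc field_simps)
  have b6: "fps_nth B 6 = 1 / 30240" using *[of 7] b0 b1 b2 b3 b4 b5 by (simp add: E numeral_eq_Suc field_simps)
  show "bernoulli 4 = - 1 / 30" "bernoulli 6 = 1 / 42"
    using b4 b6 by (simp_all add: bernoulli_def B_def E_def fact_numeral)
qed

lemma Eis_4: "Eis 4 = 1 + 240 * Sig 3" and Eis_6: "Eis 6 = 1 - 504 * Sig 5"
proof -
  have *: "fps_nth (Sig k) n = (if n = 0 then 0 else of_nat (divisor_sigma k n) :: q2)" for k n
    by (simp add: Sig_def lambert_nth divisor_sigma_def)
  show "Eis 4 = 1 + 240 * Sig 3" "Eis 6 = 1 - 504 * Sig 5"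
    by (rule fps_ext; simp add: Eis_def bernoulli_4_6 * fps_numeral_fps_const of_rat_minus)+
qed

text \<open>
  Numerator \<open>B\<close> and denominator \<open>A\<close> of \<open>\<lambda>\<close> are determined by \<open>E\<^sub>4(q) = A + 256 B\<close> and
  \<open>E\<^sub>4(q\<^sup>2) = A + 16 B\<close>.  They satisfy \<open>\<Delta>(q) = A\<^sup>2 B\<close> and \<open>\<Delta>(q\<^sup>2) = A B\<^sup>2\<close>.
\<close>

definition lambda_num :: "q2 fps" where "lambda_num = Sig 3 - fps_V (Sig 3)"

definition lambda_den :: "q2 fps" where "lambda_den = 1 + 16 * (16 * fps_V (Sig 3) - Sig 3)"

lemma Delta_eq: "1728 * Delta = Eis 4 ^ 3 - Eis 6 ^ 2"
proof -
  have "(1728 :: q2 fps) dvd 1"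
    by (simp add: fps_is_unit_iff fps_numeral_fps_const)
  hence "(1728 :: q2 fps) dvd Eis 4 ^ 3 - Eis 6 ^ 2"
    by (meson dvd_trans one_dvd)
  thus ?thesis by (simp add: Delta_def)
qed

lemma lambda_quotient:
  shows "lambda * lambda_den = lambda_num"
    and "27 * Eis 4 ^ 3 * (64 * lambda) = (Eis 4 ^ 3 - Eis 6 ^ 2) * (1 + 256 * lambda) ^ 3"
proof -
  define A B where "A = lambda_den" and "B = lambda_num"
  define Q R where "Q = Eis 4" and "R = Eis 6"
  define e where "e = (1 + 24 * Sig_odd 1 :: q2 fps)"
  note rel = level_two_relations[OF refl Eis_4 Eis_6 refl refl refl refl, folded Q_def R_def e_def]
  have Q: "Q = A + 256 * B" and Q2: "fps_V Q = A + 16 * B"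
    by (simp_all add: A_def B_def Q_def Eis_4 fps_V_ring_hom lambda_num_def lambda_den_def algebra_simps)
  have "5 * e ^ 2 = 5 * (A + 64 * B)" using rel(1) unfolding Q2 unfolding Q by algebra
  hence e2: "e ^ 2 = A + 64 * B" unfolding mult_cancel_left by simp
  have "10 * fps_V R = 10 * (e * (A - 8 * B))" using rel(2) unfolding Q2 unfolding Q by algebra
  hence R2: "fps_V R = e * (A - 8 * B)" unfolding mult_cancel_left by simp
  have "5 * R = 5 * (e * (A - 512 * B))" using rel(3) unfolding Q2 unfolding Q by algebra
  hence R: "R = e * (A - 512 * B)" unfolding mult_cancel_left by simp
  have "1728 * Delta = 1728 * (A ^ 2 * B)"
    using e2 unfolding Delta_eq Q_def[symmetric] R_def[symmetric] unfolding Q R by algebra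
  hence D: "Delta = A ^ 2 * B" unfolding mult_cancel_left by simp
  have "1728 * fps_V Delta = fps_V (1728 * Delta)" by (simp add: fps_V_ring_hom)
  also have "\<dots> = fps_V Q ^ 3 - fps_V R ^ 2"
    unfolding Delta_eq Q_def R_def by (simp add: fps_V_ring_hom power2_eq_square power3_eq_cube)
  also have "\<dots> = 1728 * (A * B ^ 2)" using e2 unfolding Q2 R2 by algebra
  finally have D2: "fps_V Delta = A * B ^ 2" by simp
  have A0: "fps_nth A 0 = 1" by (simp add: A_def lambda_den_def fps_V_nth Sig_def lambert_nth fps_numeral_fps_const)
  have B1: "fps_nth B 1 = 1" by (simp add: B_def lambda_num_def fps_V_nth Sig_def lambert_nth)
  have nz: "A \<noteq> 0" "B \<noteq> 0" using A0 B1 by auto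
  have "is_unit A" using A0 by (simp add: fps_is_unit_iff)
  then obtain C where C: "A * C = 1" by (metis dvdE)
  have "fps_V Delta = (B * C) * Delta" using C unfolding D2 unfolding D by algebra
  hence "lambda = B * C"
    unfolding lambda_def fps_V_def[symmetric] using nz by (simp add: D)
  hence L: "lambda * A = B" using C by algebra
  show "lambda * lambda_den = lambda_num" using L by (simp add: A_def B_def)
  have "A ^ 3 * (Q ^ 3 * (1728 * lambda)) = A ^ 3 * (1728 * Delta * (1 + 256 * lambda) ^ 3)"
    unfolding D Q L[symmetric] by algebra
  hence "Q ^ 3 * (1728 * lambda) = 1728 * Delta * (1 + 256 * lambda) ^ 3" using nz by simp
  thus "27 * Eis 4 ^ 3 * (64 * lambda) = (Eis 4 ^ 3 - Eis 6 ^ 2) * (1 + 256 * lambda) ^ 3"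
    unfolding Delta_eq Q_def by (simp add: mult_ac)
qed

section \<open>Modes of vertex operators\<close>

definition heis_const :: "q2 \<Rightarrow> heis" where "heis_const c = Poly_Mapping.single 0 c"

abbreviation heis_var :: "nat \<Rightarrow> heis" where "heis_var k \<equiv> monom_heis {#k#}"

lemma scale_heis_eq: "scale_heis c v = heis_const c * v"
  unfolding scale_heis_def heis_const_def by (rule mult_map_scale_conv_mult)

lemma heis_const_simps [simp]:
  "heis_const 0 = 0" "heis_const 1 = 1"
  by (simp_all add: heis_const_def)

lemma heis_const_hom:
  "heis_const (a + b) = heis_const a + heis_const b" "heis_const (a * b) = heis_const a * heis_const b"
  by (simp_all add: heis_const_def single_add mult_single)

lemma lookup_heis_const: "Poly_Mapping.lookup (heis_const c * v) I = c * Poly_Mapping.lookup v I"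
proof -
  have "heis_const c * v = Poly_Mapping.map ((*) c) v"
    by (simp add: heis_const_def mult_map_scale_conv_mult)
  thus ?thesis by (simp add: Poly_Mapping.map.rep_eq when_def)
qed

lemma lookup_heis_const': "Poly_Mapping.lookup (v * heis_const c) I = c * Poly_Mapping.lookup v I"
  by (simp add: lookup_heis_const mult.commute[of v])

lemma heis_sum_monom: "v = (\<Sum>I\<in>Poly_Mapping.keys v. heis_const (Poly_Mapping.lookup v I) * monom_heis I)"
proof (rule poly_mapping_eqI)
  fix J
  show "Poly_Mapping.lookup v J = Poly_Mapping.lookup (\<Sum>I\<in>Poly_Mapping.keys v. heis_const (Poly_Mapping.lookup v I) * monom_heis I) J"
    by (simp add: lookup_sum lookup_heis_const monom_heis_def lookup_single when_def in_keys_iff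
          if_distrib[of "(*) _"] cong: if_cong)
qed

definition heis_linear :: "(heis \<Rightarrow> heis) \<Rightarrow> bool" where
  "heis_linear f \<longleftrightarrow> (\<forall>u v. f (u + v) = f u + f v) \<and> (\<forall>c v. f (heis_const c * v) = heis_const c * f v)"

lemma heis_linear_add: "heis_linear f \<Longrightarrow> f (u + v) = f u + f v"
  and heis_linear_const: "heis_linear f \<Longrightarrow> f (heis_const c * v) = heis_const c * f v"
  by (simp_all add: heis_linear_def)

lemma heis_linear_0: "heis_linear f \<Longrightarrow> f 0 = 0"
  using heis_linear_const[of f 0 0] by simp

lemma heis_linear_sum: "heis_linear f \<Longrightarrow> f (sum g A) = (\<Sum>i\<in>A. f (g i))"
  by (induction A rule: infinite_finite_induct) (simp_all add: heis_linear_0 heis_linear_add)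

lemma heis_linear_eqI:
  assumes "heis_linear f" "heis_linear g" "\<And>I. f (monom_heis I) = g (monom_heis I)"
  shows "f v = g v"
  by (subst (1 2) heis_sum_monom[of v]) (simp add: assms heis_linear_sum heis_linear_const)

lemma monom_heis_mult: "monom_heis I * monom_heis J = monom_heis (I + J)"
  by (simp add: monom_heis_def mult_single)

lemma lookup_var_mult:
  "Poly_Mapping.lookup (heis_var k * v) I = (if k \<in># I then Poly_Mapping.lookup v (I - {#k#}) else 0)"
proof -
  have *: "I = {#k#} + J \<longleftrightarrow> k \<in># I \<and> I - {#k#} = J" for J by auto
  have "heis_var k * v = (\<Sum>J\<in>Poly_Mapping.keys v. heis_const (Poly_Mapping.lookup v J) * monom_heis ({#k#} + J))"
    by (subst (1) heis_sum_monom[of v])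
       (simp add: sum_distrib_left mult.left_commute[of "heis_var k"] monom_heis_mult)
  hence "Poly_Mapping.lookup (heis_var k * v) I =
      (\<Sum>J\<in>Poly_Mapping.keys v. if k \<in># I \<and> I - {#k#} = J then Poly_Mapping.lookup v J else 0)"
    by (simp only: lookup_sum lookup_heis_const)
       (auto simp: monom_heis_def lookup_single when_def intro!: sum.cong)
  thus ?thesis by (simp add: in_keys_iff)
qed

lemma lookup_deriv:
  "Poly_Mapping.lookup (deriv_heis k v) I = of_nat (count I k + 1) * Poly_Mapping.lookup v (add_mset k I)"
proof -
  have "Poly_Mapping.lookup (deriv_heis k v) I =
     (\<Sum>J\<in>Poly_Mapping.keys v. if J = add_mset k I then of_nat (count J k) * Poly_Mapping.lookup v J else 0)"
    unfolding deriv_heis_def lookup_sum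
  proof (rule sum.cong[OF refl])
    fix J
    show "Poly_Mapping.lookup (Poly_Mapping.single (J - {#k#}) (of_nat (count J k) * Poly_Mapping.lookup v J)) I =
        (if J = add_mset k I then of_nat (count J k) * Poly_Mapping.lookup v J else 0)"
      by (cases "k \<in># J") (auto simp: lookup_single when_def not_in_iff)
  qed
  thus ?thesis by (simp add: in_keys_iff)
qed

lemma heis_linear_deriv: "heis_linear (deriv_heis k)"
  unfolding heis_linear_def
  by (intro conjI allI poly_mapping_eqI) (simp_all add: lookup_deriv lookup_add lookup_heis_const lookup_heis_const' algebra_simps)

lemma deriv_monom: "deriv_heis k (monom_heis I) = heis_const (of_nat (count I k)) * monom_heis (I - {#k#})"
proof (rule poly_mapping_eqI)
  fix J
  show "Poly_Mapping.lookup (deriv_heis k (monom_heis I)) J =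
     Poly_Mapping.lookup (heis_const (of_nat (count I k)) * monom_heis (I - {#k#})) J"
    by (cases "k \<in># I") (auto simp: lookup_deriv lookup_heis_const monom_heis_def lookup_single when_def not_in_iff)
qed

lemma deriv_mult: "deriv_heis k (u * v) = deriv_heis k u * v + u * deriv_heis k v"
proof -
  have 1: "deriv_heis k (monom_heis I * monom_heis J) =
      deriv_heis k (monom_heis I) * monom_heis J + monom_heis I * deriv_heis k (monom_heis J)" for I J
  proof -
    have "heis_const (of_nat (count I k)) * monom_heis (I + J - {#k#}) =
       heis_const (of_nat (count I k)) * monom_heis (I - {#k#} + J)"
      by (cases "k \<in># I") (auto simp: not_in_iff)
    moreover have "heis_const (of_nat (count J k)) * monom_heis (I + J - {#k#}) =
       heis_const (of_nat (count J k)) * monom_heis (I + (J - {#k#}))"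
      by (cases "k \<in># J") (auto simp: not_in_iff)
    ultimately show ?thesis
      by (simp add: deriv_monom monom_heis_mult heis_const_hom distrib_right mult.assoc
            mult.left_commute[of "monom_heis I"])
  qed
  have lin: "heis_linear (\<lambda>u. deriv_heis k (u * v))" "heis_linear (\<lambda>v. deriv_heis k (u * v))"
    "heis_linear (\<lambda>u. deriv_heis k u * v + u * deriv_heis k v)"
    "heis_linear (\<lambda>v. deriv_heis k u * v + u * deriv_heis k v)" for u v
    using heis_linear_deriv[of k]
    by (simp_all add: heis_linear_def ring_distribs mult.assoc mult.left_commute[of _ "heis_const _"])
  have "deriv_heis k (monom_heis I * v) = deriv_heis k (monom_heis I) * v + monom_heis I * deriv_heis k v" for I v
    by (rule heis_linear_eqI[OF lin(2,4)]) (rule 1)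
  note 2 = this
  show ?thesis by (rule heis_linear_eqI[OF lin(1,3)]) (rule 2)
qed

lemma h_mode_neg: "n > 0 \<Longrightarrow> h_mode (- int n) v = heis_var (n - 1) * v"
  by (simp add: h_mode_def nat_diff_distrib)

lemma h_mode_pos: "n > 0 \<Longrightarrow> h_mode (int n) v = heis_const (of_nat n) * deriv_heis (n - 1) v"
  by (simp add: h_mode_def scale_heis_eq nat_diff_distrib)

lemma h_mode_0 [simp]: "h_mode 0 v = 0"
  by (simp add: h_mode_def)

lemma heis_linear_h_mode: "heis_linear (h_mode n)"
  using heis_linear_deriv
  by (simp add: heis_linear_def h_mode_def scale_heis_eq algebra_simps)

lemma h_mode_commute:
  assumes "n > 0"
  shows "h_mode i (h_mode (- int n) v) = h_mode (- int n) (h_mode i v) +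
     (if i = int n then heis_const (of_nat n) * v else 0)"
proof (cases "i > 0")
  case True
  then obtain m where m: "i = int m" "m > 0" by (metis zero_less_imp_eq_int)
  have "deriv_heis (m - 1) (heis_var (n - 1)) = (if m = n then 1 else 0)"
    using assms m(2) by (auto simp: deriv_monom) (simp add: monom_heis_def)
  thus ?thesis using assms m
    by (simp add: h_mode_pos h_mode_neg deriv_mult algebra_simps)
next
  case False
  thus ?thesis using assms by (auto simp: h_mode_def algebra_simps)
qed

definition wt_le :: "heis \<Rightarrow> int \<Rightarrow> bool" where
  "wt_le v w \<longleftrightarrow> (\<forall>I. Poly_Mapping.lookup v I \<noteq> 0 \<longrightarrow> int (wt I) \<le> w)"

lemma wt_add_mset [simp]: "wt (add_mset k I) = Suc k + wt I"
  by (simp add: wt_def)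

lemma wt_le_0 [simp]: "wt_le 0 w"
  by (simp add: wt_le_def)

lemma wt_le_add: "wt_le u w \<Longrightarrow> wt_le v w \<Longrightarrow> wt_le (u + v) w"
  unfolding wt_le_def lookup_add by (metis add.left_neutral)

lemma wt_le_const: "wt_le v w \<Longrightarrow> wt_le (heis_const c * v) w"
  unfolding wt_le_def lookup_heis_const by simp

lemma wt_le_sum: "(\<And>i. i \<in> A \<Longrightarrow> wt_le (f i) w) \<Longrightarrow> wt_le (sum f A) w"
  by (induction A rule: infinite_finite_induct) (simp_all add: wt_le_add)

lemma wt_le_mono: "wt_le v w \<Longrightarrow> w \<le> w' \<Longrightarrow> wt_le v w'"
  by (force simp: wt_le_def)

lemma wt_le_neg: "wt_le v w \<Longrightarrow> w < 0 \<Longrightarrow> v = 0"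
  by (rule poly_mapping_eqI) (force simp: wt_le_def)

lemma wt_le_ex: "\<exists>w\<ge>0. wt_le v w"
proof (intro exI[of _ "\<Sum>I\<in>Poly_Mapping.keys v. int (wt I)"] conjI)
  show "wt_le v (\<Sum>I\<in>Poly_Mapping.keys v. int (wt I))"
    unfolding wt_le_def by (auto intro!: member_le_sum simp: in_keys_iff)
qed (simp add: sum_nonneg)

lemma wt_le_monom: "wt_le (monom_heis I) (int (wt I))"
  by (simp add: wt_le_def monom_heis_def lookup_single when_def)

lemma wt_le_h_mode:
  assumes "wt_le v w"
  shows "wt_le (h_mode i v) (w - i)"
proof -
  consider n where "n > 0" "i = - int n" | "i = 0" | n where "n > 0" "i = int n"
    by (metis int_cases2 neq0_conv of_nat_0 minus_zero)
  thus ?thesis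
  proof cases
    case (1 n)
    have "int (wt I) \<le> w + int n" if nz: "Poly_Mapping.lookup (heis_var (n - 1) * v) I \<noteq> 0" for I
    proof -
      have I: "n - 1 \<in># I" "Poly_Mapping.lookup v (I - {#n - 1#}) \<noteq> 0"
        using nz by (auto simp: lookup_var_mult split: if_splits)
      have "wt I = wt (add_mset (n - 1) (I - {#n - 1#}))" using I(1) by simp
      also have "\<dots> = n + wt (I - {#n - 1#})" using 1 by (simp del: insert_DiffM)
      finally have "int (wt I) = int n + int (wt (I - {#n - 1#}))" by simp
      also have "int (wt (I - {#n - 1#})) \<le> w" using I(2) assms by (simp add: wt_le_def)
      finally show ?thesis by linarith
    qed
    thus ?thesis using 1 by (simp add: wt_le_def h_mode_neg)
  next
    case (3 n)
    have "int (wt I) \<le> w - int n" if "Poly_Mapping.lookup (deriv_heis (n - 1) v) I \<noteq> 0" for I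
    proof -
      have "Poly_Mapping.lookup v (add_mset (n - 1) I) \<noteq> 0" using that by (auto simp: lookup_deriv)
      hence "int (wt (add_mset (n - 1) I)) \<le> w" using assms unfolding wt_le_def by blast
      thus ?thesis using 3 by simp
    qed
    thus ?thesis using 3 by (simp add: wt_le_def h_mode_pos lookup_heis_const)
  qed simp
qed

definition hcoef :: "nat \<Rightarrow> int \<Rightarrow> q2" where
  "hcoef k i = of_int (- i - 1) gchoose k"

text \<open>The mode of \<open>vertex_op_list ks\<close> that lowers the weight by \<open>m\<close>.\<close>

definition vmode :: "nat list \<Rightarrow> int \<Rightarrow> heis \<Rightarrow> heis" where
  "vmode ks m v = vertex_op_list ks (m + int (\<Sum>k\<leftarrow>ks. Suc k) - 1) v"

definition vterm :: "nat list \<Rightarrow> int \<Rightarrow> int \<Rightarrow> heis \<Rightarrow> heis" where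
  "vterm ks m i v = (if i < 0 then h_mode i (vmode ks (m - i) v) else vmode ks (m - i) (h_mode i v))"

lemma vmode_Nil: "vmode [] m v = (if m = 0 then v else 0)"
  by (simp add: vmode_def)

lemma vmode_Cons_aux:
  assumes lin: "\<And>m. heis_linear (vmode ks m)"
    and wt: "\<And>m w v. wt_le v w \<Longrightarrow> wt_le (vmode ks m v) (w - m)"
    and v: "wt_le v w" and L: "w \<le> L" "w - m \<le> L"
  shows "vmode (k # ks) m v = (\<Sum>i\<in>{-L..L}. heis_const (hcoef k i) * vterm ks m i v)"
proof -
  define S where "S = int (\<Sum>k\<leftarrow>ks. Suc k)"
  define g where "g i = heis_const (hcoef k i) * vterm ks m i v" for i
  define A where "A = div_deriv k h_mode"
  define n where "n = m + (int k + 1 + S) - 1"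
  have V: "vertex_op_list ks (n - j - 1) u = vmode ks (m - (j - int k)) u" for j u
    unfolding vmode_def S_def[symmetric] n_def by (simp add: algebra_simps)
  have A: "A j u = heis_const (hcoef k (j - int k)) * h_mode (j - int k) u" for j u
    by (simp add: A_def div_deriv_def scale_heis_eq hcoef_def algebra_simps)
  have tm: "(if j < 0 then A j (vertex_op_list ks (n - j - 1) v) else vertex_op_list ks (n - j - 1) (A j v)) =
     g (j - int k)" for j
  proof (cases "0 \<le> j \<and> j < int k")
    case True
    define r where "r = nat (int k - j - 1)"
    have r: "- (j - int k) - 1 = int r" using True by (simp add: r_def)
    have "hcoef k (j - int k) = of_nat r gchoose k"
      unfolding hcoef_def r by simp
    also have "\<dots> = of_nat (r choose k)" by (rule binomial_gbinomial[symmetric])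
    also have "\<dots> = 0" using True by (simp add: r_def nat_less_iff)
    finally show ?thesis using True by (simp add: A V g_def heis_linear_0[OF lin])
  next
    case False
    thus ?thesis by (auto simp: A V g_def vterm_def heis_linear_const[OF lin])
  qed
  have g0: "g i = 0" if "i \<notin> {-L..L}" for i
  proof (cases "i < 0")
    case True
    have "vmode ks (m - i) v = 0" using that True L by (intro wt_le_neg[OF wt[OF v]]) auto
    thus ?thesis using True heis_linear_0[OF heis_linear_h_mode] by (simp add: g_def vterm_def)
  next
    case False
    hence "h_mode i v = 0" using that L by (intro wt_le_neg[OF wt_le_h_mode[OF v]]) auto
    thus ?thesis using False heis_linear_0[OF lin] by (simp add: g_def vterm_def)
  qed
  have "vmode (k # ks) m v = normal_ordered A (vertex_op_list ks) n v"
    by (simp add: vmode_def A_def n_def S_def algebra_simps)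
  also have "\<dots> = Sum_any (\<lambda>j. g (j - int k))"
    unfolding normal_ordered_def tm ..
  also have "\<dots> = (\<Sum>j\<in>{-L + int k..L + int k}. g (j - int k))"
    by (rule Sum_any.expand_superset) (use g0 in force)+
  also have "\<dots> = (\<Sum>i\<in>{-L..L}. g i)"
    by (rule sum.reindex_bij_witness[of _ "\<lambda>i. i + int k" "\<lambda>j. j - int k"]) auto
  finally show ?thesis unfolding g_def .
qed

lemma vmode_linear_wt:
  "heis_linear (vmode ks m) \<and> (\<forall>w v. wt_le v w \<longrightarrow> wt_le (vmode ks m v) (w - m))"
proof (induction ks arbitrary: m)
  case Nil
  show ?case by (auto simp: vmode_Nil heis_linear_def)
next
  case (Cons k ks)
  hence lin: "\<And>m. heis_linear (vmode ks m)" and wt: "\<And>m w v. wt_le v w \<Longrightarrow> wt_le (vmode ks m v) (w - m)"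
    by auto
  have aux: "vmode (k # ks) m v = (\<Sum>i\<in>{-L..L}. heis_const (hcoef k i) * vterm ks m i v)"
    if "wt_le v w" "w \<le> L" "w - m \<le> L" for m v w L
    by (rule vmode_Cons_aux[OF lin _ that]) (rule wt)
  have ltm: "heis_linear (vterm ks m i)" for i
    using lin heis_linear_h_mode unfolding heis_linear_def vterm_def by auto
  have lin': "heis_linear (vmode (k # ks) m)"
    unfolding heis_linear_def
  proof (intro conjI allI)
    fix u v
    obtain w1 where w1: "wt_le u w1" using wt_le_ex by blast
    obtain w2 where w2: "wt_le v w2" using wt_le_ex by blast
    define w where "w = max w1 w2"
    define L where "L = max w (w - m)"
    have w: "wt_le u w" "wt_le v w" "wt_le (u + v) w"
      using w1 w2 by (auto simp: w_def intro!: wt_le_add elim: wt_le_mono)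
    have L: "w \<le> L" "w - m \<le> L" by (auto simp: L_def)
    show "vmode (k # ks) m (u + v) = vmode (k # ks) m u + vmode (k # ks) m v"
      unfolding aux[OF w(1) L] aux[OF w(2) L] aux[OF w(3) L]
      by (simp add: heis_linear_add[OF ltm] sum.distrib ring_distribs)
  next
    fix c v
    obtain w where w: "wt_le v w" using wt_le_ex by blast
    define L where "L = max w (w - m)"
    have L: "w \<le> L" "w - m \<le> L" by (auto simp: L_def)
    show "vmode (k # ks) m (heis_const c * v) = heis_const c * vmode (k # ks) m v"
      unfolding aux[OF w L] aux[OF wt_le_const[OF w] L]
      by (simp add: heis_linear_const[OF ltm] sum_distrib_left mult.left_commute)
  qed
  have "wt_le (vmode (k # ks) m v) (w - m)" if w: "wt_le v w" for v w
  proof -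
    define L where "L = max w (w - m)"
    have L: "w \<le> L" "w - m \<le> L" by (auto simp: L_def)
    have "wt_le (vterm ks m i v) (w - m)" for i
      using wt_le_h_mode[OF wt[OF w, of "m - i"], of i] wt[OF wt_le_h_mode[OF w, of i], of "m - i"]
      by (auto simp: vterm_def)
    thus ?thesis unfolding aux[OF w L] by (intro wt_le_sum wt_le_const)
  qed
  with lin' show ?case by blast
qed

lemma heis_linear_vmode: "heis_linear (vmode ks m)"
  and wt_le_vmode: "wt_le v w \<Longrightarrow> wt_le (vmode ks m v) (w - m)"
  using vmode_linear_wt by blast+

lemma vmode_Cons:
  assumes "wt_le v w" "w \<le> L" "w - m \<le> L"
  shows "vmode (k # ks) m v = (\<Sum>i\<in>{-L..L}. heis_const (hcoef k i) * vterm ks m i v)"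
  by (rule vmode_Cons_aux[OF heis_linear_vmode _ assms]) (rule wt_le_vmode)

lemma vmode_Cons_ev: "\<exists>L0. \<forall>L\<ge>L0. vmode (k # ks) m v = (\<Sum>i\<in>{-L..L}. heis_const (hcoef k i) * vterm ks m i v)"
proof -
  obtain w where w: "wt_le v w" using wt_le_ex by blast
  show ?thesis by (intro exI[of _ "max w (w - m)"] allI impI vmode_Cons[OF w]) auto
qed

fun picks :: "'a list \<Rightarrow> ('a \<times> 'a list) list" where
  "picks [] = []"
| "picks (x # xs) = (x, xs) # map (\<lambda>(y, ys). (y, x # ys)) (picks xs)"

definition contract :: "(nat \<Rightarrow> q2) \<Rightarrow> (nat list \<Rightarrow> heis) \<Rightarrow> nat list \<Rightarrow> heis" where
  "contract f G ks = (\<Sum>(x, r)\<leftarrow>picks ks. heis_const (f x) * G r)"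

lemma contract_Nil [simp]: "contract f G [] = 0"
  by (simp add: contract_def)

lemma contract_Cons: "contract f G (k # ks) = heis_const (f k) * G ks + contract f (\<lambda>r. G (k # r)) ks"
  by (simp add: contract_def comp_def case_prod_unfold)

lemma contract_linear:
  assumes "heis_linear T"
  shows "T (contract f G ks) = contract f (\<lambda>r. T (G r)) ks"
  by (induction ks arbitrary: G) (simp_all add: contract_Cons heis_linear_0[OF assms] heis_linear_add[OF assms] heis_linear_const[OF assms])

lemma contract_sum: "(\<Sum>i\<in>A. heis_const (c i) * contract f (G i) ks) = contract f (\<lambda>r. \<Sum>i\<in>A. heis_const (c i) * G i r) ks"
proof (induction ks arbitrary: G)
  case (Cons k ks)
  have "(\<Sum>i\<in>A. heis_const (c i) * contract f (G i) (k # ks)) =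
     (\<Sum>i\<in>A. heis_const (f k) * (heis_const (c i) * G i ks)) + (\<Sum>i\<in>A. heis_const (c i) * contract f (\<lambda>r. G i (k # r)) ks)"
    unfolding contract_Cons distrib_left sum.distrib by (simp only: mult.left_commute)
  also have "\<dots> = heis_const (f k) * (\<Sum>i\<in>A. heis_const (c i) * G i ks) + contract f (\<lambda>r. \<Sum>i\<in>A. heis_const (c i) * G i (k # r)) ks"
    by (simp only: Cons.IH sum_distrib_left)
  finally show ?case by (simp only: contract_Cons)
qed simp

lemma contract_ev:
  assumes "\<And>r. \<exists>L0::int. \<forall>L\<ge>L0. G r = H L r"
  shows "\<exists>L0. \<forall>L\<ge>L0. contract f G ks = contract f (H L) ks"
  using assms
proof (induction ks arbitrary: G H)
  case (Cons k ks)
  obtain L1 where "\<forall>L\<ge>L1. contract f (\<lambda>r. G (k # r)) ks = contract f (\<lambda>r. H L (k # r)) ks"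
    using Cons.IH[of "\<lambda>r. G (k # r)" "\<lambda>L r. H L (k # r)"] Cons.prems by blast
  moreover obtain L2 where "\<forall>L\<ge>L2. G ks = H L ks" using Cons.prems by blast
  ultimately show ?case by (intro exI[of _ "max L1 L2"]) (auto simp: contract_Cons)
qed auto

lemma vmode_creation:
  assumes "n > 0"
  shows "vmode ks m (h_mode (- int n) v) = h_mode (- int n) (vmode ks m v) +
     heis_const (of_nat n) * contract (\<lambda>x. hcoef x (int n)) (\<lambda>r. vmode r (m - int n) v) ks"
proof (induction ks arbitrary: m v)
  case Nil
  show ?case using heis_linear_0[OF heis_linear_h_mode] by (simp add: vmode_Nil)
next
  case (Cons k ks)
  let ?h = "h_mode (- int n)" and ?c = heis_const and ?f = "\<lambda>x. hcoef x (int n)"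
  obtain L1 where L1: "\<forall>L\<ge>L1. vmode (k # ks) m (?h v) = (\<Sum>i\<in>{-L..L}. ?c (hcoef k i) * vterm ks m i (?h v))"
    using vmode_Cons_ev by blast
  obtain L2 where L2: "\<forall>L\<ge>L2. vmode (k # ks) m v = (\<Sum>i\<in>{-L..L}. ?c (hcoef k i) * vterm ks m i v)"
    using vmode_Cons_ev by blast
  have "\<exists>L3. \<forall>L\<ge>L3. contract ?f (\<lambda>r. vmode (k # r) (m - int n) v) ks =
      contract ?f (\<lambda>r. (\<Sum>i\<in>{-L..L}. ?c (hcoef k i) * vterm r (m - int n) i v)) ks"
    by (rule contract_ev[where H = "\<lambda>L r. (\<Sum>i\<in>{-L..L}. ?c (hcoef k i) * vterm r (m - int n) i v)"]) (rule vmode_Cons_ev)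
  then obtain L3 where L3: "\<forall>L\<ge>L3. contract ?f (\<lambda>r. vmode (k # r) (m - int n) v) ks =
      contract ?f (\<lambda>r. (\<Sum>i\<in>{-L..L}. ?c (hcoef k i) * vterm r (m - int n) i v)) ks" by blast
  define L where "L = max (int n) (max L1 (max L2 L3))"
  have "L1 \<le> L" "L2 \<le> L" "L3 \<le> L" and nL: "int n \<le> L" by (simp_all add: L_def)
  note L1 = L1[rule_format, OF this(1)] and L2 = L2[rule_format, OF this(2)] and L3 = L3[rule_format, OF this(3)]
  have step: "vterm ks m i (?h v) = ?h (vterm ks m i v) +
      (?c (of_nat n) * contract ?f (\<lambda>r. vterm r (m - int n) i v) ks +
       (if i = int n then ?c (of_nat n) * vmode ks (m - int n) v else 0))" for i
  proof (cases "i < 0")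
    case True
    hence "vterm ks m i (?h v) = h_mode i (vmode ks (m - i) (?h v))" by (simp add: vterm_def)
    also have "\<dots> = h_mode i (?h (vmode ks (m - i) v)) + ?c (of_nat n) * contract ?f (\<lambda>r. h_mode i (vmode r (m - i - int n) v)) ks"
      unfolding Cons.IH heis_linear_add[OF heis_linear_h_mode] heis_linear_const[OF heis_linear_h_mode]
        contract_linear[OF heis_linear_h_mode] ..
    also have "h_mode i (?h (vmode ks (m - i) v)) = ?h (vterm ks m i v)"
      using True h_mode_commute[OF assms, of i] by (simp add: vterm_def)
    also have "(\<lambda>r. h_mode i (vmode r (m - i - int n) v)) = (\<lambda>r. vterm r (m - int n) i v)"
      using True by (simp add: vterm_def fun_eq_iff algebra_simps)
    finally show ?thesis using True by simp
  next
    case False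
    hence "vterm ks m i (?h v) = vmode ks (m - i) (h_mode i (?h v))" by (simp add: vterm_def)
    also have "h_mode i (?h v) = ?h (h_mode i v) + (if i = int n then ?c (of_nat n) * v else 0)"
      by (rule h_mode_commute[OF assms])
    also have "vmode ks (m - i) \<dots> = vmode ks (m - i) (?h (h_mode i v)) +
        (if i = int n then ?c (of_nat n) * vmode ks (m - int n) v else 0)"
      by (simp add: heis_linear_add[OF heis_linear_vmode] heis_linear_const[OF heis_linear_vmode]
            heis_linear_0[OF heis_linear_vmode])
    also have "vmode ks (m - i) (?h (h_mode i v)) = ?h (vterm ks m i v) +
        ?c (of_nat n) * contract ?f (\<lambda>r. vterm r (m - int n) i v) ks"
      unfolding Cons.IH using False by (simp add: vterm_def algebra_simps)
    finally show ?thesis by (simp add: add.assoc)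
  qed
  have "vmode (k # ks) m (?h v) = (\<Sum>i\<in>{-L..L}. ?c (hcoef k i) * vterm ks m i (?h v))"
    by (simp only: L1)
  also have "\<dots> = (\<Sum>i\<in>{-L..L}. ?c (hcoef k i) * ?h (vterm ks m i v)) +
     (?c (of_nat n) * (\<Sum>i\<in>{-L..L}. ?c (hcoef k i) * contract ?f (\<lambda>r. vterm r (m - int n) i v) ks) +
      (\<Sum>i\<in>{-L..L}. if i = int n then ?c (hcoef k i) * (?c (of_nat n) * vmode ks (m - int n) v) else 0))"
    unfolding step
    by (simp add: ring_distribs sum.distrib sum_distrib_left mult.left_commute if_distrib[of "(*) _"] cong: if_cong)
  also have "(\<Sum>i\<in>{-L..L}. ?c (hcoef k i) * ?h (vterm ks m i v)) = ?h (vmode (k # ks) m v)"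
    unfolding L2 by (simp add: heis_linear_sum[OF heis_linear_h_mode] heis_linear_const[OF heis_linear_h_mode])
  also have "(\<Sum>i\<in>{-L..L}. ?c (hcoef k i) * contract ?f (\<lambda>r. vterm r (m - int n) i v) ks) =
      contract ?f (\<lambda>r. vmode (k # r) (m - int n) v) ks"
    unfolding contract_sum by (simp only: L3)
  also have "(\<Sum>i\<in>{-L..L}. if i = int n then ?c (hcoef k i) * (?c (of_nat n) * vmode ks (m - int n) v) else 0) =
     ?c (of_nat n) * (?c (hcoef k (int n)) * vmode ks (m - int n) v)"
    using nL by (subst sum.delta) (auto simp: mult.left_commute)
  finally show ?case by (simp add: contract_Cons ring_distribs add_ac)
qed

lemma vmode_annihilation:
  assumes "n > 0"
  shows "h_mode (int n) (vmode ks m v) = vmode ks m (h_mode (int n) v) +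
     heis_const (of_nat n) * contract (\<lambda>x. hcoef x (- int n)) (\<lambda>r. vmode r (m + int n) v) ks"
proof (induction ks arbitrary: m v)
  case Nil
  show ?case using heis_linear_0[OF heis_linear_h_mode] by (simp add: vmode_Nil)
next
  case (Cons k ks)
  let ?h = "h_mode (int n)" and ?c = heis_const and ?f = "\<lambda>x. hcoef x (- int n)"
  obtain L1 where L1: "\<forall>L\<ge>L1. vmode (k # ks) m (?h v) = (\<Sum>i\<in>{-L..L}. ?c (hcoef k i) * vterm ks m i (?h v))"
    using vmode_Cons_ev by blast
  obtain L2 where L2: "\<forall>L\<ge>L2. vmode (k # ks) m v = (\<Sum>i\<in>{-L..L}. ?c (hcoef k i) * vterm ks m i v)"
    using vmode_Cons_ev by blast
  have "\<exists>L3. \<forall>L\<ge>L3. contract ?f (\<lambda>r. vmode (k # r) (m + int n) v) ks =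
      contract ?f (\<lambda>r. (\<Sum>i\<in>{-L..L}. ?c (hcoef k i) * vterm r (m + int n) i v)) ks"
    by (rule contract_ev[where H = "\<lambda>L r. (\<Sum>i\<in>{-L..L}. ?c (hcoef k i) * vterm r (m + int n) i v)"]) (rule vmode_Cons_ev)
  then obtain L3 where L3: "\<forall>L\<ge>L3. contract ?f (\<lambda>r. vmode (k # r) (m + int n) v) ks =
      contract ?f (\<lambda>r. (\<Sum>i\<in>{-L..L}. ?c (hcoef k i) * vterm r (m + int n) i v)) ks" by blast
  define L where "L = max (int n) (max L1 (max L2 L3))"
  have "L1 \<le> L" "L2 \<le> L" "L3 \<le> L" and nL: "int n \<le> L" by (simp_all add: L_def)
  note L1 = L1[rule_format, OF this(1)] and L2 = L2[rule_format, OF this(2)] and L3 = L3[rule_format, OF this(3)]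
  have ann: "?h (h_mode i u) = h_mode i (?h u) + (if i = - int n then ?c (of_nat n) * u else 0)" if "i < 0" for i u
    using h_mode_commute[of "nat (- i)" "int n" u] that by auto
  have ann': "?h (h_mode i u) = h_mode i (?h u)" if "i \<ge> 0" for i u
  proof -
    have "deriv_heis a (deriv_heis b u) = deriv_heis b (deriv_heis a u)" for a b
      by (rule poly_mapping_eqI) (auto simp: lookup_deriv add_mset_commute)
    thus ?thesis using assms that
      by (simp add: h_mode_def scale_heis_eq heis_linear_const[OF heis_linear_deriv]
           heis_linear_0[OF heis_linear_deriv] mult.left_commute)
  qed
  have step: "?h (vterm ks m i v) = vterm ks m i (?h v) +
      (?c (of_nat n) * contract ?f (\<lambda>r. vterm r (m + int n) i v) ks +
       (if i = - int n then ?c (of_nat n) * vmode ks (m + int n) v else 0))" for i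
  proof (cases "i < 0")
    case True
    hence "?h (vterm ks m i v) = ?h (h_mode i (vmode ks (m - i) v))" by (simp add: vterm_def)
    also have "\<dots> = h_mode i (?h (vmode ks (m - i) v)) + (if i = - int n then ?c (of_nat n) * vmode ks (m + int n) v else 0)"
      by (simp add: ann[OF True])
    also have "h_mode i (?h (vmode ks (m - i) v)) = h_mode i (vmode ks (m - i) (?h v)) + ?c (of_nat n) * contract ?f (\<lambda>r. h_mode i (vmode r (m - i + int n) v)) ks"
      unfolding Cons.IH heis_linear_add[OF heis_linear_h_mode] heis_linear_const[OF heis_linear_h_mode]
        contract_linear[OF heis_linear_h_mode] ..
    also have "(\<lambda>r. h_mode i (vmode r (m - i + int n) v)) = (\<lambda>r. vterm r (m + int n) i v)"
      using True by (simp add: vterm_def fun_eq_iff algebra_simps)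
    finally show ?thesis using True by (simp add: vterm_def add.assoc)
  next
    case False
    hence "?h (vterm ks m i v) = ?h (vmode ks (m - i) (h_mode i v))" by (simp add: vterm_def)
    also have "\<dots> = vmode ks (m - i) (h_mode i (?h v)) + ?c (of_nat n) * contract ?f (\<lambda>r. vmode r (m - i + int n) (h_mode i v)) ks"
      unfolding Cons.IH using False by (simp add: ann')
    also have "(\<lambda>r. vmode r (m - i + int n) (h_mode i v)) = (\<lambda>r. vterm r (m + int n) i v)"
      using False by (simp add: vterm_def fun_eq_iff algebra_simps)
    finally show ?thesis using False assms by (simp add: vterm_def)
  qed
  have "?h (vmode (k # ks) m v) = (\<Sum>i\<in>{-L..L}. ?c (hcoef k i) * ?h (vterm ks m i v))"
    unfolding L2 by (simp add: heis_linear_sum[OF heis_linear_h_mode] heis_linear_const[OF heis_linear_h_mode])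
  also have "\<dots> = (\<Sum>i\<in>{-L..L}. ?c (hcoef k i) * vterm ks m i (?h v)) +
     (?c (of_nat n) * (\<Sum>i\<in>{-L..L}. ?c (hcoef k i) * contract ?f (\<lambda>r. vterm r (m + int n) i v) ks) +
      (\<Sum>i\<in>{-L..L}. if i = - int n then ?c (hcoef k i) * (?c (of_nat n) * vmode ks (m + int n) v) else 0))"
    unfolding step
    by (simp add: ring_distribs sum.distrib sum_distrib_left mult.left_commute if_distrib[of "(*) _"] cong: if_cong)
  also have "(\<Sum>i\<in>{-L..L}. ?c (hcoef k i) * vterm ks m i (?h v)) = vmode (k # ks) m (?h v)"
    by (simp only: L1)
  also have "(\<Sum>i\<in>{-L..L}. ?c (hcoef k i) * contract ?f (\<lambda>r. vterm r (m + int n) i v) ks) =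
      contract ?f (\<lambda>r. vmode (k # r) (m + int n) v) ks"
    unfolding contract_sum by (simp only: L3)
  also have "(\<Sum>i\<in>{-L..L}. if i = - int n then ?c (hcoef k i) * (?c (of_nat n) * vmode ks (m + int n) v) else 0) =
     ?c (of_nat n) * (?c (hcoef k (- int n)) * vmode ks (m + int n) v)"
    using nL by (subst sum.delta) (auto simp: mult.left_commute)
  finally show ?case by (simp add: contract_Cons ring_distribs add_ac)
qed

section \<open>Characters and the trace recursion\<close>

lemma size_le_wt: "size I \<le> wt I"
  by (induction I) (auto simp: wt_def)

lemma mem_less_wt: "k \<in># I \<Longrightarrow> k < wt I"
  by (metis insert_DiffM wt_add_mset less_Suc_eq_le le_add1 add_Suc)

lemma wt_diff: "k \<in># I \<Longrightarrow> Suc k + wt (I - {#k#}) = wt I"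
  by (metis insert_DiffM wt_add_mset)

lemma finite_wt [simp]: "finite {I. wt I = n}"
proof (rule finite_subset)
  show "{I. wt I = n} \<subseteq> mset ` {xs. set xs \<subseteq> {..<n} \<and> length xs \<le> n}"
  proof safe
    fix I assume n: "n = wt I"
    obtain xs where xs: "mset xs = I" using ex_mset by blast
    have "set xs \<subseteq> {..<wt I}" using mem_less_wt xs by auto
    moreover have "length xs \<le> wt I" using size_le_wt[of I] xs by auto
    ultimately show "I \<in> mset ` {xs. set xs \<subseteq> {..<wt I} \<and> length xs \<le> wt I}" using xs by blast
  qed
  show "finite (mset ` {xs. set xs \<subseteq> {..<n} \<and> length xs \<le> n})"
    by (intro finite_imageI finite_lists_length_le) auto
qed

lemma graded_trace_add: "graded_trace N (\<lambda>v. f v + g v) = graded_trace N f + graded_trace N g"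
  by (simp add: graded_trace_def lookup_add sum.distrib)

lemma graded_trace_const: "graded_trace N (\<lambda>v. heis_const c * f v) = c * graded_trace N f"
  by (simp add: graded_trace_def lookup_heis_const sum_distrib_left)

lemma graded_trace_sum: "graded_trace N (\<lambda>v. \<Sum>i\<in>A. f i v) = (\<Sum>i\<in>A. graded_trace N (f i))"
  unfolding graded_trace_def lookup_sum by (rule sum.swap)

lemma graded_trace_contract:
  "graded_trace N (\<lambda>v. contract f (\<lambda>r. G r v) ks) = (\<Sum>(x, r)\<leftarrow>picks ks. f x * graded_trace N (G r))"
proof (induction ks arbitrary: G)
  case Nil
  show ?case by (simp add: graded_trace_def)
next
  case (Cons k ks)
  show ?case
    by (simp add: contract_Cons graded_trace_add graded_trace_const Cons.IH comp_def case_prod_unfold)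
qed

lemma graded_trace_cong: "(\<And>I. wt I = N \<Longrightarrow> f (monom_heis I) = g (monom_heis I)) \<Longrightarrow> graded_trace N f = graded_trace N g"
  by (auto simp: graded_trace_def intro!: sum.cong)

lemma var_mult_monom: "heis_var k * monom_heis I = monom_heis (add_mset k I)"
  by (simp add: monom_heis_mult)

lemma sum_wt_reindex:
  assumes "n > 0"
  shows "(\<Sum>I | wt I = N. if n - 1 \<in># I then f I else 0) =
    (if n \<le> N then \<Sum>J | wt J = N - n. f (add_mset (n - 1) J) else (0::q2))"
proof -
  have "(\<Sum>I | wt I = N. if n - 1 \<in># I then f I else 0) = (\<Sum>I | wt I = N \<and> n - 1 \<in># I. f I)"
    by (rule sum.mono_neutral_cong_right) auto
  also have "\<dots> = (\<Sum>J | n + wt J = N. f (add_mset (n - 1) J))"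
    by (rule sum.reindex_bij_witness[of _ "add_mset (n - 1)" "\<lambda>I. I - {#n - 1#}"])
       (use assms wt_diff[of "n - 1"] in auto)
  also have "{J. n + wt J = N} = (if n \<le> N then {J. wt J = N - n} else {})" by auto
  finally show ?thesis by simp
qed

lemma graded_trace_creation:
  assumes "n > 0"
  shows "graded_trace N (\<lambda>v. h_mode (- int n) (X v)) =
    (if n \<le> N then graded_trace (N - n) (\<lambda>v. X (h_mode (- int n) v)) else 0)"
  unfolding graded_trace_def h_mode_neg[OF assms] lookup_var_mult sum_wt_reindex[OF assms] var_mult_monom
  by simp

lemma graded_trace_annihilation:
  assumes "n > 0" "heis_linear X"
  shows "graded_trace N (\<lambda>v. X (h_mode (int n) v)) =
    (if n \<le> N then graded_trace (N - n) (\<lambda>v. h_mode (int n) (X v)) else 0)"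
proof -
  have "graded_trace N (\<lambda>v. X (h_mode (int n) v)) = (\<Sum>I | wt I = N. if n - 1 \<in># I then
       of_nat n * (of_nat (count I (n - 1)) * Poly_Mapping.lookup (X (monom_heis (I - {#n - 1#}))) I) else 0)"
    unfolding graded_trace_def h_mode_pos[OF assms(1)] deriv_monom heis_linear_const[OF assms(2)] lookup_heis_const
    by (rule sum.cong) (auto simp: not_in_iff)
  also have "\<dots> = (if n \<le> N then graded_trace (N - n) (\<lambda>v. h_mode (int n) (X v)) else 0)"
    unfolding sum_wt_reindex[OF assms(1)] graded_trace_def h_mode_pos[OF assms(1)] lookup_heis_const lookup_deriv
    by (simp add: algebra_simps)
  finally show ?thesis .
qed

definition list_char :: "nat list \<Rightarrow> q2 fps" where
  "list_char ks = Abs_fps (\<lambda>N. graded_trace N (vmode ks 0))"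

definition pairing :: "nat \<Rightarrow> nat \<Rightarrow> q2 fps" where
  "pairing k l = lambert (\<lambda>d. of_nat d * (hcoef k (- int d) * hcoef l (int d) + hcoef k (int d) * hcoef l (- int d)))"

lemma pairing_commute: "pairing k l = pairing l k"
  by (simp add: pairing_def mult.commute add.commute)

lemma fps_nth_const_sum_list:
  fixes T :: "nat list \<Rightarrow> 'a::comm_ring_1 fps"
  shows "fps_nth (\<Sum>(x, r)\<leftarrow>ps. fps_const (f x) * T r) n = (\<Sum>(x, r)\<leftarrow>ps. f x * fps_nth (T r) n)"
  by (induction ps) auto

text \<open>
  By cyclicity of the trace and the commutation relation, a trace \<open>f\<close> involving \<open>h(n)\<close> or \<open>h(-n)\<close> satisfies
  \<open>f = q\<^sup>n (f + g)\<close>, where \<open>g\<close> comes from the commutator.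
\<close>

lemma char_creation:
  assumes "n > 0"
  shows "Abs_fps (\<lambda>N. graded_trace N (\<lambda>v. h_mode (- int n) (vmode ks (int n) v))) =
    geo n * (of_nat n * (\<Sum>(x, r)\<leftarrow>picks ks. fps_const (hcoef x (int n)) * list_char r))"
  by (rule geo_unique[OF assms], rule fps_ext)
     (simp add: fps_X_power_mult_nth graded_trace_creation[OF assms] vmode_creation[OF assms]
       graded_trace_add graded_trace_const graded_trace_contract fps_nth_const_sum_list list_char_def
       flip: fps_of_nat)

lemma char_annihilation:
  assumes "n > 0"
  shows "Abs_fps (\<lambda>N. graded_trace N (\<lambda>v. vmode ks (- int n) (h_mode (int n) v))) =
    geo n * (of_nat n * (\<Sum>(x, r)\<leftarrow>picks ks. fps_const (hcoef x (- int n)) * list_char r))"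
  by (rule geo_unique[OF assms], rule fps_ext)
     (simp add: fps_X_power_mult_nth graded_trace_annihilation[OF assms heis_linear_vmode] vmode_annihilation[OF assms]
       graded_trace_add graded_trace_const graded_trace_contract fps_nth_const_sum_list list_char_def
       flip: fps_of_nat)

lemma sum_int_symmetric:
  fixes f :: "int \<Rightarrow> 'a::comm_monoid_add"
  shows "(\<Sum>i\<in>{- int N..int N}. f i) = f 0 + (\<Sum>n=1..N. f (- int n) + f (int n))"
proof (induction N)
  case (Suc N)
  have "{- int (Suc N)..int (Suc N)} = insert (- int (Suc N)) (insert (int (Suc N)) {- int N..int N})" by auto
  thus ?case using Suc by (simp add: add_ac)
qed auto

lemma list_char_Nil_nth: "fps_nth (list_char []) N = of_nat (card {I. wt I = N})"
  by (simp add: list_char_def vmode_Nil graded_trace_def monom_heis_def)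

lemma list_char_Cons:
  "list_char (k # ks) = (\<Sum>(x, r)\<leftarrow>picks ks. pairing k x * list_char r)"
proof (rule fps_eqI_upto)
  fix N
  let ?c = "fps_const :: q2 \<Rightarrow> q2 fps"
  define W where "W n x = ?c (of_nat n * (hcoef k (- int n) * hcoef x (int n) + hcoef k (int n) * hcoef x (- int n)))"
    for n x
  have main: "fps_nth (list_char (k # ks)) M = fps_nth (\<Sum>n=1..M. geo n * (\<Sum>(x, r)\<leftarrow>picks ks. W n x * list_char r)) M" for M
  proof -
    have "fps_nth (list_char (k # ks)) M =
        graded_trace M (\<lambda>v. \<Sum>i\<in>{- int M..int M}. heis_const (hcoef k i) * vterm ks 0 i v)"
      unfolding list_char_def fps_nth_Abs_fps
      by (rule graded_trace_cong, rule vmode_Cons[OF wt_le_monom]) auto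
    also have "\<dots> = (\<Sum>i\<in>{- int M..int M}. hcoef k i * graded_trace M (vterm ks 0 i))"
      unfolding graded_trace_sum graded_trace_const ..
    also have "\<dots> = hcoef k 0 * graded_trace M (vterm ks 0 0) + (\<Sum>n=1..M. hcoef k (- int n) * graded_trace M (vterm ks 0 (- int n))
        + hcoef k (int n) * graded_trace M (vterm ks 0 (int n)))"
      by (rule sum_int_symmetric)
    also have "graded_trace M (vterm ks 0 0) = 0"
      by (simp add: graded_trace_def vterm_def heis_linear_0[OF heis_linear_vmode])
    also have "(\<Sum>n=1..M. hcoef k (- int n) * graded_trace M (vterm ks 0 (- int n)) + hcoef k (int n) * graded_trace M (vterm ks 0 (int n))) =
       (\<Sum>n=1..M. fps_nth (geo n * (\<Sum>(x, r)\<leftarrow>picks ks. W n x * list_char r)) M)"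
    proof (intro sum.cong refl)
      fix n assume "n \<in> {1..M}"
      hence n: "n > 0" by simp
      have "graded_trace M (vterm ks 0 (- int n)) = fps_nth (Abs_fps (\<lambda>N. graded_trace N (\<lambda>v. h_mode (- int n) (vmode ks (int n) v)))) M"
        using n by (simp add: vterm_def[abs_def])
      moreover have "graded_trace M (vterm ks 0 (int n)) = fps_nth (Abs_fps (\<lambda>N. graded_trace N (\<lambda>v. vmode ks (- int n) (h_mode (int n) v)))) M"
        using n by (simp add: vterm_def[abs_def])
      moreover have "?c (hcoef k (- int n)) * (\<Sum>(x, r)\<leftarrow>ps. ?c (hcoef x (int n)) * list_char r) * of_nat n +
           ?c (hcoef k (int n)) * (\<Sum>(x, r)\<leftarrow>ps. ?c (hcoef x (- int n)) * list_char r) * of_nat n =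
           (\<Sum>(x, r)\<leftarrow>ps. W n x * list_char r)" for ps
        by (induction ps)
           (auto simp: W_def algebra_simps simp flip: fps_const_mult fps_const_add fps_of_nat)
      note this[of "picks ks", symmetric]
      ultimately show "hcoef k (- int n) * graded_trace M (vterm ks 0 (- int n)) + hcoef k (int n) * graded_trace M (vterm ks 0 (int n)) =
          fps_nth (geo n * (\<Sum>(x, r)\<leftarrow>picks ks. W n x * list_char r)) M"
        unfolding char_creation[OF n] char_annihilation[OF n] by (simp add: algebra_simps flip: fps_mult_left_const_nth)
    qed
    finally show ?thesis by (simp add: fps_sum_nth)
  qed
  have "fps_eq_upto M (\<Sum>n=1..M. geo n * (\<Sum>(x, r)\<leftarrow>ps. W n x * list_char r)) (\<Sum>(x, r)\<leftarrow>ps. pairing k x * list_char r)" for ps M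
  proof (induction ps)
    case (Cons p ps)
    have "fps_eq_upto M (\<Sum>n=1..M. W n x * geo n) (pairing k x)" for x
      unfolding pairing_def W_def by (rule fps_eq_upto_sym[OF lambert_upto]) simp
    hence "fps_eq_upto M ((\<Sum>n=1..M. W n (fst p) * geo n) * list_char (snd p)) (pairing k (fst p) * list_char (snd p))"
      by (intro fps_eq_upto_mult fps_eq_upto_refl)
    from fps_eq_upto_add[OF this Cons.IH] show ?case
      by (simp add: case_prod_unfold ring_distribs sum.distrib sum_distrib_right sum_distrib_left mult_ac)
  qed simp
  thus "fps_eq_upto N (list_char (k # ks)) (\<Sum>(x, r)\<leftarrow>picks ks. pairing k x * list_char r)"
    unfolding fps_eq_upto_def main by auto
qed

lemma picks_mset: "(x, r) \<in> set (picks ks) \<Longrightarrow> mset ks = add_mset x (mset r)"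
  by (induction ks arbitrary: r) auto

lemma mset_fst_picks: "mset (map fst (picks ks)) = mset ks"
proof (induction ks)
  case (Cons k ks)
  have "map fst (map (\<lambda>(y, ys). (y, k # ys)) (picks ks)) = map fst (picks ks)" by auto
  thus ?case using Cons by (simp del: map_map)
qed simp

lemma sum_picks_mset:
  fixes W :: "nat \<Rightarrow> 'a::comm_ring_1"
  assumes "\<And>x r. (x, r) \<in> set (picks ks) \<Longrightarrow> T r = H (mset r)"
  shows "(\<Sum>(x, r)\<leftarrow>picks ks. W x * T r) = (\<Sum>x\<in>#mset ks. W x * H (mset ks - {#x#}))"
proof -
  have "(\<Sum>(x, r)\<leftarrow>picks ks. W x * T r) = (\<Sum>p\<leftarrow>picks ks. W (fst p) * H (mset ks - {#fst p#}))"
    by (intro arg_cong[where f = sum_list] map_cong) (auto simp: assms picks_mset)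
  also have "\<dots> = (\<Sum>x\<leftarrow>map fst (picks ks). W x * H (mset ks - {#x#}))"
    by (simp add: comp_def)
  also have "\<dots> = (\<Sum>x\<in>#mset (map fst (picks ks)). W x * H (mset ks - {#x#}))"
    by (simp only: sum_mset_sum_list[symmetric] mset_map)
  finally show ?thesis unfolding mset_fst_picks .
qed

lemma sum_picks_swap:
  fixes g :: "nat \<Rightarrow> nat \<Rightarrow> nat list \<Rightarrow> 'a::comm_monoid_add"
  shows "(\<Sum>(x, r)\<leftarrow>picks ks. \<Sum>(y, s)\<leftarrow>picks r. g x y s) = (\<Sum>(x, r)\<leftarrow>picks ks. \<Sum>(y, s)\<leftarrow>picks r. g y x s)"
proof (induction ks arbitrary: g)
  case (Cons k ks)
  have "(\<Sum>(x, r)\<leftarrow>picks (k # ks). \<Sum>(y, s)\<leftarrow>picks r. g x y s) =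
     ((\<Sum>(x, r)\<leftarrow>picks ks. g k x r) + (\<Sum>(x, r)\<leftarrow>picks ks. g x k r)) +
     (\<Sum>(x, r)\<leftarrow>picks ks. \<Sum>(y, s)\<leftarrow>picks r. g x y (k # s))" for g :: "nat \<Rightarrow> nat \<Rightarrow> nat list \<Rightarrow> 'a"
    by (simp add: comp_def case_prod_unfold sum_list_addf add.assoc)
  from this[of g] this[of "\<lambda>x y. g y x"] Cons.IH[of "\<lambda>x y s. g x y (k # s)"]
  show ?case by (simp add: add_ac)
qed simp

lemma list_char_swap: "list_char (k # l # ks) = list_char (l # k # ks)"
proof -
  have "list_char (k # l # ks) = pairing k l * list_char ks +
     (\<Sum>(x, r)\<leftarrow>picks ks. \<Sum>(y, s)\<leftarrow>picks r. pairing k x * (pairing l y * list_char s))" for k l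
    by (simp add: list_char_Cons[of k] list_char_Cons[of l] comp_def case_prod_unfold sum_list_const_mult)
  from this[of k l] this[of l k] show ?thesis
    by (simp add: pairing_commute[of k l] mult.left_commute
          sum_picks_swap[of "\<lambda>x y s. pairing k x * (pairing l y * list_char s)"])
qed

lemma list_char_mset: "mset xs = mset ys \<Longrightarrow> list_char xs = list_char ys"
proof (induction xs arbitrary: ys rule: length_induct)
  case (1 xs)
  define H where "H M = list_char (SOME r. mset r = M)" for M
  have H: "list_char r = H (mset r)" if "length r < length xs" for r
  proof -
    have "mset (SOME s. mset s = mset r) = mset r" by (rule someI) auto
    thus ?thesis unfolding H_def using that 1(1) by metis
  qed
  have pick_len: "Suc (length r) = length us" if "(x, r) \<in> set (picks us)" for x r and us :: "nat list"
    using arg_cong[OF picks_mset[OF that], of size] by simp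
  have *: "list_char (k # us) = (\<Sum>x\<in>#mset us. pairing k x * H (mset us - {#x#}))" if "length us < length xs" for k us
    unfolding list_char_Cons
  proof (rule sum_picks_mset)
    fix x r assume "(x, r) \<in> set (picks us)"
    thus "list_char r = H (mset r)" using pick_len[of x r us] that by (intro H) simp
  qed
  have **: "list_char (k # us) = list_char (k # vs)" if "mset us = mset vs" "length us < length xs" for k us vs
    using that *[of us k] *[of vs k] mset_eq_length[OF that(1)] by simp
  show ?case
  proof (cases xs)
    case Nil
    thus ?thesis using 1(2) by simp
  next
    case (Cons k us)
    then obtain l vs where ys: "ys = l # vs" using 1(2) by (cases ys) auto
    have eq: "add_mset k (mset us) = add_mset l (mset vs)" using 1(2) Cons ys by simp
    have len: "length us < length xs" "length vs < length xs"
      using Cons ys mset_eq_length[OF 1(2)] by auto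
    show ?thesis
    proof (cases "k = l")
      case True
      hence "mset us = mset vs" using eq by simp
      thus ?thesis unfolding Cons ys True by (rule **[OF _ len(1)])
    next
      case False
      obtain zs where zs: "mset zs = mset us - {#l#}" using ex_mset by blast
      have us: "mset us = mset (l # zs)" and vs: "mset (k # zs) = mset vs"
        using eq False zs by (auto simp: add_eq_conv_ex)
      have lz: "length (k # zs) < length xs" using mset_eq_length[OF vs] len by simp
      have "list_char xs = list_char (k # l # zs)" unfolding Cons by (rule **[OF us len(1)])
      also have "\<dots> = list_char (l # k # zs)" by (rule list_char_swap)
      also have "\<dots> = list_char ys" unfolding ys by (rule **[OF vs lz])
      finally show ?thesis .
    qed
  qed
qed

definition mset_char :: "nat multiset \<Rightarrow> q2 fps" where
  "mset_char I = list_char (sorted_list_of_multiset I)"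

lemma mset_char_add: "mset_char (add_mset k I) = (\<Sum>x\<in>#I. pairing k x * mset_char (I - {#x#}))"
proof -
  have "mset_char (add_mset k I) = list_char (k # sorted_list_of_multiset I)"
    unfolding mset_char_def by (rule list_char_mset) simp
  also have "\<dots> = (\<Sum>x\<in>#mset (sorted_list_of_multiset I). pairing k x * mset_char (mset (sorted_list_of_multiset I) - {#x#}))"
    unfolding list_char_Cons
    by (rule sum_picks_mset) (auto simp: mset_char_def intro!: list_char_mset)
  finally show ?thesis by simp
qed

lemma F_S_eq: "F_S v = (\<Sum>I\<in>Poly_Mapping.keys v. fps_const (Poly_Mapping.lookup v I) * (euler_prod * mset_char I))"
proof -
  have wt: "int (wt I) - 1 = 0 + int (\<Sum>k\<leftarrow>sorted_list_of_multiset I. Suc k) - 1" for I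
    unfolding wt_def by (subst (1) mset_sorted_list_of_multiset[symmetric], subst sum_mset_sum_list[symmetric]) simp
  have op: "vertex_op (monom_heis I) (int (wt I) - 1) u = vmode (sorted_list_of_multiset I) 0 u" for I u
    unfolding vmode_def wt[symmetric] by (simp add: vertex_op_def monom_heis_def scale_heis_eq)
  have "graded_trace n (zero_mode v) =
     (\<Sum>I\<in>Poly_Mapping.keys v. Poly_Mapping.lookup v I * graded_trace n (vmode (sorted_list_of_multiset I) 0))" for n
    unfolding zero_mode_def[abs_def] scale_heis_eq op graded_trace_sum graded_trace_const ..
  hence "Abs_fps (\<lambda>n. graded_trace n (zero_mode v)) = (\<Sum>I\<in>Poly_Mapping.keys v. fps_const (Poly_Mapping.lookup v I) * mset_char I)"
    by (intro fps_ext) (simp add: fps_sum_nth mset_char_def list_char_def)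
  thus ?thesis by (simp add: F_S_def sum_distrib_left mult_ac)
qed

lemma F_S_superset:
  assumes "finite A" "Poly_Mapping.keys v \<subseteq> A"
  shows "F_S v = (\<Sum>I\<in>A. fps_const (Poly_Mapping.lookup v I) * (euler_prod * mset_char I))"
  unfolding F_S_eq using assms by (intro sum.mono_neutral_left) (auto simp: in_keys_iff)

lemma F_S_add: "F_S (u + v) = F_S u + F_S v"
proof -
  let ?A = "Poly_Mapping.keys u \<union> Poly_Mapping.keys v"
  have "Poly_Mapping.keys (u + v) \<subseteq> ?A" by (rule keys_add)
  thus ?thesis
    by (simp add: F_S_superset[of ?A] lookup_add ring_distribs sum.distrib flip: fps_const_add)
qed

lemma F_S_const: "F_S (heis_const c * v) = fps_const c * F_S v"
proof -
  have "Poly_Mapping.keys (heis_const c * v) \<subseteq> Poly_Mapping.keys v"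
    by (auto simp: in_keys_iff lookup_heis_const)
  thus ?thesis
    by (simp add: F_S_superset[of "Poly_Mapping.keys v"] lookup_heis_const lookup_heis_const' sum_distrib_left mult_ac flip: fps_const_mult)
qed

lemma F_S_0 [simp]: "F_S 0 = 0"
  using F_S_const[of 0 0] by simp

lemma F_S_diff: "F_S (u - v) = F_S u - F_S v"
  using F_S_add[of "u - v" v] by simp

lemma F_S_sum: "F_S (sum f A) = (\<Sum>i\<in>A. F_S (f i))"
  by (induction A rule: infinite_finite_induct) (simp_all add: F_S_add)

lemma F_S_monom: "F_S (monom_heis I) = euler_prod * mset_char I"
  by (simp add: F_S_eq monom_heis_def)

lemma sum_mset_count:
  fixes f :: "'b \<Rightarrow> 'a::comm_ring_1"
  assumes "finite A" "set_mset I \<subseteq> A"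
  shows "(\<Sum>x\<in>#I. f x) = (\<Sum>x\<in>A. of_nat (count I x) * f x)"
  using assms(2)
proof (induction I)
  case (add a I)
  have "(\<Sum>x\<in>A. of_nat (count (add_mset a I) x) * f x) = (\<Sum>x\<in>A. (if x = a then f x else 0) + of_nat (count I x) * f x)"
    by (intro sum.cong refl) (simp add: ring_distribs)
  thus ?case using add assms(1) by (simp add: sum.distrib)
qed simp

lemma F_S_var_mult:
  assumes "finite A" "\<And>I. Poly_Mapping.lookup v I \<noteq> 0 \<Longrightarrow> set_mset I \<subseteq> A"
  shows "F_S (heis_var k * v) = (\<Sum>j\<in>A. pairing k j * F_S (deriv_heis j v))"
proof -
  have *: "F_S (heis_var k * monom_heis I) = (\<Sum>j\<in>A. pairing k j * F_S (deriv_heis j (monom_heis I)))"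
    if "set_mset I \<subseteq> A" for I
    unfolding var_mult_monom F_S_monom mset_char_add deriv_monom F_S_const sum_mset_count[OF assms(1) that]
    by (simp add: sum_distrib_left mult_ac fps_of_nat)
  have "F_S (heis_var k * v) = (\<Sum>I\<in>Poly_Mapping.keys v. fps_const (Poly_Mapping.lookup v I) * F_S (heis_var k * monom_heis I))"
    by (subst (1) heis_sum_monom[of v]) (simp add: sum_distrib_left mult.left_commute[of "heis_var k"] F_S_sum F_S_const)
  also have "\<dots> = (\<Sum>I\<in>Poly_Mapping.keys v. \<Sum>j\<in>A. fps_const (Poly_Mapping.lookup v I) * (pairing k j * F_S (deriv_heis j (monom_heis I))))"
    by (intro sum.cong refl, subst *) (use assms(2) in \<open>auto simp: in_keys_iff sum_distrib_left\<close>)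
  also have "\<dots> = (\<Sum>j\<in>A. \<Sum>I\<in>Poly_Mapping.keys v. fps_const (Poly_Mapping.lookup v I) * (pairing k j * F_S (deriv_heis j (monom_heis I))))"
    by (rule sum.swap)
  also have "\<dots> = (\<Sum>j\<in>A. pairing k j * F_S (deriv_heis j v))"
  proof (intro sum.cong refl)
    fix j
    have "F_S (deriv_heis j v) = (\<Sum>I\<in>Poly_Mapping.keys v. fps_const (Poly_Mapping.lookup v I) * F_S (deriv_heis j (monom_heis I)))"
      by (subst (1) heis_sum_monom[of v])
         (simp add: heis_linear_sum[OF heis_linear_deriv] heis_linear_const[OF heis_linear_deriv] F_S_sum F_S_const)
    thus "(\<Sum>I\<in>Poly_Mapping.keys v. fps_const (Poly_Mapping.lookup v I) * (pairing k j * F_S (deriv_heis j (monom_heis I)))) =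
       pairing k j * F_S (deriv_heis j v)" by (simp add: sum_distrib_left mult_ac)
  qed
  finally show ?thesis .
qed

definition bounded_part_gf :: "nat \<Rightarrow> q2 fps" where
  "bounded_part_gf M = Abs_fps (\<lambda>n. of_nat (card {I. wt I = n \<and> set_mset I \<subseteq> {..<M}}))"

lemma bounded_part_gf_0: "bounded_part_gf 0 = 1"
proof (rule fps_ext)
  fix n
  have "{I. wt I = n \<and> set_mset I \<subseteq> {..<0::nat}} = (if n = 0 then {{#}} else {})"
    by (auto simp: wt_def)
  thus "fps_nth (bounded_part_gf 0) n = fps_nth 1 n" by (simp add: bounded_part_gf_def)
qed

lemma bounded_part_gf_Suc: "(1 - fps_X ^ Suc M) * bounded_part_gf (Suc M) = bounded_part_gf M"
proof -
  have "card {I. wt I = n \<and> set_mset I \<subseteq> {..<Suc M}} = card {I. wt I = n \<and> set_mset I \<subseteq> {..<M}} +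
     (if n < Suc M then 0 else card {I. wt I = n - Suc M \<and> set_mset I \<subseteq> {..<Suc M}})" for n
  proof -
    have fin: "finite {I. wt I = n \<and> P I}" for n and P :: "nat multiset \<Rightarrow> bool"
      by (rule finite_subset[OF _ finite_wt[of n]]) auto
    have "{I. wt I = n \<and> set_mset I \<subseteq> {..<Suc M}} =
       {I. wt I = n \<and> set_mset I \<subseteq> {..<M}} \<union> {I. wt I = n \<and> set_mset I \<subseteq> {..<Suc M} \<and> M \<in># I}"
      by (auto simp: less_Suc_eq)
    also have "card \<dots> = card {I. wt I = n \<and> set_mset I \<subseteq> {..<M}} + card {I. wt I = n \<and> set_mset I \<subseteq> {..<Suc M} \<and> M \<in># I}"
      by (rule card_Un_disjoint) (use fin in auto)
    also have "card {I. wt I = n \<and> set_mset I \<subseteq> {..<Suc M} \<and> M \<in># I} =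
       card {I. Suc M + wt I = n \<and> set_mset I \<subseteq> {..<Suc M}}"
      by (rule bij_betw_same_card[of "\<lambda>I. I - {#M#}"], rule bij_betw_byWitness[where f' = "add_mset M"])
         (auto simp: wt_diff[simplified] dest: in_diffD)
    also have "{I. Suc M + wt I = n \<and> set_mset I \<subseteq> {..<Suc M}} =
       (if n < Suc M then {} else {I. wt I = n - Suc M \<and> set_mset I \<subseteq> {..<Suc M}})" by auto
    finally show ?thesis by simp
  qed
  hence "bounded_part_gf (Suc M) = bounded_part_gf M + fps_X ^ Suc M * bounded_part_gf (Suc M)"
    by (intro fps_ext) (simp add: bounded_part_gf_def fps_X_power_mult_nth del: power_Suc)
  thus ?thesis by (simp add: algebra_simps del: power_Suc)
qed

lemma prod_bounded_part_gf: "(\<Prod>m=1..M. 1 - fps_X ^ m) * bounded_part_gf M = 1"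
proof (induction M)
  case (Suc M)
  have "(\<Prod>m=1..Suc M. 1 - fps_X ^ m) * bounded_part_gf (Suc M) =
     (\<Prod>m=1..M. 1 - fps_X ^ m) * ((1 - fps_X ^ Suc M) * bounded_part_gf (Suc M))"
    by (simp add: mult.assoc del: power_Suc)
  also have "\<dots> = 1" unfolding bounded_part_gf_Suc by (rule Suc.IH)
  finally show ?case .
qed (simp add: bounded_part_gf_0)

lemma euler_prod_eq_upto: "fps_eq_upto N euler_prod (\<Prod>m=1..N. 1 - fps_X ^ m)"
proof -
  have "fps_nth (\<Prod>m=1..n. 1 - fps_X ^ m) n = fps_nth (\<Prod>m=1..n+k. 1 - fps_X ^ m :: q2 fps) n" for n k
  proof (induction k)
    case (Suc k)
    have "(\<Prod>m=1..n+Suc k. 1 - fps_X ^ m :: q2 fps) = (\<Prod>m=1..n+k. 1 - fps_X ^ m) - fps_X ^ Suc (n + k) * (\<Prod>m=1..n+k. 1 - fps_X ^ m)"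
      by (simp add: algebra_simps del: power_Suc)
    thus ?case using Suc by (simp add: fps_X_power_mult_nth del: power_Suc)
  qed simp
  thus ?thesis unfolding fps_eq_upto_def euler_prod_def by (auto simp: le_iff_add)
qed

lemma F_S_one: "F_S 1 = 1"
proof -
  have "fps_eq_upto N (euler_prod * mset_char {#}) 1" for N
  proof -
    have "fps_eq_upto N (mset_char {#}) (bounded_part_gf N)"
      unfolding fps_eq_upto_def
    proof safe
      fix n assume "n \<le> N"
      hence "{I. wt I = n} = {I. wt I = n \<and> set_mset I \<subseteq> {..<N}}" using mem_less_wt by fastforce
      thus "fps_nth (mset_char {#}) n = fps_nth (bounded_part_gf N) n"
        by (simp add: mset_char_def list_char_Nil_nth bounded_part_gf_def)
    qed
    from fps_eq_upto_mult[OF euler_prod_eq_upto this] show ?thesis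
      unfolding prod_bounded_part_gf .
  qed
  hence "F_S (monom_heis {#}) = 1" unfolding F_S_monom by (rule fps_eqI_upto)
  thus ?thesis by (simp only: monom_heis_def single_one)
qed

lemma norm2_of_int_le: "norm2 (of_int z) \<le> 1"
proof (cases "z = 0")
  case False
  have "norm2 (of_int z) = abs2 (of_int z)"
    using norm2_of_rat[of "of_int z"] by simp
  also have "\<dots> = 2 powi (int (multiplicity 2 (1::int)) - int (multiplicity 2 z))"
    using abs2_of_int_div[OF False one_neq_zero] by simp
  also have "\<dots> \<le> 2 powi 0" by (intro power_int_increasing) auto
  finally show ?thesis by simp
qed simp

lemma norm2_of_nat_le: "norm2 (of_nat n) \<le> 1"
  using norm2_of_int_le[of "int n"] by simp

lemma norm2_numeral_le: "norm2 (numeral w) \<le> 1"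
  using norm2_of_nat_le[of "numeral w"] by simp

lemma norm2_sum_le: "B \<ge> 0 \<Longrightarrow> (\<And>i. i \<in> A \<Longrightarrow> norm2 (f i) \<le> B) \<Longrightarrow> norm2 (sum f A) \<le> B"
proof (induction A rule: infinite_finite_induct)
  case (insert x A)
  thus ?case using norm2_ultra[of "f x" "sum f A"] by force
qed auto

definition heis_le :: "heis \<Rightarrow> real \<Rightarrow> bool" where
  "heis_le v B \<longleftrightarrow> (\<forall>I. norm2 (Poly_Mapping.lookup v I) \<le> B)"

definition fps_le :: "q2 fps \<Rightarrow> real \<Rightarrow> bool" where
  "fps_le f B \<longleftrightarrow> (\<forall>n. norm2 (fps_nth f n) \<le> B)"

lemma heis_le_add: "heis_le u B \<Longrightarrow> heis_le v B \<Longrightarrow> heis_le (u + v) B"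
  unfolding heis_le_def lookup_add using norm2_ultra by (metis max.bounded_iff order_trans)

lemma heis_le_0: "B \<ge> 0 \<Longrightarrow> heis_le 0 B"
  by (simp add: heis_le_def)

lemma heis_le_sum: "B \<ge> 0 \<Longrightarrow> (\<And>i. i \<in> A \<Longrightarrow> heis_le (f i) B) \<Longrightarrow> heis_le (sum f A) B"
  by (induction A rule: infinite_finite_induct) (simp_all add: heis_le_0 heis_le_add)

lemma heis_le_const: "norm2 c \<le> C \<Longrightarrow> heis_le v B \<Longrightarrow> heis_le (heis_const c * v) (C * B)"
  unfolding heis_le_def lookup_heis_const norm2_mult
  by (auto intro!: mult_mono order_trans[OF norm2_nonneg])

lemma heis_le_const1: "norm2 c \<le> 1 \<Longrightarrow> heis_le v B \<Longrightarrow> heis_le (heis_const c * v) B"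
  using heis_le_const[of c 1 v B] by simp

lemma heis_le_monom: "heis_le (monom_heis I) 1"
  by (simp add: heis_le_def monom_heis_def lookup_single when_def)

lemma monom_heis_empty: "monom_heis {#} = 1"
  unfolding monom_heis_def by (rule single_one)

lemma heis_le_var_mult: "heis_le v B \<Longrightarrow> B \<ge> 0 \<Longrightarrow> heis_le (heis_var k * v) B"
  by (auto simp: heis_le_def lookup_var_mult)

lemma heis_le_monom_mult:
  assumes "heis_le v B" "B \<ge> 0"
  shows "heis_le (monom_heis I * v) B"
proof (induction I)
  case empty
  show ?case unfolding monom_heis_empty mult_1 by (rule assms(1))
next
  case (add k I)
  have "monom_heis (add_mset k I) * v = heis_var k * (monom_heis I * v)"
    by (subst var_mult_monom[symmetric]) (rule mult.assoc)
  thus ?case using heis_le_var_mult[OF add assms(2)] by metis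
qed

lemma heis_le_mult:
  assumes "heis_le u 1" "heis_le v 1"
  shows "heis_le (u * v) 1"
proof -
  have "u * v = (\<Sum>I\<in>Poly_Mapping.keys u. heis_const (Poly_Mapping.lookup u I) * (monom_heis I * v))"
    by (subst (1) heis_sum_monom[of u]) (simp add: sum_distrib_right mult.assoc)
  also have "heis_le \<dots> 1"
    by (intro heis_le_sum heis_le_const1 heis_le_monom_mult) (use assms in \<open>auto simp: heis_le_def\<close>)
  finally show ?thesis .
qed

lemma heis_le_power: "heis_le v 1 \<Longrightarrow> heis_le (v ^ n) 1"
proof (induction n)
  case 0
  show ?case by (simp add: heis_le_def lookup_one when_def)
qed (simp add: heis_le_mult)

lemma heis_le_h_mode:
  assumes "heis_le v 1"
  shows "heis_le (h_mode i v) 1"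
proof -
  have "norm2 (a * b) \<le> 1" if "norm2 a \<le> 1" "norm2 b \<le> 1" for a b
    unfolding norm2_mult using that mult_mono[of "norm2 a" 1 "norm2 b" 1] by simp
  hence "heis_le (deriv_heis k v) 1" for k
    using assms norm2_of_nat_le[of "Suc _"] by (auto simp: heis_le_def lookup_deriv)
  thus ?thesis using assms norm2_of_int_le
    by (auto simp: h_mode_def scale_heis_eq intro!: heis_le_const1 heis_le_0 heis_le_monom_mult)
qed

lemma norm2_hcoef_le: "norm2 (hcoef k i) \<le> 1"
  unfolding hcoef_def of_int_gbinomial[symmetric] by (rule norm2_of_int_le)

lemma heis_le_vmode: "heis_le v 1 \<Longrightarrow> heis_le (vmode ks m v) 1"
proof (induction ks arbitrary: m v)
  case Nil
  thus ?case by (simp add: vmode_Nil heis_le_0)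
next
  case (Cons k ks)
  obtain L where "vmode (k # ks) m v = (\<Sum>i\<in>{-L..L}. heis_const (hcoef k i) * vterm ks m i v)"
    using vmode_Cons_ev by blast
  moreover have "heis_le (vterm ks m i v) 1" for i
    using Cons.IH Cons.prems heis_le_h_mode by (simp add: vterm_def)
  ultimately show ?case by (auto intro!: heis_le_sum heis_le_const1 norm2_hcoef_le)
qed

lemma fps_le_sum: "B \<ge> 0 \<Longrightarrow> (\<And>i. i \<in> A \<Longrightarrow> fps_le (f i) B) \<Longrightarrow> fps_le (sum f A) B"
  by (auto simp: fps_le_def fps_sum_nth intro!: norm2_sum_le)

lemma fps_le_add: "fps_le f B \<Longrightarrow> fps_le g B \<Longrightarrow> fps_le (f + g) B"
  unfolding fps_le_def fps_add_nth using norm2_ultra by (metis max.bounded_iff order_trans)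

lemma fps_le_uminus: "fps_le f B \<Longrightarrow> fps_le (- f) B"
  by (simp add: fps_le_def)

lemma fps_le_diff: "fps_le f B \<Longrightarrow> fps_le g B \<Longrightarrow> fps_le (f - g) B"
  using fps_le_add[OF _ fps_le_uminus, of f B g] by simp

lemma fps_le_mult:
  assumes "fps_le f B" "fps_le g C" "B \<ge> 0" "C \<ge> 0"
  shows "fps_le (f * g) (B * C)"
  unfolding fps_le_def fps_mult_nth
  using assms by (auto simp: fps_le_def norm2_mult intro!: norm2_sum_le mult_mono)

lemma fps_le_const: "norm2 c \<le> B \<Longrightarrow> B \<ge> 0 \<Longrightarrow> fps_le (fps_const c) B"
  by (simp add: fps_le_def)

lemma fps_le_one: "fps_le 1 1"
  by (simp add: fps_le_def)

lemma fps_le_X_power: "fps_le (fps_X ^ n) 1"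
  by (simp add: fps_le_def fps_X_power_nth)

lemma fps_le_euler_prod: "fps_le euler_prod 1"
proof -
  have "fps_le (\<Prod>m\<in>A. 1 - fps_X ^ m) 1" for A
  proof (induction A rule: infinite_finite_induct)
    case (insert x A)
    thus ?case using fps_le_mult[OF fps_le_diff[OF fps_le_one fps_le_X_power] insert.IH] by simp
  qed (simp_all add: fps_le_one)
  thus ?thesis by (simp add: fps_le_def euler_prod_def)
qed

lemma fps_le_F_S:
  assumes "heis_le v B" "B \<ge> 0"
  shows "fps_le (F_S v) B"
proof -
  have "norm2 (fps_nth (mset_char I) n) \<le> 1" for I n
    using heis_le_vmode[OF heis_le_monom]
    by (auto simp: mset_char_def list_char_def graded_trace_def heis_le_def intro!: norm2_sum_le)
  hence "fps_le (mset_char I) 1" for I by (simp add: fps_le_def)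
  from fps_le_mult[OF fps_le_euler_prod this] have 1: "fps_le (euler_prod * mset_char I) 1" for I by simp
  have "fps_le (fps_const (Poly_Mapping.lookup v I) * (euler_prod * mset_char I)) (B * 1)" for I
    using assms by (intro fps_le_mult fps_le_const 1) (auto simp: heis_le_def)
  thus ?thesis unfolding F_S_eq using assms(2) by (intro fps_le_sum) simp_all
qed

definition linear_form :: "nat \<Rightarrow> (nat \<Rightarrow> q2) \<Rightarrow> heis" where
  "linear_form K \<alpha> = (\<Sum>k<K. heis_const (\<alpha> k) * heis_var k)"

definition form_coef :: "nat \<Rightarrow> (nat \<Rightarrow> q2) \<Rightarrow> int \<Rightarrow> q2" where
  "form_coef K \<alpha> i = (\<Sum>k<K. \<alpha> k * hcoef k i)"

definition form_pairing :: "nat \<Rightarrow> (nat \<Rightarrow> q2) \<Rightarrow> (nat \<Rightarrow> q2) \<Rightarrow> q2 fps" where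
  "form_pairing K \<alpha> \<beta> = lambert (\<lambda>d. of_nat d *
     (form_coef K \<alpha> (- int d) * form_coef K \<beta> (int d) + form_coef K \<alpha> (int d) * form_coef K \<beta> (- int d)))"

definition vars_below :: "nat \<Rightarrow> heis \<Rightarrow> bool" where
  "vars_below K v \<longleftrightarrow> (\<forall>I. Poly_Mapping.lookup v I \<noteq> 0 \<longrightarrow> set_mset I \<subseteq> {..<K})"

lemma lambert_sum: "lambert (\<lambda>d. \<Sum>i\<in>A. g i d) = (\<Sum>i\<in>A. lambert (g i))"
  by (rule fps_ext) (simp add: lambert_nth fps_sum_nth sum.swap[of _ A])

lemma form_pairing_eq:
  "form_pairing K \<alpha> \<beta> = (\<Sum>j<K. fps_const (\<beta> j) * (\<Sum>k<K. fps_const (\<alpha> k) * pairing k j))"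
proof -
  have "form_pairing K \<alpha> \<beta> = lambert (\<lambda>d. \<Sum>j<K. \<beta> j * (\<Sum>k<K. \<alpha> k *
     (of_nat d * (hcoef k (- int d) * hcoef j (int d) + hcoef k (int d) * hcoef j (- int d)))))"
    unfolding form_pairing_def
  proof (rule lambert_cong)
    fix d :: nat
    have *: "(\<Sum>k<K. \<alpha> k * hcoef k x) * (\<Sum>j<K. \<beta> j * hcoef j y) = (\<Sum>j<K. \<Sum>k<K. \<beta> j * (\<alpha> k * (hcoef k x * hcoef j y)))" for x y
      unfolding sum_product by (subst sum.swap) (simp add: mult_ac)
    show "of_nat d * (form_coef K \<alpha> (- int d) * form_coef K \<beta> (int d) + form_coef K \<alpha> (int d) * form_coef K \<beta> (- int d)) =
      (\<Sum>j<K. \<beta> j * (\<Sum>k<K. \<alpha> k * (of_nat d * (hcoef k (- int d) * hcoef j (int d) + hcoef k (int d) * hcoef j (- int d)))))"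
      unfolding form_coef_def * unfolding sum.distrib[symmetric] sum_distrib_left
      by (intro sum.cong refl) (simp add: algebra_simps)
  qed
  thus ?thesis by (simp add: lambert_sum lambert_cmult pairing_def)
qed

lemma vars_below_add: "vars_below K u \<Longrightarrow> vars_below K v \<Longrightarrow> vars_below K (u + v)"
  unfolding vars_below_def lookup_add by (metis add.left_neutral)

lemma vars_below_mult:
  assumes "vars_below K u" "vars_below K v"
  shows "vars_below K (u * v)"
  unfolding vars_below_def
proof safe
  fix I x assume "Poly_Mapping.lookup (u * v) I \<noteq> 0" and x: "x \<in># I"
  hence "I \<in> Poly_Mapping.keys (u * v)" by (simp add: in_keys_iff)
  then obtain A B where AB: "I = A + B" "A \<in> Poly_Mapping.keys u" "B \<in> Poly_Mapping.keys v"
    using keys_mult[of u v] by blast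
  thus "x < K" using assms x unfolding vars_below_def by (auto simp: in_keys_iff)
qed

lemma vars_below_power: "vars_below K u \<Longrightarrow> vars_below K (u ^ n)"
  by (induction n) (auto intro: vars_below_mult simp: vars_below_def[of K 1] lookup_one when_def)

lemma vars_below_sum: "(\<And>i. i \<in> A \<Longrightarrow> vars_below K (f i)) \<Longrightarrow> vars_below K (sum f A)"
  by (induction A rule: infinite_finite_induct) (simp_all add: vars_below_add, simp_all add: vars_below_def)

lemma vars_below_linear_form: "vars_below K (linear_form K \<alpha>)"
  unfolding linear_form_def
  by (intro vars_below_sum) (auto simp: vars_below_def lookup_heis_const monom_heis_def lookup_single when_def)

lemma deriv_linear_form: "j < K \<Longrightarrow> deriv_heis j (linear_form K \<alpha>) = heis_const (\<alpha> j)"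
proof -
  assume j: "j < K"
  have "deriv_heis j (heis_var k) = (if k = j then 1 else 0)" for k
    by (simp add: deriv_monom monom_heis_empty)
  thus ?thesis using j
    by (simp add: linear_form_def heis_linear_sum[OF heis_linear_deriv] heis_linear_const[OF heis_linear_deriv]
        if_distrib[of "(*) _"] cong: if_cong)
qed

lemma deriv_power: "deriv_heis j (u ^ n) = heis_const (of_nat n) * u ^ (n - 1) * deriv_heis j u"
proof (induction n)
  case 0
  have "deriv_heis j 1 = 0" using deriv_monom[of j "{#}"] by (simp add: monom_heis_empty)
  thus ?case by simp
next
  case (Suc n)
  have "u * (heis_const (of_nat n) * u ^ (n - 1) * deriv_heis j u) = heis_const (of_nat n) * u ^ n * deriv_heis j u"
    by (cases n) (simp_all add: mult_ac)
  thus ?case by (simp add: deriv_mult Suc heis_const_hom ring_distribs mult_ac)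
qed

lemma F_S_linear_form_mult:
  assumes "vars_below K v"
  shows "F_S (linear_form K \<alpha> * v) = (\<Sum>j<K. (\<Sum>k<K. fps_const (\<alpha> k) * pairing k j) * F_S (deriv_heis j v))"
proof -
  have *: "F_S (heis_var k * v) = (\<Sum>j<K. pairing k j * F_S (deriv_heis j v))" for k
    by (rule F_S_var_mult) (use assms in \<open>auto simp: vars_below_def\<close>)
  have "F_S (linear_form K \<alpha> * v) = (\<Sum>k<K. fps_const (\<alpha> k) * F_S (heis_var k * v))"
    by (simp add: linear_form_def sum_distrib_right F_S_sum mult.assoc F_S_const)
  also have "\<dots> = (\<Sum>k<K. \<Sum>j<K. fps_const (\<alpha> k) * pairing k j * F_S (deriv_heis j v))"
    by (simp add: * sum_distrib_left mult.assoc)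
  also have "\<dots> = (\<Sum>j<K. \<Sum>k<K. fps_const (\<alpha> k) * pairing k j * F_S (deriv_heis j v))"
    by (rule sum.swap)
  finally show ?thesis by (simp add: sum_distrib_right)
qed

lemma F_S_wick:
  "F_S (linear_form K \<alpha> * (linear_form K \<alpha> ^ m * linear_form K \<beta> ^ n)) =
     of_nat m * form_pairing K \<alpha> \<alpha> * F_S (linear_form K \<alpha> ^ (m - 1) * linear_form K \<beta> ^ n) +
     of_nat n * form_pairing K \<alpha> \<beta> * F_S (linear_form K \<alpha> ^ m * linear_form K \<beta> ^ (n - 1))"
proof -
  let ?a = "linear_form K \<alpha>" and ?b = "linear_form K \<beta>"
  define P where "P j = (\<Sum>k<K. fps_const (\<alpha> k) * pairing k j)" for j
  have "deriv_heis j (?a ^ m * ?b ^ n) = heis_const (of_nat m * \<alpha> j) * (?a ^ (m - 1) * ?b ^ n) +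
      heis_const (of_nat n * \<beta> j) * (?a ^ m * ?b ^ (n - 1))" if "j < K" for j
    by (simp add: deriv_mult deriv_power deriv_linear_form[OF that] heis_const_hom mult_ac)
  hence D: "F_S (deriv_heis j (?a ^ m * ?b ^ n)) =
      of_nat m * fps_const (\<alpha> j) * F_S (?a ^ (m - 1) * ?b ^ n) +
      of_nat n * fps_const (\<beta> j) * F_S (?a ^ m * ?b ^ (n - 1))" if "j < K" for j
    using that by (simp add: F_S_add F_S_const fps_of_nat flip: fps_const_mult)
  have "F_S (?a * (?a ^ m * ?b ^ n)) = (\<Sum>j<K. P j * F_S (deriv_heis j (?a ^ m * ?b ^ n)))"
    unfolding P_def by (intro F_S_linear_form_mult vars_below_mult vars_below_power vars_below_linear_form)
  also have "\<dots> = (\<Sum>j<K. of_nat m * F_S (?a ^ (m - 1) * ?b ^ n) * (fps_const (\<alpha> j) * P j) +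
      of_nat n * F_S (?a ^ m * ?b ^ (n - 1)) * (fps_const (\<beta> j) * P j))"
    by (intro sum.cong refl) (simp add: D ring_distribs mult_ac)
  also have "\<dots> = of_nat m * F_S (?a ^ (m - 1) * ?b ^ n) * form_pairing K \<alpha> \<alpha> +
      of_nat n * F_S (?a ^ m * ?b ^ (n - 1)) * form_pairing K \<alpha> \<beta>"
    by (simp add: form_pairing_eq P_def[symmetric] sum.distrib sum_distrib_left)
  finally show ?thesis by (simp add: mult_ac)
qed

definition odd_factorial :: "nat \<Rightarrow> nat" where
  "odd_factorial r = (\<Prod>i<r. 2 * i + 1)"

lemma F_S_even_powers:
  assumes "form_pairing K \<alpha> \<beta> = 0"
  shows "F_S (linear_form K \<alpha> ^ (2 * r) * linear_form K \<beta> ^ (2 * s)) =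
    of_nat (odd_factorial r) * of_nat (odd_factorial s) * form_pairing K \<alpha> \<alpha> ^ r * form_pairing K \<beta> \<beta> ^ s"
proof (induction r)
  case 0
  show ?case
  proof (induction s)
    case (Suc s)
    show ?case using F_S_wick[of K \<beta> "2 * s + 1" \<beta> 0] Suc
      by (simp add: odd_factorial_def algebra_simps)
  qed (simp add: odd_factorial_def F_S_one)
next
  case (Suc r)
  show ?case using F_S_wick[of K \<alpha> "2 * r + 1" \<beta> "2 * s"] Suc assms
    by (simp add: odd_factorial_def algebra_simps)
qed

lemma norm2_odd: "odd z \<Longrightarrow> norm2 (of_int z) = 1"
proof -
  assume z: "odd z"
  have "norm2 (of_int z) = abs2 (of_int z)"
    using norm2_of_rat[of "of_int z"] by simp
  also have "\<dots> = 2 powi (int (multiplicity 2 (1::int)) - int (multiplicity 2 z))"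
    using abs2_of_int_div[of z 1] z by auto
  also have "multiplicity 2 z = 0" using z by (simp add: not_dvd_imp_multiplicity_0)
  finally show ?thesis by simp
qed

lemma norm2_inverse: "norm2 (inverse x) = inverse (norm2 x)"
  by (cases "x = 0") (metis norm2_0 inverse_zero, metis norm2_1 norm2_mult inverse_unique right_inverse)

lemma norm2_power: "norm2 (x ^ n) = norm2 x ^ n"
  by (induction n) (simp_all add: norm2_mult)

lemma hcoef_small: "hcoef 0 i = 1" "hcoef (Suc 0) i = - of_int i - 1" "hcoef 2 i = (of_int i + 1) * (of_int i + 2) / 2"
proof -
  have gb: "(x gchoose 2) = x * (x - 1) / 2" for x :: q2
    by (simp add: gbinomial_prod_rev numeral_2_eq_2)
  show "hcoef 2 i = (of_int i + 1) * (of_int i + 2) / 2" unfolding hcoef_def gb by (simp add: algebra_simps)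
qed (simp_all add: hcoef_def)

lemma monomial_in_image:
  "\<exists>v. heis_le v 1 \<and> F_S v = (2 * Sig 3) ^ i * (2 * Sig 5) ^ j"
proof -
  define \<alpha> :: "nat \<Rightarrow> q2" where "\<alpha> = (\<lambda>k. if k = 2 then 0 else 1)"
  define \<beta> :: "nat \<Rightarrow> q2" where "\<beta> = (\<lambda>k. if k = 0 then 1 else if k = 1 then 3 else 2)"
  have f: "form_coef 3 \<alpha> i = - of_int i" "form_coef 3 \<beta> i = of_int i ^ 2" for i
    by (simp_all add: form_coef_def \<alpha>_def \<beta>_def hcoef_small lessThan_nat_numeral lessThan_Suc algebra_simps
        power2_eq_square)
  have p: "form_pairing 3 \<alpha> \<beta> = 0" "form_pairing 3 \<alpha> \<alpha> = - (2 * Sig 3)" "form_pairing 3 \<beta> \<beta> = 2 * Sig 5"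
    unfolding form_pairing_def f Sig_def lambert_numeral[symmetric] lambert_uminus[symmetric]
    by (auto simp: fps_eq_iff lambert_nth power_numeral_reduce intro!: sum.cong)
  define c where "c = of_nat (odd_factorial i) * (of_nat (odd_factorial j) :: q2)"
  have "odd (odd_factorial r)" for r by (induction r) (simp_all add: odd_factorial_def)
  hence n: "norm2 (of_nat (odd_factorial r)) = 1" for r
    using norm2_odd[of "int (odd_factorial r)"] by simp
  hence c: "norm2 c = 1" by (simp add: c_def norm2_mult)
  hence c0: "c \<noteq> 0" by auto
  define u where "u = linear_form 3 \<alpha> ^ (2 * i) * linear_form 3 \<beta> ^ (2 * j)"
  define v where "v = heis_const ((-1) ^ i * inverse c) * u"
  have "heis_le (linear_form 3 \<gamma>) 1" if "\<And>k. norm2 (\<gamma> k) \<le> 1" for \<gamma>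
    unfolding linear_form_def by (intro heis_le_sum heis_le_const1 that heis_le_monom) auto
  hence "heis_le (linear_form 3 \<alpha>) 1" "heis_le (linear_form 3 \<beta>) 1"
    by (simp_all add: \<alpha>_def \<beta>_def norm2_numeral_le)
  hence "heis_le u 1" unfolding u_def by (intro heis_le_mult heis_le_power)
  hence "heis_le v 1" unfolding v_def
    by (intro heis_le_const1) (simp_all add: norm2_mult norm2_power norm2_inverse c)
  moreover have "F_S v = fps_const ((-1) ^ i * inverse c) * (fps_const c * ((- (2 * Sig 3)) ^ i * (2 * Sig 5) ^ j))"
    unfolding v_def u_def F_S_const F_S_even_powers[OF p(1)] p c_def
    by (simp add: fps_of_nat mult_ac flip: fps_const_mult)
  moreover have "\<dots> = fps_const ((-1) ^ i * inverse c * c) * ((- (2 * Sig 3)) ^ i * (2 * Sig 5) ^ j)"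
    by (simp flip: fps_const_mult mult.assoc)
  moreover have "\<dots> = fps_const ((-1) ^ i) * ((- (2 * Sig 3)) ^ i * (2 * Sig 5) ^ j)"
    using c0 by (simp add: mult.assoc)
  moreover have "\<dots> = (2 * Sig 3) ^ i * (2 * Sig 5) ^ j"
    by (cases "even i") (simp_all flip: fps_const_neg)
  ultimately show ?thesis by metis
qed

section \<open>Approximation of polynomials in \<open>\<lambda>\<close>\<close>

inductive_set int_span :: "q2 fps set" where
  zero: "0 \<in> int_span"
| monom: "norm2 c \<le> 1 \<Longrightarrow> t \<in> int_span \<Longrightarrow> fps_const c * ((2 * Sig 3) ^ i * (2 * Sig 5) ^ j) + t \<in> int_span"

lemma int_span_add: "s \<in> int_span \<Longrightarrow> t \<in> int_span \<Longrightarrow> s + t \<in> int_span"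
proof (induction s rule: int_span.induct)
  case (monom c u i j)
  thus ?case using int_span.monom[of c "u + t" i j] by (simp add: add.assoc)
qed simp

lemma norm2_mult_le1: "norm2 a \<le> 1 \<Longrightarrow> norm2 b \<le> 1 \<Longrightarrow> norm2 (a * b) \<le> 1"
  unfolding norm2_mult using mult_mono[of "norm2 a" 1 "norm2 b" 1] by simp

lemma int_span_mult: "s \<in> int_span \<Longrightarrow> t \<in> int_span \<Longrightarrow> s * t \<in> int_span"
proof (induction s rule: int_span.induct)
  case zero
  show ?case by (simp add: int_span.zero)
next
  case (monom c u i j)
  have "fps_const c * ((2 * Sig 3) ^ i * (2 * Sig 5) ^ j) * t \<in> int_span"
    using monom.prems
  proof (induction t rule: int_span.induct)
    case zero
    show ?case by (simp add: int_span.zero)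
  next
    case (monom d u' k l)
    have "fps_const c * ((2 * Sig 3) ^ i * (2 * Sig 5) ^ j) * (fps_const d * ((2 * Sig 3) ^ k * (2 * Sig 5) ^ l) + u') =
       fps_const (c * d) * ((2 * Sig 3) ^ (i + k) * (2 * Sig 5) ^ (j + l)) +
       fps_const c * ((2 * Sig 3) ^ i * (2 * Sig 5) ^ j) * u'"
      unfolding fps_const_mult[symmetric] power_add by algebra
    thus ?case using monom.IH monom.hyps(1) \<open>norm2 c \<le> 1\<close> by (simp only: int_span.monom norm2_mult_le1)
  qed
  moreover have "u * t \<in> int_span" using monom by blast
  ultimately show ?case unfolding distrib_right by (rule int_span_add)
qed

lemma int_span_const: "norm2 c \<le> 1 \<Longrightarrow> fps_const c \<in> int_span"
  using int_span.monom[OF _ int_span.zero, of c 0 0] by simp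

lemma int_span_one: "1 \<in> int_span"
  using int_span_const[of 1] by simp

lemma int_span_numeral: "numeral w \<in> int_span"
  using int_span_const[OF norm2_numeral_le] by (simp add: fps_numeral_fps_const)

lemma int_span_gens: "2 * Sig 3 \<in> int_span" "2 * Sig 5 \<in> int_span"
  using int_span.monom[OF _ int_span.zero, of 1 1 0] int_span.monom[OF _ int_span.zero, of 1 0 1] by simp_all

lemma int_span_diff: "s \<in> int_span \<Longrightarrow> t \<in> int_span \<Longrightarrow> s - t \<in> int_span"
  using int_span_add[OF _ int_span_mult[OF int_span_const[of "-1"]], of s t]
  by (simp flip: fps_const_neg)

lemma int_span_power: "s \<in> int_span \<Longrightarrow> s ^ n \<in> int_span"
  by (induction n) (simp_all add: int_span_one int_span_mult)

lemma int_span_sum: "(\<And>i. i \<in> A \<Longrightarrow> f i \<in> int_span) \<Longrightarrow> sum f A \<in> int_span"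
  by (induction A rule: infinite_finite_induct) (simp_all add: int_span.zero int_span_add)

lemmas int_span_intros = int_span_add int_span_diff int_span_mult int_span_power int_span_one int_span_numeral
  int_span_gens

lemma int_span_image: "t \<in> int_span \<Longrightarrow> \<exists>v. heis_le v 1 \<and> F_S v = t"
proof (induction t rule: int_span.induct)
  case zero
  show ?case by (rule exI[of _ 0]) (simp add: heis_le_0)
next
  case (monom c t i j)
  then obtain v where v: "heis_le v 1" "F_S v = t" by blast
  obtain u where u: "heis_le u 1" "F_S u = (2 * Sig 3) ^ i * (2 * Sig 5) ^ j"
    using monomial_in_image by blast
  show ?case by (rule exI[of _ "heis_const c * u + v"])
    (use u v monom.hyps in \<open>simp add: F_S_add F_S_const heis_le_add heis_le_const1\<close>)
qed

lemma int_span_fps_le: "t \<in> int_span \<Longrightarrow> fps_le t 1"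
  using int_span_image fps_le_F_S zero_le_one by metis

lemma modular_forms_monom: "fps_const c * Eis 4 ^ i * Eis 6 ^ j \<in> modular_forms"
proof -
  define N where "N = max i j"
  define d where "d k l = (if k = i then if l = j then c else 0 else 0)" for k l
  have "(\<Sum>k\<le>N. \<Sum>l\<le>N. fps_const (d k l) * Eis 4 ^ k * Eis 6 ^ l) =
    (\<Sum>k\<le>N. if k = i then \<Sum>l\<le>N. if l = j then fps_const c * Eis 4 ^ k * Eis 6 ^ l else 0 else 0)"
  proof (intro sum.cong refl)
    fix k
    show "(\<Sum>l\<le>N. fps_const (d k l) * Eis 4 ^ k * Eis 6 ^ l) =
       (if k = i then \<Sum>l\<le>N. if l = j then fps_const c * Eis 4 ^ k * Eis 6 ^ l else 0 else 0)"
    proof (cases "k = i")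
      case True
      show ?thesis unfolding d_def if_P[OF True] by (intro sum.cong refl) simp
    qed (simp add: d_def)
  qed
  also have "\<dots> = fps_const c * Eis 4 ^ i * Eis 6 ^ j" by (simp add: N_def)
  finally have "fps_const c * Eis 4 ^ i * Eis 6 ^ j = (\<Sum>k\<le>N. \<Sum>l\<le>N. fps_const (d k l) * Eis 4 ^ k * Eis 6 ^ l)" ..
  thus ?thesis unfolding modular_forms_def by blast
qed

lemma modular_forms_pad:
  assumes "f = (\<Sum>i\<le>N. \<Sum>j\<le>N. fps_const (c i j) * Eis 4 ^ i * Eis 6 ^ j)" "N \<le> M"
  shows "f = (\<Sum>i\<le>M. \<Sum>j\<le>M. fps_const (if i \<le> N \<and> j \<le> N then c i j else 0) * Eis 4 ^ i * Eis 6 ^ j)"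
proof -
  have "f = (\<Sum>i\<le>N. \<Sum>j\<le>M. fps_const (if i \<le> N \<and> j \<le> N then c i j else 0) * Eis 4 ^ i * Eis 6 ^ j)"
    unfolding assms(1) by (intro sum.cong refl sum.mono_neutral_cong_left) (use assms(2) in auto)
  also have "\<dots> = (\<Sum>i\<le>M. \<Sum>j\<le>M. fps_const (if i \<le> N \<and> j \<le> N then c i j else 0) * Eis 4 ^ i * Eis 6 ^ j)"
    by (intro sum.mono_neutral_left) (use assms(2) in auto)
  finally show ?thesis .
qed

lemma modular_forms_add:
  assumes "f \<in> modular_forms" "g \<in> modular_forms"
  shows "f + g \<in> modular_forms"
proof -
  obtain N c where f: "f = (\<Sum>i\<le>N. \<Sum>j\<le>N. fps_const (c i j) * Eis 4 ^ i * Eis 6 ^ j)"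
    using assms(1) unfolding modular_forms_def by blast
  obtain M d where g: "g = (\<Sum>i\<le>M. \<Sum>j\<le>M. fps_const (d i j) * Eis 4 ^ i * Eis 6 ^ j)"
    using assms(2) unfolding modular_forms_def by blast
  define K where "K = max N M"
  define e where "e i j = (if i \<le> N \<and> j \<le> N then c i j else 0) + (if i \<le> M \<and> j \<le> M then d i j else 0)" for i j
  have NM: "N \<le> K" "M \<le> K" by (simp_all add: K_def)
  have "f + g = (\<Sum>i\<le>K. \<Sum>j\<le>K. fps_const (e i j) * Eis 4 ^ i * Eis 6 ^ j)"
    unfolding modular_forms_pad[OF f NM(1)] modular_forms_pad[OF g NM(2)] sum.distrib[symmetric] e_def
    by (intro sum.cong refl) (simp only: fps_const_add[symmetric] ring_distribs)
  thus ?thesis unfolding modular_forms_def by blast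
qed

lemma modular_forms_0: "0 \<in> modular_forms"
  using modular_forms_monom[of 0 0 0] by simp

lemma modular_forms_sum: "(\<And>i. i \<in> A \<Longrightarrow> f i \<in> modular_forms) \<Longrightarrow> sum f A \<in> modular_forms"
  by (induction A rule: infinite_finite_induct) (simp_all add: modular_forms_0 modular_forms_add)

lemma modular_forms_monom_mult:
  assumes "f \<in> modular_forms"
  shows "fps_const d * Eis 4 ^ k * Eis 6 ^ l * f \<in> modular_forms"
proof -
  obtain N c where f: "f = (\<Sum>i\<le>N. \<Sum>j\<le>N. fps_const (c i j) * Eis 4 ^ i * Eis 6 ^ j)"
    using assms(1) unfolding modular_forms_def by blast
  have "fps_const d * Eis 4 ^ k * Eis 6 ^ l * f =
     (\<Sum>i\<le>N. \<Sum>j\<le>N. fps_const (d * c i j) * Eis 4 ^ (k + i) * Eis 6 ^ (l + j))"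
    unfolding f sum_distrib_left
    by (intro sum.cong refl) (simp only: fps_const_mult[symmetric] power_add mult_ac)
  thus ?thesis by (simp only: modular_forms_sum modular_forms_monom)
qed

lemma modular_forms_const_mult: "f \<in> modular_forms \<Longrightarrow> fps_const c * f \<in> modular_forms"
  using modular_forms_monom_mult[of f c 0 0] by simp

lemma Sig_3_5_Eis:
  "2 * Sig 3 = fps_const (1 / 120) * Eis 4 + fps_const (- 1 / 120)"
  "2 * Sig 5 = fps_const (- 1 / 252) * Eis 6 + fps_const (1 / 252)"
proof -
  have *: "fps_const (1 / numeral w) * numeral w = (1 :: q2 fps)" for w
    by (simp add: fps_numeral_fps_const)
  have "fps_const (- 1 / 120) = - (fps_const (1 / 120) :: q2 fps)" "fps_const (- 1 / 252) = - (fps_const (1 / 252) :: q2 fps)"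
    by simp_all
  thus "2 * Sig 3 = fps_const (1 / 120) * Eis 4 + fps_const (- 1 / 120)"
   "2 * Sig 5 = fps_const (- 1 / 252) * Eis 6 + fps_const (1 / 252)"
    unfolding Eis_4 Eis_6 using *[of "num.Bit0 (num.Bit0 (num.Bit0 (num.Bit1 (num.Bit1 (num.Bit1 num.One)))))"]
      *[of "num.Bit0 (num.Bit0 (num.Bit1 (num.Bit1 (num.Bit1 (num.Bit1 (num.Bit1 num.One))))))"]
    by algebra+
qed

lemma int_span_modular: "t \<in> int_span \<Longrightarrow> t \<in> modular_forms"
proof (induction t rule: int_span.induct)
  case (monom c t i j)
  have gen3: "2 * Sig 3 * f \<in> modular_forms" if "f \<in> modular_forms" for f
    unfolding Sig_3_5_Eis distrib_right
    using modular_forms_monom_mult[OF that, of "1/120" 1 0] modular_forms_const_mult[OF that]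
    by (intro modular_forms_add) simp_all
  have gen5: "2 * Sig 5 * f \<in> modular_forms" if "f \<in> modular_forms" for f
    unfolding Sig_3_5_Eis distrib_right
    using modular_forms_monom_mult[OF that, of "-1/252" 0 1] modular_forms_const_mult[OF that]
    by (intro modular_forms_add) simp_all
  have "(2 * Sig 5) ^ j \<in> modular_forms"
    by (induction j) (use modular_forms_monom[of 1 0 0] in \<open>simp_all only: power_0 power_Suc gen5 fps_const_1_eq_1 mult_1\<close>)
  hence "(2 * Sig 3) ^ i * (2 * Sig 5) ^ j \<in> modular_forms"
    by (induction i) (simp_all only: power_0 power_Suc mult_1 mult.assoc[of "2 * Sig 3"] gen3)
  thus ?case using monom by (intro modular_forms_add modular_forms_const_mult)
qed (rule modular_forms_0)

lemma dist_q2: "dist x y = norm2 (x - y)"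
  by (simp add: dist_q2_def)

lemma uniform_limit_geometric:
  assumes "\<And>n x. dist (f n x) (l x :: q2) \<le> C * (1 / 8) ^ n"
  shows "uniform_limit UNIV f l sequentially"
proof (rule uniform_limitI)
  fix e :: real assume "e > 0"
  have "(\<lambda>n. C * (1 / 8) ^ n) \<longlonglongrightarrow> 0" by (intro tendsto_mult_right_zero LIMSEQ_power_zero) simp
  from order_tendstoD(2)[OF this \<open>e > 0\<close>]
  show "\<forall>\<^sub>F n in sequentially. \<forall>x\<in>UNIV. dist (f n x) (l x) < e"
    by eventually_elim (use assms order_le_less_trans in blast)
qed

lemma F_S_hat_criterion:
  assumes mf: "\<And>n. F_S (V n) \<in> modular_forms"
    and step: "\<And>n. heis_le (V (Suc n) - V n) (C * (1 / 8) ^ n)"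
    and lim: "\<And>n. fps_le (f - F_S (V n)) (C * (1 / 8) ^ n)" and C: "C \<ge> 0"
  shows "f \<in> F_S_hat ` S1"
proof -
  have tail: "heis_le (V m - V n) (C * (1 / 8) ^ n)" if "n \<le> m" for m n
    using that
  proof (induction m rule: dec_induct)
    case base
    show ?case using C by (simp add: heis_le_0)
  next
    case (step m)
    have "C * (1 / 8) ^ m \<le> C * (1 / 8) ^ n"
      using step C by (intro mult_left_mono power_decreasing) auto
    hence "heis_le (V (Suc m) - V m) (C * (1 / 8) ^ n)"
      using assms(2)[of m] unfolding heis_le_def by (blast intro: order_trans)
    from heis_le_add[OF this step.IH] show ?case by simp
  qed
  have zero: "(\<lambda>n. C * (1 / 8) ^ n) \<longlonglongrightarrow> 0" by (intro tendsto_mult_right_zero LIMSEQ_power_zero) simp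
  have "uniformly_Cauchy_on UNIV (\<lambda>n. Poly_Mapping.lookup (V n))"
    unfolding uniformly_Cauchy_on_def
  proof safe
    fix e :: real assume "e > 0"
    from order_tendstoD(2)[OF zero this] obtain M where M: "\<forall>n\<ge>M. C * (1 / 8) ^ n < e"
      by (auto simp: eventually_sequentially)
    have "dist (Poly_Mapping.lookup (V m) I) (Poly_Mapping.lookup (V n) I) < e" if "n \<ge> M" "n \<le> m" for m n I
      using tail[OF that(2)] M that(1) unfolding heis_le_def lookup_minus dist_q2
      by (meson order_le_less_trans)
    hence "dist (Poly_Mapping.lookup (V m) I) (Poly_Mapping.lookup (V n) I) < e" if "n \<ge> M" "m \<ge> M" for m n I
      using that by (metis dist_commute nle_le)
    thus "\<exists>M. \<forall>x\<in>UNIV. \<forall>m\<ge>M. \<forall>n\<ge>M. dist (Poly_Mapping.lookup (V m) x) (Poly_Mapping.lookup (V n) x) < e" by blast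
  qed
  from Cauchy_uniformly_convergent[OF this] obtain a where a: "heis_sup_tendsto V a"
    unfolding uniformly_convergent_on_def heis_sup_tendsto_def by blast
  have FV: "fps_sup_tendsto (\<lambda>n. F_S (V n)) f"
    unfolding fps_sup_tendsto_def
  proof (rule uniform_limit_geometric)
    fix n k
    have "dist (fps_nth f k) (fps_nth (F_S (V n)) k) \<le> C * (1 / 8) ^ n"
      using lim[of n] unfolding dist_q2 fps_le_def fps_sub_nth by blast
    thus "dist (fps_nth (F_S (V n)) k) (fps_nth f k) \<le> C * (1 / 8) ^ n"
      by (subst dist_commute)
  qed
  have all: "fps_sup_tendsto (\<lambda>n. F_S (v n)) f" if v: "heis_sup_tendsto v a" for v
    unfolding fps_sup_tendsto_def
  proof (rule uniform_limitI)
    fix e :: real assume e: "e > 0"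
    have "\<forall>\<^sub>F n in sequentially. \<forall>I\<in>UNIV. dist (Poly_Mapping.lookup (v n) I) (a I) < e / 4"
      "\<forall>\<^sub>F n in sequentially. \<forall>I\<in>UNIV. dist (Poly_Mapping.lookup (V n) I) (a I) < e / 4"
      "\<forall>\<^sub>F n in sequentially. \<forall>k\<in>UNIV. dist (fps_nth (F_S (V n)) k) (fps_nth f k) < e / 4"
      using uniform_limitD[OF v[unfolded heis_sup_tendsto_def], of "e / 4"]
        uniform_limitD[OF a[unfolded heis_sup_tendsto_def], of "e / 4"]
        uniform_limitD[OF FV[unfolded fps_sup_tendsto_def], of "e / 4"] e by auto
    thus "\<forall>\<^sub>F n in sequentially. \<forall>k\<in>UNIV. dist (fps_nth (F_S (v n)) k) (fps_nth f k) < e"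
    proof eventually_elim
      case (elim n)
      have "dist (Poly_Mapping.lookup (v n) I) (Poly_Mapping.lookup (V n) I) \<le> e / 2" for I
        using elim(1)[rule_format, of I] elim(2)[rule_format, of I]
          dist_triangle2[of "Poly_Mapping.lookup (v n) I" "Poly_Mapping.lookup (V n) I" "a I"] by simp
      hence "heis_le (v n - V n) (e / 2)" by (simp add: heis_le_def lookup_minus dist_q2)
      hence "fps_le (F_S (v n) - F_S (V n)) (e / 2)"
        using fps_le_F_S[of "v n - V n" "e / 2"] e by (simp add: F_S_diff)
      hence vV: "dist (fps_nth (F_S (v n)) k) (fps_nth (F_S (V n)) k) \<le> e / 2" for k
        by (simp add: fps_le_def dist_q2)
      show ?case
      proof
        fix k
        show "dist (fps_nth (F_S (v n)) k) (fps_nth f k) < e"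
          using vV[of k] elim(3)[rule_format, of k] e
            dist_triangle[of "fps_nth (F_S (v n)) k" "fps_nth f k" "fps_nth (F_S (V n)) k"] by simp
      qed
    qed
  qed
  have "f \<in> M2" unfolding M2_def
    by (intro CollectI exI[of _ "\<lambda>n. F_S (V n)"] conjI allI mf FV)
  have "F_S_hat a = f" unfolding F_S_hat_def
  proof (rule the_equality)
    show "f \<in> M2 \<and> (\<forall>v. heis_sup_tendsto v a \<longrightarrow> fps_sup_tendsto (\<lambda>n. F_S (v n)) f)"
      using \<open>f \<in> M2\<close> all by blast
    fix g assume "g \<in> M2 \<and> (\<forall>v. heis_sup_tendsto v a \<longrightarrow> fps_sup_tendsto (\<lambda>n. F_S (v n)) g)"
    hence "fps_sup_tendsto (\<lambda>n. F_S (V n)) g" using a by blast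
    hence "(\<lambda>n. fps_nth (F_S (V n)) k) \<longlonglongrightarrow> fps_nth g k" "(\<lambda>n. fps_nth (F_S (V n)) k) \<longlonglongrightarrow> fps_nth f k" for k
      using FV unfolding fps_sup_tendsto_def by (auto intro: tendsto_uniform_limitI)
    thus "g = f" using LIMSEQ_unique by (intro fps_ext) blast
  qed
  moreover have "a \<in> S1" using a by (auto simp: S1_def)
  ultimately show ?thesis by blast
qed

lemma fps_le_lambda: "fps_le lambda 1"
proof -
  have Sig: "fps_le (Sig k) 1" for k
    unfolding fps_le_def Sig_def lambert_nth
    using norm2_of_nat_le by (auto intro!: norm2_sum_le simp flip: of_nat_power)
  hence V: "fps_le (fps_V (Sig k)) 1" for k by (auto simp: fps_le_def fps_V_nth)
  have num: "fps_le (numeral w) 1" for w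
    using fps_le_const[OF norm2_numeral_le] by (simp add: fps_numeral_fps_const)
  note mult1 = fps_le_mult[where B = 1 and C = 1, simplified]
  have A: "fps_le lambda_den 1" and B: "fps_le lambda_num 1"
    unfolding lambda_den_def lambda_num_def
    by (intro fps_le_add fps_le_diff mult1 fps_le_one num V Sig)+
  have A0: "fps_nth lambda_den 0 = 1"
    by (simp add: lambda_den_def fps_V_nth Sig_def lambert_nth fps_numeral_fps_const)
  have "norm2 (fps_nth lambda n) \<le> 1" for n
  proof (induction n rule: less_induct)
    case (less n)
    have "fps_nth lambda_num n = (\<Sum>i=0..n. fps_nth lambda i * fps_nth lambda_den (n - i))"
      unfolding lambda_quotient(1)[symmetric] by (rule fps_mult_nth)
    also have "\<dots> = fps_nth lambda n + (\<Sum>i=0..<n. fps_nth lambda i * fps_nth lambda_den (n - i))"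
      using A0 by (cases n) (simp_all add: atLeastLessThanSuc_atLeastAtMost add.commute)
    finally have "fps_nth lambda n = fps_nth lambda_num n - (\<Sum>i=0..<n. fps_nth lambda i * fps_nth lambda_den (n - i))"
      by simp
    moreover have "norm2 (\<Sum>i=0..<n. fps_nth lambda i * fps_nth lambda_den (n - i)) \<le> 1"
      using less A by (intro norm2_sum_le norm2_mult_le1) (auto simp: fps_le_def)
    moreover have "norm2 (fps_nth lambda_num n) \<le> 1" using B by (simp add: fps_le_def)
    ultimately show ?case
      using norm2_ultra[of "fps_nth lambda_num n" "- (\<Sum>i=0..<n. fps_nth lambda i * fps_nth lambda_den (n - i))"] by simp
  qed
  thus ?thesis by (simp add: fps_le_def)
qed

lemma norm2_two: "norm2 2 = 1 / 2"
proof -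
  have "norm2 2 = abs2 2" using norm2_of_rat[of 2] by simp
  also have "\<dots> = 2 powi (int (multiplicity 2 (1::int)) - int (multiplicity 2 (2::int)))"
    using abs2_of_int_div[of 2 1] by simp
  also have "\<dots> = 1 / 2" by (simp add: power_int_minus)
  finally show ?thesis .
qed

lemma norm2_8_power: "norm2 (8 ^ n) = (1 / 8) ^ n"
proof -
  have "norm2 8 = norm2 (2 * 2 * 2)" by simp
  also have "\<dots> = 1 / 8" unfolding norm2_mult norm2_two by simp
  finally have 8: "norm2 8 = 1 / 8" .
  show ?thesis unfolding norm2_power 8 ..
qed

text \<open>
  \<open>E\<^sub>4\<^sup>3 = 1 + 8 contraction_base\<close> and \<open>E\<^sub>4\<^sup>3 - E\<^sub>6\<^sup>2 = 216 contraction_factor\<close>.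
\<close>

definition contraction_base :: "q2 fps" where
  "contraction_base = 45 * (2 * Sig 3) + 5400 * (2 * Sig 3) ^ 2 + 216000 * (2 * Sig 3) ^ 3"

definition contraction_factor :: "q2 fps" where
  "contraction_factor = fps_const (1 / 27) * (contraction_base + 63 * (2 * Sig 5) - 7938 * (2 * Sig 5) ^ 2)"

definition contraction :: "q2 fps \<Rightarrow> q2 fps" where
  "contraction g = contraction_factor * (1 + 32 * g) ^ 3 - 8 * contraction_base * g"

definition contraction_slope :: "q2 fps \<Rightarrow> q2 fps \<Rightarrow> q2 fps" where
  "contraction_slope g h = 4 * contraction_factor * ((1 + 32 * g) ^ 2 + (1 + 32 * g) * (1 + 32 * h) + (1 + 32 * h) ^ 2) - contraction_base"

definition contraction_iter :: "nat \<Rightarrow> q2 fps" where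
  "contraction_iter n = (contraction ^^ n) 0"

lemma contraction_base_in: "contraction_base \<in> int_span"
  unfolding contraction_base_def by (intro int_span_intros)

lemma contraction_factor_in: "contraction_factor \<in> int_span"
proof -
  have "norm2 (27 :: q2) = 1" using norm2_odd[of 27] by simp
  hence "norm2 (1 / 27) \<le> 1" using norm2_mult[of "1 / 27" 27] by simp
  thus ?thesis unfolding contraction_factor_def by (intro int_span_intros contraction_base_in int_span_const)
qed

lemma contraction_diff: "contraction g - contraction h = 8 * (g - h) * contraction_slope g h"
  unfolding contraction_def contraction_slope_def by algebra

lemma contraction_iter_in: "contraction_iter n \<in> int_span"
proof (induction n)
  case (Suc n)
  thus ?case unfolding contraction_iter_def funpow.simps comp_def contraction_def by (intro int_span_intros contraction_base_in contraction_factor_in)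
qed (simp add: contraction_iter_def int_span.zero)

lemma contraction_lambda: "contraction (8 * lambda) = 8 * lambda"
proof -
  define c :: "q2 fps" where "c = fps_const (1 / 27)"
  have c: "27 * c = 1" by (simp add: c_def fps_numeral_fps_const)
  have Q: "Eis 4 ^ 3 = 1 + 8 * contraction_base" unfolding Eis_4 contraction_base_def by algebra
  have "Eis 4 ^ 3 - Eis 6 ^ 2 = 8 * (27 * contraction_factor)"
    unfolding Q unfolding contraction_factor_def c_def[symmetric] Eis_6 using c by algebra
  with lambda_quotient(2) have "8 * 27 * contraction (8 * lambda) = 8 * 27 * (8 * lambda)"
    unfolding Q contraction_def by algebra
  thus ?thesis unfolding mult_cancel_left by simp
qed

lemma contraction_iter_Suc_diff: "\<exists>t\<in>int_span. contraction_iter (Suc n) - contraction_iter n = 8 ^ n * t"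
proof (induction n)
  case 0
  show ?case using contraction_iter_in[of 1] by (intro bexI[of _ "contraction_iter 1"]) (simp_all add: contraction_iter_def)
next
  case (Suc n)
  then obtain t where t: "t \<in> int_span" "contraction_iter (Suc n) - contraction_iter n = 8 ^ n * t" by blast
  have "contraction_iter (Suc (Suc n)) - contraction_iter (Suc n) = contraction (contraction_iter (Suc n)) - contraction (contraction_iter n)" by (simp add: contraction_iter_def)
  also have "\<dots> = 8 ^ Suc n * (t * contraction_slope (contraction_iter (Suc n)) (contraction_iter n))" unfolding contraction_diff t(2) by simp
  finally have "contraction_iter (Suc (Suc n)) - contraction_iter (Suc n) = 8 ^ Suc n * (t * contraction_slope (contraction_iter (Suc n)) (contraction_iter n))" .
  moreover have "t * contraction_slope (contraction_iter (Suc n)) (contraction_iter n) \<in> int_span"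
    unfolding contraction_slope_def by (intro int_span_intros contraction_iter_in contraction_base_in contraction_factor_in t(1))
  ultimately show ?case by blast
qed

lemma lambda_iter_diff: "\<exists>t. fps_le t 1 \<and> 8 * lambda - contraction_iter n = 8 ^ n * t"
proof (induction n)
  case 0
  have "fps_le (8 * lambda) (1 * 1)"
    by (intro fps_le_mult fps_le_lambda int_span_fps_le int_span_numeral) auto
  thus ?case by (intro exI[of _ "8 * lambda"]) (simp add: contraction_iter_def)
next
  case (Suc n)
  then obtain t where t: "fps_le t 1" "8 * lambda - contraction_iter n = 8 ^ n * t" by blast
  note mult1 = fps_le_mult[where B = 1 and C = 1, simplified]
  have le: "fps_le (numeral v) 1" "fps_le contraction_factor 1" "fps_le contraction_base 1" "fps_le (contraction_iter n) 1" for v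
    by (intro int_span_fps_le int_span_numeral contraction_factor_in contraction_base_in contraction_iter_in)+
  have "fps_le (contraction_slope (8 * lambda) (contraction_iter n)) 1"
    unfolding contraction_slope_def power2_eq_square
    by (intro fps_le_add fps_le_diff mult1 le fps_le_one fps_le_lambda)
  hence "fps_le (t * contraction_slope (8 * lambda) (contraction_iter n)) 1" by (intro mult1 t(1))
  moreover have "8 * lambda - contraction_iter (Suc n) = contraction (8 * lambda) - contraction (contraction_iter n)" by (simp add: contraction_iter_def contraction_lambda)
  moreover have "\<dots> = 8 ^ Suc n * (t * contraction_slope (8 * lambda) (contraction_iter n))" unfolding contraction_diff t(2) by simp
  ultimately show ?case by metis
qed

theorem theorem1p2:
  fixes p :: "q2 poly"
  shows "poly (map_poly fps_const p) lambda \<in> F_S_hat ` S1"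
proof -
  define d where "d = degree p"
  define e where "e i = coeff p i / 8 ^ i" for i
  define h where "h x = (\<Sum>i\<le>d. fps_const (e i) * x ^ i)" for x
  define C where "C = (\<Sum>i\<le>d. norm2 (e i))"
  have C0: "C \<ge> 0" by (simp add: C_def sum_nonneg)
  have eC: "norm2 (e i) \<le> C" if "i \<le> d" for i
    unfolding C_def using that by (intro member_le_sum) auto
  have f: "poly (map_poly fps_const p) lambda = h (8 * lambda)"
  proof -
    have "poly (map_poly fps_const p) lambda = (\<Sum>i\<le>d. fps_const (coeff p i) * lambda ^ i)"
      by (simp add: poly_altdef d_def degree_map_poly coeff_map_poly)
    also have "\<dots> = h (8 * lambda)" unfolding h_def
    proof (intro sum.cong refl)
      fix i
      have "fps_const (coeff p i) = fps_const (e i) * 8 ^ i"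
        by (simp add: e_def fps_numeral_fps_const fps_const_power)
      thus "fps_const (coeff p i) * lambda ^ i = fps_const (e i) * (8 * lambda) ^ i"
        by (simp add: power_mult_distrib mult_ac)
    qed
    finally show ?thesis .
  qed
  have diff: "h x - h y = (\<Sum>i\<le>d. fps_const (e i * 8 ^ n) * (t * (\<Sum>j<i. y ^ (i - Suc j) * x ^ j)))"
    if "x - y = 8 ^ n * t" for x y t n
    unfolding h_def sum_subtractf[symmetric]
  proof (intro sum.cong refl)
    fix i
    have 8: "fps_const (e i * 8 ^ n) = fps_const (e i) * 8 ^ n"
      by (simp add: fps_numeral_fps_const fps_const_power)
    have "fps_const (e i) * x ^ i - fps_const (e i) * y ^ i = fps_const (e i) * ((x - y) * (\<Sum>j<i. y ^ (i - Suc j) * x ^ j))"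
      by (simp only: right_diff_distrib[symmetric] power_diff_sumr2)
    thus "fps_const (e i) * x ^ i - fps_const (e i) * y ^ i =
      fps_const (e i * 8 ^ n) * (t * (\<Sum>j<i. y ^ (i - Suc j) * x ^ j))"
      unfolding that 8 by (simp only: mult.assoc)
  qed
  have norm: "norm2 (e i * 8 ^ n) \<le> C * (1 / 8) ^ n" if "i \<le> d" for i n
    unfolding norm2_mult norm2_8_power using eC[OF that] by (intro mult_right_mono) auto
  have "\<forall>n. \<exists>\<delta>. heis_le \<delta> (C * (1 / 8) ^ n) \<and> F_S \<delta> = h (contraction_iter (Suc n)) - h (contraction_iter n)"
  proof
    fix n
    obtain t where t: "t \<in> int_span" "contraction_iter (Suc n) - contraction_iter n = 8 ^ n * t" using contraction_iter_Suc_diff by blast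
    have "t * (\<Sum>j<i. contraction_iter n ^ (i - Suc j) * contraction_iter (Suc n) ^ j) \<in> int_span" for i
      by (intro int_span_intros int_span_sum t(1) contraction_iter_in)
    hence "\<forall>i. \<exists>u. heis_le u 1 \<and> F_S u = t * (\<Sum>j<i. contraction_iter n ^ (i - Suc j) * contraction_iter (Suc n) ^ j)"
      by (intro allI int_span_image)
    from choice[OF this] obtain u where u: "\<And>i. heis_le (u i) 1"
      "\<And>i. F_S (u i) = t * (\<Sum>j<i. contraction_iter n ^ (i - Suc j) * contraction_iter (Suc n) ^ j)" by blast
    have "heis_le (\<Sum>i\<le>d. heis_const (e i * 8 ^ n) * u i) (C * (1 / 8) ^ n)"
      using heis_le_const[OF norm u(1)] C0 by (intro heis_le_sum) auto
    thus "\<exists>\<delta>. heis_le \<delta> (C * (1 / 8) ^ n) \<and> F_S \<delta> = h (contraction_iter (Suc n)) - h (contraction_iter n)"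
      by (intro exI[of _ "\<Sum>i\<le>d. heis_const (e i * 8 ^ n) * u i"])
        (simp add: F_S_sum F_S_const u(2) diff[OF t(2)])
  qed
  from choice[OF this] obtain \<delta> where \<delta>: "\<And>n. heis_le (\<delta> n) (C * (1 / 8) ^ n)"
    "\<And>n. F_S (\<delta> n) = h (contraction_iter (Suc n)) - h (contraction_iter n)" by blast
  define V where "V n = heis_const (e 0) * 1 + (\<Sum>k<n. \<delta> k)" for n
  have FV: "F_S (V n) = h (contraction_iter n)" for n
  proof (induction n)
    case 0
    have "h 0 = (\<Sum>i\<le>d. if i = 0 then fps_const (e i) else 0)"
      unfolding h_def by (intro sum.cong refl) (simp add: power_0_left)
    hence "h (contraction_iter 0) = fps_const (e 0)" by (simp add: contraction_iter_def)
    thus ?case by (simp only: V_def F_S_add F_S_const F_S_one) simp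
  next
    case (Suc n)
    have "F_S (V (Suc n)) = F_S (V n) + F_S (\<delta> n)" by (simp add: V_def F_S_add add.assoc)
    thus ?case by (simp add: Suc \<delta>(2))
  qed
  show ?thesis unfolding f
  proof (rule F_S_hat_criterion[OF _ _ _ C0])
    fix n
    show "F_S (V n) \<in> modular_forms" unfolding FV h_def
      by (intro modular_forms_sum modular_forms_const_mult int_span_modular int_span_power contraction_iter_in)
    show "heis_le (V (Suc n) - V n) (C * (1 / 8) ^ n)" using \<delta>(1)[of n] by (simp add: V_def)
    obtain t where t: "fps_le t 1" "8 * lambda - contraction_iter n = 8 ^ n * t" using lambda_iter_diff by blast
    note mult1 = fps_le_mult[where B = 1 and C = 1, simplified]
    have pow: "fps_le (g ^ k) 1" if "fps_le g 1" for g k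
      by (induction k) (simp_all add: fps_le_one mult1 that)
    have le8: "fps_le (8 * lambda) 1" by (intro mult1 fps_le_lambda int_span_fps_le int_span_numeral)
    have "fps_le (t * (\<Sum>j<i. contraction_iter n ^ (i - Suc j) * (8 * lambda) ^ j)) 1" for i
      by (intro mult1 t(1) fps_le_sum pow[OF le8] pow[OF int_span_fps_le[OF contraction_iter_in]]) auto
    hence "fps_le (fps_const (e i * 8 ^ n) * (t * (\<Sum>j<i. contraction_iter n ^ (i - Suc j) * (8 * lambda) ^ j))) (C * (1 / 8) ^ n * 1)"
      if "i \<le> d" for i
      using that C0 by (intro fps_le_mult fps_le_const norm) auto
    thus "fps_le (h (8 * lambda) - F_S (V n)) (C * (1 / 8) ^ n)"
      unfolding FV diff[OF t(2)] using C0 by (intro fps_le_sum) auto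
  qed
qed


end
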